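(* Let $\nu>0$ and let $u$ be a smooth solution of the Navier-Stokes equation $\partial_t u+\mathbb{P}(\operatorname{curl}u\times u)+\nu\operatorname{curl}^2u=0$, $\operatorname{div}u=0$, $u(0)=u_0$, on $[0,T)\times\mathbb{R}^3$. Then for all $t\in[0,T)$ and for each choice of sign $\pm$, $$\|\mathbf{C}_\pm^{1/2}u(t)\|_{L^2}^2+2\nu\int_0^t\|\mathbf{C}_\pm^{3/2}u(t')\|_{L^2}^2dt'+\int_0^t\int_{\mathbb{R}^3}\det(\operatorname{curl}u,u,|D|u)\,dx\,dt'=\|\mathbf{C}_\pm^{1/2}u_0\|_{L^2}^2 .$$ One has also $$\|u(t)\|_{\dot H^{1/2}}^2+2\nu\int_0^t\|u(t')\|_{\dot H^{3/2}}^2dt'+2\int_0^t\int_{\mathbb{R}^3}\det(\operatorname{curl}u,u,|D|u)\,dx\,dt'=\|u_0\|_{\dot H^{1/2}}^2 .$$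
   Context: $\mathbb{P}$ is the Leray projection (orthogonal projection of $L^2(\mathbb{R}^3)$ onto divergence-free fields). A smooth solution on $[0,T)$ is a real-valued solution, smooth in $(t,x)$ and of finite energy, with $u\in C([0,T);H^s(\mathbb{R}^3))$ for every $s\ge0$. $|D|=(-\Delta)^{1/2}$, $\mathbf{C}=\operatorname{curl}$, $\mathbb{Q}_\pm=\tfrac12(\mathbb{P}\pm\mathbf{C}|D|^{-1})$ and, for $s\in\mathbb{R}$, $\mathbf{C}_\pm^s=|D|^s\mathbb{Q}_\pm$ (all Fourier multipliers). The homogeneous norms are $\|u\|_{\dot H^s}=\||D|^su\|_{L^2}$, and $\det(a,b,c)=(a\times b)\cdot c$ pointwise. *)

theory Defs
  imports "HOL-Analysis.Analysis"
begin

section \<open>Differential operators on \<open>\<real>\<^sup>3\<close>\<close>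

definition partial :: "3 \<Rightarrow> (real^3 \<Rightarrow> real) \<Rightarrow> real^3 \<Rightarrow> real" where
  "partial i f x = frechet_derivative f (at x) (axis i 1)"

definition gradient :: "(real^3 \<Rightarrow> real) \<Rightarrow> real^3 \<Rightarrow> real^3" where
  "gradient f x = (\<chi> i. partial i f x)"

definition divergence :: "(real^3 \<Rightarrow> real^3) \<Rightarrow> real^3 \<Rightarrow> real" where
  "divergence v x = (\<Sum>i\<in>UNIV. partial i (\<lambda>y. v y $ i) x)"

definition curl :: "(real^3 \<Rightarrow> real^3) \<Rightarrow> real^3 \<Rightarrow> real^3" where
  "curl v x = vector
    [partial 2 (\<lambda>y. v y $ 3) x - partial 3 (\<lambda>y. v y $ 2) x,
     partial 3 (\<lambda>y. v y $ 1) x - partial 1 (\<lambda>y. v y $ 3) x,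
     partial 1 (\<lambda>y. v y $ 2) x - partial 2 (\<lambda>y. v y $ 1) x]"

definition det3 :: "real^3 \<Rightarrow> real^3 \<Rightarrow> real^3 \<Rightarrow> real" where
  "det3 a b c = cross3 a b \<bullet> c"

text \<open>
  Derivatives are taken within \<open>S\<close>, so that \<open>S\<close> may contain boundary points; for a convex
  \<open>S\<close> with nonempty interior they are unique.
\<close>

primrec Ck_on :: "'a::real_normed_vector set \<Rightarrow> nat \<Rightarrow> ('a \<Rightarrow> 'b::real_normed_vector) \<Rightarrow> bool" where
  "Ck_on S 0 f \<longleftrightarrow> continuous_on S f"
| "Ck_on S (Suc k) f \<longleftrightarrow>
     (\<exists>f'. (\<forall>x\<in>S. (f has_derivative f' x) (at x within S)) \<and> (\<forall>v. Ck_on S k (\<lambda>x. f' x v)))"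

definition smooth_on :: "'a::real_normed_vector set \<Rightarrow> ('a \<Rightarrow> 'b::real_normed_vector) \<Rightarrow> bool" where
  "smooth_on S f \<longleftrightarrow> (\<forall>k. Ck_on S k f)"

definition test_function :: "(real^3 \<Rightarrow> real) \<Rightarrow> bool" where
  "test_function \<phi> \<longleftrightarrow> smooth_on UNIV \<phi> \<and> compact (closure {x. \<phi> x \<noteq> 0})"


section \<open>The space \<open>L\<^sup>2\<close> and the Leray projection\<close>

text \<open>
  Elements of \<open>L\<^sup>2\<close> are represented by functions; the operators below return an
  arbitrary representative, determined up to a null set.
\<close>

definition L2 :: "(real^3 \<Rightarrow> 'b::euclidean_space) \<Rightarrow> bool" where
  "L2 f \<longleftrightarrow> f \<in> borel_measurable lborel \<and> integrable lborel (\<lambda>x. (norm (f x))\<^sup>2)"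

definition L2_norm :: "(real^3 \<Rightarrow> 'b::euclidean_space) \<Rightarrow> real" where
  "L2_norm f = sqrt (LINT x|lborel. (norm (f x))\<^sup>2)"

definition L2_div_free :: "(real^3 \<Rightarrow> real^3) \<Rightarrow> bool" where
  "L2_div_free g \<longleftrightarrow>
     L2 g \<and> (\<forall>\<phi>. test_function \<phi> \<longrightarrow> (LINT x|lborel. g x \<bullet> gradient \<phi> x) = 0)"

definition leray :: "(real^3 \<Rightarrow> real^3) \<Rightarrow> real^3 \<Rightarrow> real^3" where
  "leray f = (SOME g. L2_div_free g \<and>
     (\<forall>h. L2_div_free h \<longrightarrow> (LINT x|lborel. (f x - g x) \<bullet> h x) = 0))"


section \<open>Fourier transform on \<open>L\<^sup>2\<close> and Fourier multipliers\<close>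

definition fourier_ball :: "real \<Rightarrow> (real^3 \<Rightarrow> real^3) \<Rightarrow> real^3 \<Rightarrow> complex^3" where
  "fourier_ball R f \<xi> =
     (\<chi> j. LINT x:cball 0 R|lborel. cis (- (x \<bullet> \<xi>)) * complex_of_real (f x $ j))"

text \<open>
  Plancherel's transform: the \<open>L\<^sup>2\<close>-limit, as \<open>R \<rightarrow> \<infinity>\<close>, of the integrals over balls of
  radius \<open>R\<close>, with the normalization \<open>\<integral> e\<^sup>-\<^sup>i\<^sup>x\<^sup>\<cdot>\<^sup>\<xi> f(x) dx\<close>.
\<close>

definition is_fourier :: "(real^3 \<Rightarrow> real^3) \<Rightarrow> (real^3 \<Rightarrow> complex^3) \<Rightarrow> bool" where
  "is_fourier f g \<longleftrightarrow> L2 f \<and> L2 g \<and>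
     ((\<lambda>R. \<integral>\<^sup>+ \<xi>. ennreal ((norm (fourier_ball R f \<xi> - g \<xi>))\<^sup>2) \<partial>lborel) \<longlongrightarrow> 0) at_top"

definition fourier :: "(real^3 \<Rightarrow> real^3) \<Rightarrow> real^3 \<Rightarrow> complex^3" where
  "fourier f = (SOME g. is_fourier f g)"

text \<open>
  The symbol \<open>m \<xi>\<close> is a linear map on \<open>\<complex>\<^sup>3\<close>. All symbols used here satisfy
  \<open>m (-\<xi>) (cnj v) = cnj (m \<xi> v)\<close>, so that the multipliers preserve real-valued fields.
  The value is meaningful for \<open>f\<close> in the domain, i.e. when \<open>m \<xi> (fourier f \<xi>)\<close> is in \<open>L\<^sup>2\<close>.
\<close>

definition multiplier ::
    "(real^3 \<Rightarrow> complex^3 \<Rightarrow> complex^3) \<Rightarrow> (real^3 \<Rightarrow> real^3) \<Rightarrow> real^3 \<Rightarrow> real^3" where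
  "multiplier m f =
     (SOME h. L2 h \<and> (AE \<xi> in lborel. fourier h \<xi> = m \<xi> (fourier f \<xi>)))"

definition abs_D_powr :: "real \<Rightarrow> (real^3 \<Rightarrow> real^3) \<Rightarrow> real^3 \<Rightarrow> real^3" where
  "abs_D_powr s = multiplier (\<lambda>\<xi> v. (norm \<xi> powr s) *\<^sub>R v)"

definition curl_symbol :: "real^3 \<Rightarrow> complex^3 \<Rightarrow> complex^3" where
  "curl_symbol \<xi> v = vector
    [\<i> * (complex_of_real (\<xi> $ 2) * v $ 3 - complex_of_real (\<xi> $ 3) * v $ 2),
     \<i> * (complex_of_real (\<xi> $ 3) * v $ 1 - complex_of_real (\<xi> $ 1) * v $ 3),
     \<i> * (complex_of_real (\<xi> $ 1) * v $ 2 - complex_of_real (\<xi> $ 2) * v $ 1)]"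

text \<open>
  \<open>curl |D|\<^sup>-\<^sup>1\<close> is a single multiplier of order zero, because \<open>|D|\<^sup>-\<^sup>1 f\<close> itself need
  not be in \<open>L\<^sup>2\<close>.
\<close>

definition curl_inv_abs_D :: "(real^3 \<Rightarrow> real^3) \<Rightarrow> real^3 \<Rightarrow> real^3" where
  "curl_inv_abs_D = multiplier (\<lambda>\<xi> v. (norm \<xi> powr (-1)) *\<^sub>R curl_symbol \<xi> v)"

text \<open>In the next two definitions the sign is \<open>\<sigma> = 1\<close> or \<open>\<sigma> = -1\<close>.\<close>

definition Q_sign :: "real \<Rightarrow> (real^3 \<Rightarrow> real^3) \<Rightarrow> real^3 \<Rightarrow> real^3" where
  "Q_sign \<sigma> f = (\<lambda>x. (1/2) *\<^sub>R (leray f x + \<sigma> *\<^sub>R curl_inv_abs_D f x))"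

definition C_sign :: "real \<Rightarrow> real \<Rightarrow> (real^3 \<Rightarrow> real^3) \<Rightarrow> real^3 \<Rightarrow> real^3" where
  "C_sign \<sigma> s f = abs_D_powr s (Q_sign \<sigma> f)"

definition hom_sobolev_norm :: "real \<Rightarrow> (real^3 \<Rightarrow> real^3) \<Rightarrow> real" where
  "hom_sobolev_norm s f = L2_norm (abs_D_powr s f)"

definition sobolev :: "real \<Rightarrow> (real^3 \<Rightarrow> real^3) \<Rightarrow> bool" where
  "sobolev s f \<longleftrightarrow>
     L2 f \<and> integrable lborel (\<lambda>\<xi>. (1 + (norm \<xi>)\<^sup>2) powr s * (norm (fourier f \<xi>))\<^sup>2)"

text \<open>The factor \<open>(2\<pi>)\<^sup>-\<^sup>3\<close> makes the norm for \<open>s = 0\<close> the \<open>L\<^sup>2\<close> norm.\<close>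

definition sobolev_norm :: "real \<Rightarrow> (real^3 \<Rightarrow> real^3) \<Rightarrow> real" where
  "sobolev_norm s f =
     sqrt ((LINT \<xi>|lborel. (1 + (norm \<xi>)\<^sup>2) powr s * (norm (fourier f \<xi>))\<^sup>2) / (2 * pi) ^ 3)"


section \<open>Smooth solutions of the Navier-Stokes equation\<close>

definition time_interval :: "ereal \<Rightarrow> real set" where
  "time_interval T = {t. 0 \<le> t \<and> ereal t < T}"

definition continuous_in_sobolev :: "real \<Rightarrow> ereal \<Rightarrow> (real \<Rightarrow> real^3 \<Rightarrow> real^3) \<Rightarrow> bool" where
  "continuous_in_sobolev s T u \<longleftrightarrow>
     (\<forall>t\<in>time_interval T. sobolev s (u t) \<and>
        ((\<lambda>\<tau>. sobolev_norm s (\<lambda>x. u \<tau> x - u t x)) \<longlongrightarrow> 0) (at t within time_interval T))"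

definition smooth_NS_solution ::
    "real \<Rightarrow> ereal \<Rightarrow> (real \<Rightarrow> real^3 \<Rightarrow> real^3) \<Rightarrow> (real^3 \<Rightarrow> real^3) \<Rightarrow> bool" where
  "smooth_NS_solution \<nu> T u u0 \<longleftrightarrow>
     smooth_on (time_interval T \<times> UNIV) (\<lambda>(t, x). u t x) \<and>
     (\<forall>t\<in>time_interval T. L2 (u t)) \<and>
     (\<forall>s\<ge>0. continuous_in_sobolev s T u) \<and>
     (\<forall>t\<in>time_interval T. AE x in lborel.
        vector_derivative (\<lambda>\<tau>. u \<tau> x) (at t within time_interval T)
        + leray (\<lambda>y. cross3 (curl (u t) y) (u t y)) x
        + \<nu> *\<^sub>R curl (curl (u t)) x = 0) \<and>
     (\<forall>t\<in>time_interval T. \<forall>x. divergence (u t) x = 0) \<and>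
     u 0 = u0"

end

theory Submission
  imports Defs "HOL-Probability.Probability"
begin

text \<open>
  Set \<open>w = (|D| u + \<sigma> curl u) / 2\<close>. For divergence-free \<open>u\<close> this is \<open>|D| Q\<^sub>\<sigma> u\<close>, where \<open>Q\<^sub>\<sigma>\<close> is an
  orthogonal projection commuting with \<open>|D|\<close>. Hence \<open>\<parallel>|D|\<^sup>1\<^sup>/\<^sup>2 Q\<^sub>\<sigma> u\<parallel>\<^sup>2 = \<langle>u, w\<rangle>\<close>, and this quadratic form is
  symmetric, so its time derivative is \<open>2 \<langle>\<partial>\<^sub>t u, w\<rangle>\<close>. Insert the equation. The viscous term gives
  \<open>- 2 \<nu> \<langle>curl curl u, w\<rangle> = - 2 \<nu> \<parallel>|D|\<^sup>3\<^sup>/\<^sup>2 Q\<^sub>\<sigma> u\<parallel>\<^sup>2\<close>. In the nonlinear term the Leray projection drops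
  out, since \<open>w\<close> is divergence-free, and so does \<open>curl u\<close>, since it is pointwise orthogonal to
  \<open>curl u \<times> u\<close>; what remains is \<open>- \<integral> det (curl u, u, |D| u)\<close>, the same for both signs. Integrating in time
  gives the first identity. The second is the sum of the first over the two signs, because the two
  projections are complementary on divergence-free fields.

  To justify the computation, the operators have to be tied to their symbols. The \<open>L\<^sup>2\<close> theory of the
  Fourier transform is built up from the Gaussian: isometry on continuous functions of bounded support
  (\<open>plancherel_isometric_Cc\<close>), on \<open>L\<^sup>1 \<inter> L\<^sup>2\<close> by density, and then Parseval and surjectivity on
  \<open>L\<^sup>2\<close> (\<open>plancherel_pair_surj\<close>, \<open>Parseval\<close>, \<open>is_fourier_surj\<close>), which make every multiplier
  well defined (\<open>multiplier_is_fourier\<close>). Classical derivatives become multipliers through difference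
  quotients (\<open>plancherel_pair_pointwise_derivative\<close>). The Leray projection enters through the
  orthogonality that characterizes it (\<open>L2_div_free_projection\<close>).

  The time derivative is at first only pointwise. By the \<open>H\<^sup>3\<close> bound on the supremum
  (\<open>sobolev_sup_bound\<close>) all terms of the equation are continuous curves in \<open>L\<^sup>2\<close>, hence so is
  \<open>\<partial>\<^sub>t u\<close>, and a mean value inequality in \<open>L\<^sup>2\<close> (\<open>L2_difference_bound\<close>) shows that \<open>u\<close> is differentiable
  as an \<open>L\<^sup>2\<close>-valued curve. This is what the computation needs.
\<close>

section \<open>Square-integrable functions\<close>

definition L2_inner :: "(real^3 \<Rightarrow> 'b::euclidean_space) \<Rightarrow> (real^3 \<Rightarrow> 'b) \<Rightarrow> real" where
  "L2_inner f g = (LINT x|lborel. f x \<bullet> g x)"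

lemma L2_measurable[measurable_dest]: "L2 f \<Longrightarrow> f \<in> borel_measurable borel"
  by (simp add: L2_def)

lemma L2_bound:
  assumes "f \<in> borel_measurable borel" and "integrable lborel w"
    and "AE x in lborel. (norm (f x))\<^sup>2 \<le> w x"
  shows "L2 f"
  unfolding L2_def
proof
  show "f \<in> borel_measurable lborel" using assms by simp
  show "integrable lborel (\<lambda>x. (norm (f x))\<^sup>2)"
  proof (rule Bochner_Integration.integrable_bound[OF assms(2)])
    show "(\<lambda>x. (norm (f x))\<^sup>2) \<in> borel_measurable lborel" using assms(1) by simp
    show "AE x in lborel. norm ((norm (f x))\<^sup>2) \<le> norm (w x)"
      using assms(3) by eventually_elim auto
  qed
qed

lemma L2_zero[simp]: "L2 (\<lambda>x. 0)" by (simp add: L2_def)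

lemma L2_scaleR: assumes "L2 f" shows "L2 (\<lambda>x. c *\<^sub>R f x)"
  using assms by (auto simp: L2_def power_mult_distrib)

lemma L2_minus: assumes "L2 f" shows "L2 (\<lambda>x. - f x)"
  using L2_scaleR[OF assms, of "-1"] by simp

lemma L2_add: assumes "L2 f" "L2 g" shows "L2 (\<lambda>x. f x + g x)"
proof (rule L2_bound)
  show "(\<lambda>x. f x + g x) \<in> borel_measurable borel"
    using L2_measurable[OF assms(1)] L2_measurable[OF assms(2)] by measurable
  show "integrable lborel (\<lambda>x. 2 * (norm (f x))\<^sup>2 + 2 * (norm (g x))\<^sup>2)"
    using assms by (auto simp: L2_def)
  show "AE x in lborel. (norm (f x + g x))\<^sup>2 \<le> 2 * (norm (f x))\<^sup>2 + 2 * (norm (g x))\<^sup>2"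
  proof (rule AE_I2)
    fix x
    have "(norm (f x + g x))\<^sup>2 + (norm (f x - g x))\<^sup>2 = 2 * (norm (f x))\<^sup>2 + 2 * (norm (g x))\<^sup>2"
      by (simp add: power2_norm_eq_inner algebra_simps inner_commute)
    then show "(norm (f x + g x))\<^sup>2 \<le> 2 * (norm (f x))\<^sup>2 + 2 * (norm (g x))\<^sup>2"
      using zero_le_power2[of "norm (f x - g x)"] by linarith
  qed
qed

lemma L2_diff: assumes "L2 f" "L2 g" shows "L2 (\<lambda>x. f x - g x)"
  using L2_add[OF assms(1) L2_minus[OF assms(2)]] by simp

lemma L2_inner_integrable:
  assumes "L2 f" "L2 g" shows "integrable lborel (\<lambda>x. f x \<bullet> g x)"
proof (rule Bochner_Integration.integrable_bound)
  show "integrable lborel (\<lambda>x. (norm (f x))\<^sup>2 + (norm (g x))\<^sup>2)"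
    using assms by (auto simp: L2_def)
  show "(\<lambda>x. f x \<bullet> g x) \<in> borel_measurable lborel"
    using L2_measurable[OF assms(1)] L2_measurable[OF assms(2)] by simp
  show "AE x in lborel. norm (f x \<bullet> g x) \<le> norm ((norm (f x))\<^sup>2 + (norm (g x))\<^sup>2)"
  proof (rule AE_I2)
    fix x
    have "\<bar>f x \<bullet> g x\<bar> \<le> norm (f x) * norm (g x)" by (rule Cauchy_Schwarz_ineq2)
    moreover have "0 \<le> (norm (f x) - norm (g x))\<^sup>2" by simp
    moreover have "0 \<le> norm (f x) * norm (g x)" by simp
    ultimately show "norm (f x \<bullet> g x) \<le> norm ((norm (f x))\<^sup>2 + (norm (g x))\<^sup>2)"
      by (simp add: power2_diff)
  qed
qed

lemma L2_norm_nonneg[simp]: "0 \<le> L2_norm f"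
  by (simp add: L2_norm_def)

lemma L2_norm_sq: "(L2_norm f)\<^sup>2 = (LINT x|lborel. (norm (f x))\<^sup>2)"
  by (simp add: L2_norm_def)

lemma L2_norm_sq_inner: "(L2_norm f)\<^sup>2 = L2_inner f f"
  by (simp add: L2_norm_sq L2_inner_def power2_norm_eq_inner)

lemma nn_integral_norm_sq:
  "L2 f \<Longrightarrow> (\<integral>\<^sup>+x. ennreal ((norm (f x))\<^sup>2) \<partial>lborel) = ennreal ((L2_norm f)\<^sup>2)"
  by (subst nn_integral_eq_integral) (auto simp: L2_def L2_norm_sq)

lemma L2_iff_nn_integral:
  "L2 f \<longleftrightarrow> f \<in> borel_measurable borel \<and> (\<integral>\<^sup>+x. ennreal ((norm (f x))\<^sup>2) \<partial>lborel) < \<infinity>"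
  by (auto simp: L2_def integrable_iff_bounded)

lemma L2_norm_cong_AE:
  assumes "AE x in lborel. f x = g x" "f \<in> borel_measurable borel" "g \<in> borel_measurable borel"
  shows "L2_norm f = L2_norm g"
  unfolding L2_norm_def using assms by (intro arg_cong[of _ _ sqrt] integral_cong_AE) auto

lemma L2_cong_AE:
  assumes "L2 f" "AE x in lborel. f x = g x" "g \<in> borel_measurable borel"
  shows "L2 g"
proof -
  have "(\<integral>\<^sup>+x. ennreal ((norm (f x))\<^sup>2) \<partial>lborel) = (\<integral>\<^sup>+x. ennreal ((norm (g x))\<^sup>2) \<partial>lborel)"
    by (rule nn_integral_cong_AE) (use assms(2) in auto)
  then show ?thesis using assms by (simp add: L2_iff_nn_integral)
qed

lemma L2_inner_commute: "L2_inner f g = L2_inner g f"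
  by (simp add: L2_inner_def inner_commute)

lemma L2_inner_add_left:
  "L2 f \<Longrightarrow> L2 g \<Longrightarrow> L2 h \<Longrightarrow> L2_inner (\<lambda>x. f x + g x) h = L2_inner f h + L2_inner g h"
  by (simp add: L2_inner_def inner_add_left Bochner_Integration.integral_add L2_inner_integrable)

lemma L2_inner_diff_left:
  "L2 f \<Longrightarrow> L2 g \<Longrightarrow> L2 h \<Longrightarrow> L2_inner (\<lambda>x. f x - g x) h = L2_inner f h - L2_inner g h"
  by (simp add: L2_inner_def inner_diff_left Bochner_Integration.integral_diff L2_inner_integrable)

lemma L2_inner_scaleR_left: "L2_inner (\<lambda>x. c *\<^sub>R f x) h = c * L2_inner f h"
  by (simp add: L2_inner_def)

lemma L2_inner_add_right:
  "L2 f \<Longrightarrow> L2 g \<Longrightarrow> L2 h \<Longrightarrow> L2_inner h (\<lambda>x. f x + g x) = L2_inner h f + L2_inner h g"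
  unfolding L2_inner_commute[of h] by (rule L2_inner_add_left)

lemma L2_inner_diff_right:
  "L2 f \<Longrightarrow> L2 g \<Longrightarrow> L2 h \<Longrightarrow> L2_inner h (\<lambda>x. f x - g x) = L2_inner h f - L2_inner h g"
  unfolding L2_inner_commute[of h] by (rule L2_inner_diff_left)

lemma L2_inner_scaleR_right: "L2_inner h (\<lambda>x. c *\<^sub>R f x) = c * L2_inner h f"
  by (simp add: L2_inner_def)

lemmas L2_inner_simps = L2_inner_add_left L2_inner_diff_left L2_inner_scaleR_left
  L2_inner_add_right L2_inner_diff_right L2_inner_scaleR_right

lemma L2_norm_scaleR: "L2_norm (\<lambda>x. c *\<^sub>R f x) = \<bar>c\<bar> * L2_norm f"
  by (simp add: L2_norm_def power_mult_distrib real_sqrt_mult)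

lemma L2_norm_minus_commute: "L2_norm (\<lambda>x. f x - g x) = L2_norm (\<lambda>x. g x - f x)"
  by (simp add: L2_norm_def norm_minus_commute)

lemma L2_norm_eq_0:
  assumes "L2 f" shows "L2_norm f = 0 \<longleftrightarrow> (AE x in lborel. f x = 0)"
proof -
  have "L2_norm f = 0 \<longleftrightarrow> (LINT x|lborel. (norm (f x))\<^sup>2) = 0" by (simp add: L2_norm_def)
  also have "\<dots> \<longleftrightarrow> (AE x in lborel. (norm (f x))\<^sup>2 = 0)"
    using assms by (intro integral_nonneg_eq_0_iff_AE) (auto simp: L2_def)
  finally show ?thesis by simp
qed

lemma L2_norm_sq_add:
  assumes "L2 f" "L2 g"
  shows "(L2_norm (\<lambda>x. f x + g x))\<^sup>2 = (L2_norm f)\<^sup>2 + 2 * L2_inner f g + (L2_norm g)\<^sup>2"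
  using assms by (simp add: L2_norm_sq_inner L2_inner_simps L2_add L2_inner_commute[of g f])

lemma L2_norm_sq_diff:
  assumes "L2 f" "L2 g"
  shows "(L2_norm (\<lambda>x. f x - g x))\<^sup>2 = (L2_norm f)\<^sup>2 - 2 * L2_inner f g + (L2_norm g)\<^sup>2"
  using assms by (simp add: L2_norm_sq_inner L2_inner_simps L2_diff L2_inner_commute[of g f])

text \<open>
  The quadratic polynomial \<open>r \<mapsto> \<parallel>f - r g\<parallel>\<^sup>2\<close> is nonnegative; evaluate it at its minimum when \<open>g\<close>
  is not null, and at a suitable large \<open>r\<close> otherwise.
\<close>

lemma L2_Cauchy_Schwarz:
  assumes "L2 f" "L2 g" shows "\<bar>L2_inner f g\<bar> \<le> L2_norm f * L2_norm g"
proof -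
  let ?p = "L2_inner f g"
  have q: "0 \<le> (L2_norm f)\<^sup>2 - 2 * r * ?p + r\<^sup>2 * (L2_norm g)\<^sup>2" for r
    using L2_norm_sq_diff[OF assms(1) L2_scaleR[OF assms(2), of r]]
      zero_le_power2[of "L2_norm (\<lambda>x. f x - r *\<^sub>R g x)"]
    unfolding L2_inner_simps L2_norm_scaleR power_mult_distrib power2_abs by (simp only: mult.assoc)
  have "?p\<^sup>2 \<le> (L2_norm f)\<^sup>2 * (L2_norm g)\<^sup>2"
  proof (cases "L2_norm g = 0")
    case True
    have "?p = 0"
    proof (rule ccontr)
      assume "?p \<noteq> 0"
      then show False using q[of "((L2_norm f)\<^sup>2 + 1) / (2 * ?p)"] True by simp
    qed
    then show ?thesis by simp
  next
    case False
    then have b: "0 < (L2_norm g)\<^sup>2" by simp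
    have "0 \<le> (L2_norm f)\<^sup>2 - ?p\<^sup>2 / (L2_norm g)\<^sup>2"
    proof -
      define G where "G = (L2_norm g)\<^sup>2"
      have "0 < G" using b by (simp add: G_def)
      then show ?thesis
        using q[of "?p / G"] unfolding G_def[symmetric] by (simp add: power2_eq_square field_simps)
    qed
    then show ?thesis using b by (simp add: field_simps)
  qed
  then have "\<bar>?p\<bar>\<^sup>2 \<le> (L2_norm f * L2_norm g)\<^sup>2" by (simp add: power_mult_distrib)
  then show ?thesis by (rule power2_le_imp_le) simp
qed

lemma L2_norm_triangle:
  assumes "L2 f" "L2 g" shows "L2_norm (\<lambda>x. f x + g x) \<le> L2_norm f + L2_norm g"
proof (rule power2_le_imp_le)
  show "(L2_norm (\<lambda>x. f x + g x))\<^sup>2 \<le> (L2_norm f + L2_norm g)\<^sup>2"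
    using L2_Cauchy_Schwarz[OF assms] by (simp add: L2_norm_sq_add assms power2_sum)
qed simp

lemma L2_norm_triangle_diff:
  assumes "L2 f" "L2 g" "L2 h"
  shows "L2_norm (\<lambda>x. f x - h x) \<le> L2_norm (\<lambda>x. f x - g x) + L2_norm (\<lambda>x. g x - h x)"
  using L2_norm_triangle[OF L2_diff[OF assms(1,2)] L2_diff[OF assms(2,3)]] by simp

lemma L2_norm_le_add_diff:
  assumes "L2 f" "L2 g"
  shows "L2_norm f \<le> L2_norm g + L2_norm (\<lambda>x. f x - g x)"
  using L2_norm_triangle[OF assms(2) L2_diff[OF assms]] by simp

lemma L2_norm_mono:
  fixes f :: "real^3 \<Rightarrow> 'b::euclidean_space" and g :: "real^3 \<Rightarrow> 'c::euclidean_space"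
  assumes "AE x in lborel. norm (f x) \<le> norm (g x)" "L2 g" "f \<in> borel_measurable borel"
  shows "L2 f" "L2_norm f \<le> L2_norm g"
proof -
  have ae: "AE x in lborel. (norm (f x))\<^sup>2 \<le> (norm (g x))\<^sup>2"
    using assms(1) by eventually_elim (simp add: power_mono)
  show "L2 f" using assms ae by (intro L2_bound[of f "\<lambda>x. (norm (g x))\<^sup>2"]) (auto simp: L2_def)
  then show "L2_norm f \<le> L2_norm g"
    unfolding L2_norm_def using assms ae by (intro real_sqrt_le_mono integral_mono_AE) (auto simp: L2_def)
qed

lemma L2_inner_tendsto:
  assumes "\<And>n. L2 (F n)" "\<And>n. L2 (G n)" "L2 f" "L2 g"
    and F: "((\<lambda>n. L2_norm (\<lambda>x. F n x - f x)) \<longlongrightarrow> 0) net"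
    and G: "((\<lambda>n. L2_norm (\<lambda>x. G n x - g x)) \<longlongrightarrow> 0) net"
  shows "((\<lambda>n. L2_inner (F n) (G n)) \<longlongrightarrow> L2_inner f g) net"
proof -
  have "((\<lambda>n. L2_norm (\<lambda>x. F n x - f x) * (L2_norm g + L2_norm (\<lambda>x. G n x - g x))
      + L2_norm f * L2_norm (\<lambda>x. G n x - g x)) \<longlongrightarrow> 0 * (L2_norm g + 0) + L2_norm f * 0) net"
    by (intro tendsto_intros F G)
  then have "((\<lambda>n. L2_norm (\<lambda>x. F n x - f x) * (L2_norm g + L2_norm (\<lambda>x. G n x - g x))
      + L2_norm f * L2_norm (\<lambda>x. G n x - g x)) \<longlongrightarrow> 0) net" by simp
  then have "((\<lambda>n. L2_inner (F n) (G n) - L2_inner f g) \<longlongrightarrow> 0) net"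
  proof (rule Lim_null_comparison[rotated], intro always_eventually allI)
    fix n
    have "L2_inner (F n) (G n) - L2_inner f g
        = L2_inner (\<lambda>x. F n x - f x) (G n) + L2_inner f (\<lambda>x. G n x - g x)"
      using assms by (simp add: L2_inner_simps)
    also have "\<bar>\<dots>\<bar> \<le> L2_norm (\<lambda>x. F n x - f x) * L2_norm (G n) + L2_norm f * L2_norm (\<lambda>x. G n x - g x)"
      using assms by (intro order_trans[OF abs_triangle_ineq] add_mono L2_Cauchy_Schwarz L2_diff)
    also have "\<dots> \<le> L2_norm (\<lambda>x. F n x - f x) * (L2_norm g + L2_norm (\<lambda>x. G n x - g x))
        + L2_norm f * L2_norm (\<lambda>x. G n x - g x)"
      using assms by (intro add_mono mult_left_mono L2_norm_le_add_diff) auto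
    finally show "norm (L2_inner (F n) (G n) - L2_inner f g) \<le> L2_norm (\<lambda>x. F n x - f x) * (L2_norm g + L2_norm (\<lambda>x. G n x - g x))
        + L2_norm f * L2_norm (\<lambda>x. G n x - g x)" by simp
  qed
  then show ?thesis using LIM_zero_iff by blast
qed

lemma L2_norm_tendsto:
  assumes "\<And>n. L2 (F n)" "L2 f"
    and F: "((\<lambda>n. L2_norm (\<lambda>x. F n x - f x)) \<longlongrightarrow> 0) net"
  shows "((\<lambda>n. L2_norm (F n)) \<longlongrightarrow> L2_norm f) net"
proof -
  have "((\<lambda>n. L2_norm (F n) - L2_norm f) \<longlongrightarrow> 0) net"
  proof (rule Lim_null_comparison[OF _ F], intro always_eventually allI)
    fix n
    show "norm (L2_norm (F n) - L2_norm f) \<le> L2_norm (\<lambda>x. F n x - f x)"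
      using L2_norm_le_add_diff[OF assms(1)[of n] assms(2)] L2_norm_le_add_diff[OF assms(2) assms(1)[of n]]
      by (simp add: L2_norm_minus_commute[of f] abs_if)
  qed
  then show ?thesis using LIM_zero_iff by blast
qed

lemma L2_lim_unique:
  assumes "\<And>n. L2 (F n)" "L2 f" "L2 g" "net \<noteq> bot"
    and F: "((\<lambda>n. L2_norm (\<lambda>x. F n x - f x)) \<longlongrightarrow> 0) net"
    and G: "((\<lambda>n. L2_norm (\<lambda>x. F n x - g x)) \<longlongrightarrow> 0) net"
  shows "AE x in lborel. f x = g x"
proof -
  have "((\<lambda>n. L2_norm (\<lambda>x. F n x - f x) + L2_norm (\<lambda>x. F n x - g x)) \<longlongrightarrow> 0 + 0) net"
    by (intro tendsto_intros F G)
  moreover have "L2_norm (\<lambda>x. f x - g x) \<le> L2_norm (\<lambda>x. F n x - f x) + L2_norm (\<lambda>x. F n x - g x)" for n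
    using L2_norm_triangle_diff[OF assms(2) assms(1)[of n] assms(3)] by (simp add: L2_norm_minus_commute[of f])
  ultimately have "L2_norm (\<lambda>x. f x - g x) \<le> 0"
    using \<open>net \<noteq> bot\<close> by (intro tendsto_lowerbound[of _ _ net]) auto
  then have "L2_norm (\<lambda>x. f x - g x) = 0" using L2_norm_nonneg[of "\<lambda>x. f x - g x"] by linarith
  then show ?thesis using L2_norm_eq_0[OF L2_diff[OF assms(2,3)]] by simp
qed

text \<open>
  An \<open>L\<^sup>2\<close> limit and a pointwise limit of the same sequence agree almost everywhere. This is how
  classical derivatives are identified with Fourier multipliers below.
\<close>

lemma L2_lim_AE_subseq:
  assumes "\<And>n. L2 (F n)" "L2 f" and F: "(\<lambda>n::nat. L2_norm (\<lambda>x. F n x - f x)) \<longlonglongrightarrow> 0"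
  obtains r where "strict_mono r" "AE x in lborel. (\<lambda>n. F (r n) x) \<longlonglongrightarrow> f x"
proof -
  have "\<exists>r::nat\<Rightarrow>nat. strict_mono r \<and> (AE x in lborel. (\<lambda>n. (norm (F (r n) x - f x))\<^sup>2) \<longlonglongrightarrow> 0)"
  proof (rule tendsto_L1_AE_subseq)
    show "integrable lborel (\<lambda>x. (norm (F n x - f x))\<^sup>2)" for n
      using L2_diff[OF assms(1)[of n] assms(2)] by (simp add: L2_def)
    have "(\<lambda>n. (L2_norm (\<lambda>x. F n x - f x))\<^sup>2) \<longlonglongrightarrow> 0\<^sup>2" by (intro tendsto_intros F)
    then show "(\<lambda>n. LINT x|lborel. norm ((norm (F n x - f x))\<^sup>2)) \<longlonglongrightarrow> 0"
      by (simp add: L2_norm_sq)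
  qed
  then obtain r where r: "strict_mono r" "AE x in lborel. (\<lambda>n. (norm (F (r n) x - f x))\<^sup>2) \<longlonglongrightarrow> 0"
    by blast
  have "AE x in lborel. (\<lambda>n. F (r n) x) \<longlonglongrightarrow> f x"
    using r(2)
  proof eventually_elim
    case (elim x)
    then have "(\<lambda>n. sqrt ((norm (F (r n) x - f x))\<^sup>2)) \<longlonglongrightarrow> sqrt 0" by (intro tendsto_intros)
    then have "(\<lambda>n. F (r n) x - f x) \<longlonglongrightarrow> 0" by (simp add: tendsto_norm_zero_iff)
    then show ?case by (rule LIM_zero_cancel)
  qed
  with r(1) show ?thesis by (rule that)
qed

text \<open>
  Fatou's lemma; it carries boundedness in \<open>L\<^sup>2\<close> over to pointwise limits.
\<close>

lemma L2_Fatou: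
  assumes F: "\<And>n. L2 (F n)" and "f \<in> borel_measurable borel"
    and lim: "AE x in lborel. (\<lambda>n. F n x) \<longlonglongrightarrow> f x"
    and b: "\<forall>\<^sub>F n in sequentially. L2_norm (F n) \<le> C"
  shows "L2 f" "L2_norm f \<le> C"
proof -
  obtain n0 where "L2_norm (F n0) \<le> C" using eventually_happens'[OF sequentially_bot b] by blast
  then have C: "0 \<le> C" using L2_norm_nonneg[of "F n0"] by linarith
  have [measurable]: "F n \<in> borel_measurable borel" for n using F by (rule L2_measurable)
  note assms(2)[measurable]
  have "(\<integral>\<^sup>+x. ennreal ((norm (f x))\<^sup>2) \<partial>lborel)
      = (\<integral>\<^sup>+x. liminf (\<lambda>n. ennreal ((norm (F n x))\<^sup>2)) \<partial>lborel)"
  proof (rule nn_integral_cong_AE, use lim in eventually_elim)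
    case (elim x)
    then have "(\<lambda>n. ennreal ((norm (F n x))\<^sup>2)) \<longlonglongrightarrow> ennreal ((norm (f x))\<^sup>2)"
      by (intro tendsto_intros)
    then show ?case by (rule lim_imp_Liminf[OF sequentially_bot, symmetric])
  qed
  also have "\<dots> \<le> liminf (\<lambda>n. \<integral>\<^sup>+x. ennreal ((norm (F n x))\<^sup>2) \<partial>lborel)"
    by (rule nn_integral_liminf) simp
  also have "\<dots> = liminf (\<lambda>n. ennreal ((L2_norm (F n))\<^sup>2))"
    by (simp add: nn_integral_norm_sq F)
  also have "\<dots> \<le> ennreal (C\<^sup>2)"
  proof (rule Liminf_le)
    show "\<forall>\<^sub>F n in sequentially. ennreal ((L2_norm (F n))\<^sup>2) \<le> ennreal (C\<^sup>2)"
      using b by eventually_elim (intro ennreal_leI power_mono, auto)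
  qed simp
  finally have le: "(\<integral>\<^sup>+x. ennreal ((norm (f x))\<^sup>2) \<partial>lborel) \<le> ennreal (C\<^sup>2)" .
  then show L: "L2 f"
    using assms(2) by (auto simp: L2_iff_nn_integral intro: le_less_trans)
  from le have "(L2_norm f)\<^sup>2 \<le> C\<^sup>2" by (simp add: nn_integral_norm_sq[OF L])
  then show "L2_norm f \<le> C" using C by (rule power2_le_imp_le)
qed

lemma L2_dominated:
  fixes F :: "nat \<Rightarrow> real^3 \<Rightarrow> 'b::euclidean_space"
  assumes F: "\<And>n. F n \<in> borel_measurable borel" and f: "f \<in> borel_measurable borel"
    and lim: "AE x in lborel. (\<lambda>n. F n x) \<longlonglongrightarrow> f x"
    and w: "integrable lborel w" "\<And>n. AE x in lborel. (norm (F n x))\<^sup>2 \<le> w x"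
  shows "L2 f" "(\<lambda>n. L2_norm (\<lambda>x. F n x - f x)) \<longlonglongrightarrow> 0"
proof -
  note F[measurable] f[measurable]
  have Fn: "L2 (F n)" for n by (rule L2_bound[OF F w])
  have w': "AE x in lborel. \<forall>n. (norm (F n x))\<^sup>2 \<le> w x" using w(2) by (simp add: AE_all_countable)
  have fw: "AE x in lborel. (norm (f x))\<^sup>2 \<le> w x"
    using lim w'
  proof eventually_elim
    case (elim x)
    have "(\<lambda>n. (norm (F n x))\<^sup>2) \<longlonglongrightarrow> (norm (f x))\<^sup>2" using elim by (intro tendsto_intros)
    then show ?case by (rule LIMSEQ_le_const2) (use elim in auto)
  qed
  show L: "L2 f" by (rule L2_bound[OF f w(1) fw])
  have "(\<lambda>n. LINT x|lborel. (norm (F n x - f x))\<^sup>2) \<longlonglongrightarrow> (LINT (x::real^3)|lborel. (0::real))"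
  proof (rule integral_dominated_convergence[where w="\<lambda>x. 4 * w x"])
    show "integrable lborel (\<lambda>x. 4 * w x)" using w by simp
    show "AE x in lborel. (\<lambda>n. (norm (F n x - f x))\<^sup>2) \<longlonglongrightarrow> 0"
      using lim
    proof eventually_elim
      case (elim x)
      then have "(\<lambda>n. (norm (F n x - f x))\<^sup>2) \<longlonglongrightarrow> (norm (f x - f x))\<^sup>2" by (intro tendsto_intros)
      then show ?case by simp
    qed
    show "AE x in lborel. norm ((norm (F n x - f x))\<^sup>2) \<le> 4 * w x" for n
      using w' fw
    proof eventually_elim
      case (elim x)
      have "(norm (F n x + f x))\<^sup>2 + (norm (F n x - f x))\<^sup>2 = 2 * (norm (F n x))\<^sup>2 + 2 * (norm (f x))\<^sup>2"
        by (simp add: power2_norm_eq_inner algebra_simps inner_commute)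
      moreover have "0 \<le> (norm (F n x + f x))\<^sup>2" by simp
      moreover have "(norm (F n x))\<^sup>2 \<le> w x" using elim by blast
      moreover have "(norm (f x))\<^sup>2 \<le> w x" using elim by blast
      ultimately have "(norm (F n x - f x))\<^sup>2 \<le> 4 * w x" by linarith
      then show ?case by simp
    qed
  qed auto
  then have "(\<lambda>n. sqrt (LINT x|lborel. (norm (F n x - f x))\<^sup>2)) \<longlonglongrightarrow> sqrt 0"
    by (intro tendsto_intros) simp
  then show "(\<lambda>n. L2_norm (\<lambda>x. F n x - f x)) \<longlonglongrightarrow> 0" by (simp add: L2_norm_def)
qed

text \<open>
  Riesz-Fischer. Along a subsequence with \<open>\<parallel>F\<^sub>k\<^sub>+\<^sub>1 - F\<^sub>k\<parallel> \<le> 2\<^sup>-\<^sup>k\<close> the series of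
  \<open>2\<^sup>k |F\<^sub>k\<^sub>+\<^sub>1 - F\<^sub>k|\<^sup>2\<close> is integrable, hence finite almost everywhere, and
  \<open>2 |d| \<le> 2\<^sup>-\<^sup>k + 2\<^sup>k |d|\<^sup>2\<close> turns this into absolute convergence of the increments. The
  weights avoid a Minkowski inequality for infinite sums.
\<close>

theorem L2_complete:
  fixes F :: "nat \<Rightarrow> real^3 \<Rightarrow> 'b::euclidean_space"
  assumes F: "\<And>n. L2 (F n)"
    and cauchy: "\<And>e. 0 < e \<Longrightarrow> \<exists>N. \<forall>m\<ge>N. \<forall>n\<ge>N. L2_norm (\<lambda>x. F m x - F n x) < e"
  obtains f where "L2 f" "(\<lambda>n. L2_norm (\<lambda>x. F n x - f x)) \<longlonglongrightarrow> 0"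
proof -
  have [measurable]: "F n \<in> borel_measurable borel" for n using F by (rule L2_measurable)
  obtain N where N: "\<And>k m n. m \<ge> N k \<Longrightarrow> n \<ge> N k \<Longrightarrow> L2_norm (\<lambda>x. F m x - F n x) < (1/2)^k"
    using cauchy[of "(1/2)^_"] by (metis zero_less_power half_gt_zero zero_less_one)
  \<comment> \<open>Summing makes the indices monotone, and adding \<open>k\<close> makes them unbounded.\<close>
  define r where "r k = (\<Sum>i\<le>k. N i) + k" for k
  have rN: "N k \<le> r k" for k unfolding r_def by (simp add: member_le_sum trans_le_add1)
  have rS: "r k \<le> r (Suc k)" for k by (simp add: r_def)
  have rk: "k \<le> r k" for k by (simp add: r_def)
  define d where "d k x = F (r (Suc k)) x - F (r k) x" for k x
  have [measurable]: "d k \<in> borel_measurable borel" for k unfolding d_def by measurable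
  have dL: "L2 (d k)" for k unfolding d_def by (intro L2_diff F)
  have dn: "L2_norm (d k) \<le> (1/2)^k" for k
    unfolding d_def using N[of k "r (Suc k)" "r k"] rN[of k] rS[of k] by force
  have "(\<integral>\<^sup>+x. (\<Sum>k. ennreal (2^k * (norm (d k x))\<^sup>2)) \<partial>lborel)
      = (\<Sum>k. \<integral>\<^sup>+x. ennreal (2^k * (norm (d k x))\<^sup>2) \<partial>lborel)"
    by (rule nn_integral_suminf) simp
  also have "\<dots> \<le> (\<Sum>k. ennreal ((1/2)^k))"
  proof (rule suminf_le)
    fix k
    have "(\<integral>\<^sup>+x. ennreal (2^k * (norm (d k x))\<^sup>2) \<partial>lborel) = ennreal (2^k) * ennreal ((L2_norm (d k))\<^sup>2)"
      by (subst nn_integral_norm_sq[symmetric, OF dL], subst nn_integral_cmult[symmetric])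
         (auto simp: ennreal_mult)
    also have "\<dots> \<le> ennreal (2^k) * ennreal (((1/2)^k)\<^sup>2)"
      by (intro mult_left_mono ennreal_leI power_mono dn) auto
    also have "\<dots> = ennreal ((1/2)^k)"
    proof -
      have "(2::real)^k * ((1/2)^k)\<^sup>2 = (2 * (1/2) * (1/2))^k"
        unfolding power2_eq_square power_mult_distrib by simp
      then show ?thesis by (subst ennreal_mult[symmetric]) auto
    qed
    finally show "(\<integral>\<^sup>+x. ennreal (2^k * (norm (d k x))\<^sup>2) \<partial>lborel) \<le> ennreal ((1/2)^k)" .
  qed auto
  also have "\<dots> < \<infinity>"
    by (simp add: suminf_ennreal_eq[OF _ geometric_sums])
  finally have "AE x in lborel. (\<Sum>k. ennreal (2^k * (norm (d k x))\<^sup>2)) \<noteq> \<infinity>"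
    by (intro nn_integral_PInf_AE) auto
  then have conv: "AE x in lborel. convergent (\<lambda>k. F (r k) x)"
  proof eventually_elim
    case (elim x)
    have s1: "summable (\<lambda>k. 2^k * (norm (d k x))\<^sup>2)"
      by (rule summable_suminf_not_top) (use elim in \<open>auto simp: top_unique\<close>)
    have s2: "summable (\<lambda>k. 2^k * (norm (d k x))\<^sup>2 + (1/2)^k)"
      by (intro summable_add s1 summable_geometric) simp
    have "summable (\<lambda>k. d k x)"
    proof (rule summable_comparison_test'[OF s2])
      fix k :: nat
      have p: "(2::real)^k * (1/2)^k = 1" by (simp flip: power_mult_distrib)
      have "0 \<le> 2^k * (norm (d k x) - (1/2)^k)\<^sup>2" by simp
      also have "\<dots> = 2^k * (norm (d k x))\<^sup>2 + (2^k * (1/2)^k) * (1/2)^k - 2 * (2^k * (1/2)^k) * norm (d k x)"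
        by (simp add: power2_eq_square algebra_simps)
      also have "\<dots> = 2^k * (norm (d k x))\<^sup>2 + (1/2)^k - 2 * norm (d k x)"
        unfolding p by simp
      finally show "norm (d k x) \<le> 2^k * (norm (d k x))\<^sup>2 + (1/2)^k" using norm_ge_zero[of "d k x"] by linarith
    qed
    then have "convergent (\<lambda>n. \<Sum>k<n. d k x)" by (simp add: summable_iff_convergent)
    moreover have "(\<Sum>k<n. d k x) = F (r n) x - F (r 0) x" for n
      unfolding d_def by (rule sum_lessThan_telescope)
    ultimately have "convergent (\<lambda>n. F (r n) x - F (r 0) x)" by simp
    then have "convergent (\<lambda>n. (F (r n) x - F (r 0) x) + F (r 0) x)" by (intro convergent_add convergent_const)
    then show ?case by simp
  qed
  define f where "f x = lim (\<lambda>k. F (r k) x)" for x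
  have fm[measurable]: "f \<in> borel_measurable borel" unfolding f_def by (rule borel_measurable_lim_metric) simp
  have flim: "AE x in lborel. (\<lambda>k. F (r k) x) \<longlonglongrightarrow> f x"
    using conv by eventually_elim (simp add: f_def convergent_LIMSEQ_iff)
  have key: "L2 (\<lambda>x. F n x - f x) \<and> L2_norm (\<lambda>x. F n x - f x) \<le> (1/2)^k" if "n \<ge> N k" for n k
  proof -
    have a: "AE x in lborel. (\<lambda>m. F n x - F (r m) x) \<longlonglongrightarrow> F n x - f x"
      using flim by eventually_elim (intro tendsto_intros)
    have b: "\<forall>\<^sub>F m in sequentially. L2_norm (\<lambda>x. F n x - F (r m) x) \<le> (1/2)^k"
      using eventually_ge_at_top[of "N k"]
      by eventually_elim (use N[OF that] rk in \<open>meson le_trans less_imp_le\<close>)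
    show ?thesis
      using L2_Fatou[of "\<lambda>m x. F n x - F (r m) x", OF L2_diff[OF F F] _ a b] by simp
  qed
  have "L2 (\<lambda>x. F (N 0) x - (F (N 0) x - f x))"
    by (rule L2_diff[OF F conjunct1[OF key[OF order_refl]]])
  then have fL: "L2 f" by simp
  have "(\<lambda>n. L2_norm (\<lambda>x. F n x - f x)) \<longlonglongrightarrow> 0"
  proof (rule LIMSEQ_I)
    fix e :: real assume "0 < e"
    then obtain k where k: "(1/2)^k < e" using real_arch_pow_inv[of e "1/2"] by auto
    show "\<exists>no. \<forall>n\<ge>no. norm (L2_norm (\<lambda>x. F n x - f x) - 0) < e"
      using key[of k] k by (intro exI[of _ "N k"]) (auto intro: le_less_trans)
  qed
  with fL show ?thesis by (rule that)
qed

section \<open>Integrals over Euclidean space\<close>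

lemma
  fixes f :: "'a::euclidean_space \<Rightarrow> real \<Rightarrow> 'b::{real_normed_field,banach,second_countable_topology}"
  assumes f: "\<And>b. b \<in> Basis \<Longrightarrow> integrable lborel (f b)"
  shows integrable_lborel_prod: "integrable lborel (\<lambda>x. \<Prod>b\<in>Basis. f b (x \<bullet> b))"
    and integral_lborel_prod: "(LINT x|lborel. (\<Prod>b\<in>Basis. f b (x \<bullet> b))) = (\<Prod>b\<in>Basis. LINT t|lborel. f b t)"
proof -
  interpret product_sigma_finite "\<lambda>_::'a. lborel :: real measure" by standard
  let ?T = "\<lambda>y::'a \<Rightarrow> real. \<Sum>b\<in>Basis. y b *\<^sub>R b"
  have [measurable]: "f b \<in> borel_measurable borel" if "b \<in> Basis" for b using f[OF that] by auto
  have T[measurable]: "?T \<in> measurable (\<Pi>\<^sub>M b\<in>Basis. lborel) borel" by measurable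
  have eq: "(\<Prod>b\<in>Basis. f b (?T y \<bullet> b)) = (\<Prod>b\<in>Basis. f b (y b))" for y
    by (intro prod.cong refl) simp
  have m[measurable]: "(\<lambda>x. \<Prod>b\<in>Basis. f b (x \<bullet> b)) \<in> borel_measurable borel" by measurable
  show "integrable lborel (\<lambda>x. \<Prod>b\<in>Basis. f b (x \<bullet> b))"
    unfolding lborel_eq[where 'a='a] by (subst integrable_distr_eq[OF T m])
      (unfold eq, intro product_integrable_prod f finite_Basis)
  show "(LINT x|lborel. (\<Prod>b\<in>Basis. f b (x \<bullet> b))) = (\<Prod>b\<in>Basis. LINT t|lborel. f b t)"
    unfolding lborel_eq[where 'a='a] by (subst integral_distr[OF T m])
      (unfold eq, intro product_integral_prod f finite_Basis)
qed

lemma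
  fixes g :: "'a::euclidean_space \<Rightarrow> 'b::{banach,second_countable_topology}"
  assumes c: "c \<noteq> 0" and [measurable]: "g \<in> borel_measurable borel"
  shows integral_lborel_affine: "(LINT x|lborel. g x) = \<bar>c\<bar>^DIM('a) *\<^sub>R (LINT x|lborel. g (t + c *\<^sub>R x))"
    and integrable_lborel_affine: "integrable lborel g \<longleftrightarrow> integrable lborel (\<lambda>x. g (t + c *\<^sub>R x))"
proof -
  show "(LINT x|lborel. g x) = \<bar>c\<bar>^DIM('a) *\<^sub>R (LINT x|lborel. g (t + c *\<^sub>R x))"
    by (subst lborel_affine[OF c, of t]) (simp add: integral_density integral_distr)
  show "integrable lborel g \<longleftrightarrow> integrable lborel (\<lambda>x. g (t + c *\<^sub>R x))"
  proof -
    let ?k = "\<bar>c\<bar> ^ DIM('a)"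
    have "integrable lborel g \<longleftrightarrow> integrable lborel (\<lambda>x. ?k *\<^sub>R g (t + c *\<^sub>R x))"
      by (subst lborel_affine[OF c, of t]) (simp add: integrable_density integrable_distr_eq)
    also have "\<dots> \<longleftrightarrow> integrable lborel (\<lambda>x. g (t + c *\<^sub>R x))"
    proof
      assume "integrable lborel (\<lambda>x. ?k *\<^sub>R g (t + c *\<^sub>R x))"
      from integrable_scaleR_right[OF this, of "inverse ?k"]
      show "integrable lborel (\<lambda>x. g (t + c *\<^sub>R x))" using c by simp
    qed (rule integrable_scaleR_right)
    finally show ?thesis .
  qed
qed

section \<open>The Fourier integral and the Gaussian\<close>

definition fourier_integral :: "(real^3 \<Rightarrow> complex) \<Rightarrow> real^3 \<Rightarrow> complex" where
  "fourier_integral f \<xi> = (LINT x|lborel. cis (- (x \<bullet> \<xi>)) * f x)"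

lemma borel_measurable_cis[measurable (raw)]:
  "f \<in> borel_measurable M \<Longrightarrow> (\<lambda>x. cis (f x)) \<in> borel_measurable M"
  by (rule borel_measurable_continuous_on[OF continuous_on_cis[OF continuous_on_id]])

lemma integrable_cis_mult:
  fixes h :: "'a::euclidean_space \<Rightarrow> real"
  assumes "integrable lborel f" and [measurable]: "h \<in> borel_measurable borel"
  shows "integrable lborel (\<lambda>x. cis (h x) * f x)"
  by (rule Bochner_Integration.integrable_bound[OF assms(1)]) (use assms in \<open>auto simp: norm_mult\<close>)

lemma fourier_integral_integrable: "integrable lborel f \<Longrightarrow> integrable lborel (\<lambda>x. cis (- (x \<bullet> \<xi>)) * f x)"
  by (rule integrable_cis_mult) auto

lemma norm_fourier_integral_le: assumes "integrable lborel f" shows "norm (fourier_integral f \<xi>) \<le> (LINT x|lborel. norm (f x))"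
  unfolding fourier_integral_def
  by (rule order_trans[OF integral_norm_bound]) (simp add: norm_mult)

lemma fourier_integral_diff: "integrable lborel f \<Longrightarrow> integrable lborel g \<Longrightarrow> fourier_integral (\<lambda>x. f x - g x) \<xi> = fourier_integral f \<xi> - fourier_integral g \<xi>"
  unfolding fourier_integral_def right_diff_distrib by (intro Bochner_Integration.integral_diff fourier_integral_integrable)

lemma fourier_integral_add: "integrable lborel f \<Longrightarrow> integrable lborel g \<Longrightarrow> fourier_integral (\<lambda>x. f x + g x) \<xi> = fourier_integral f \<xi> + fourier_integral g \<xi>"
  unfolding fourier_integral_def distrib_left by (intro Bochner_Integration.integral_add fourier_integral_integrable)

lemma fourier_integral_cmult: "fourier_integral (\<lambda>x. c * f x) \<xi> = c * fourier_integral f \<xi>"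
  unfolding fourier_integral_def by (subst integral_mult_right_zero[symmetric]) (simp add: mult_ac)

lemma fourier_integral_measurable[measurable]:
  assumes [measurable]: "f \<in> borel_measurable borel" shows "fourier_integral f \<in> borel_measurable borel"
  unfolding fourier_integral_def by measurable

lemma fourier_integral_cnj: "cnj (fourier_integral f \<xi>) = fourier_integral (\<lambda>x. cnj (f x)) (- \<xi>)"
  unfolding fourier_integral_def Bochner_Integration.integral_cnj[symmetric] by (simp add: cis_cnj)

text \<open>
  Fubini: the kernel \<open>e\<^sup>-\<^sup>i\<^sup>x\<^sup>\<cdot>\<^sup>\<xi>\<close> is symmetric in its two variables. Everything about inversion
  rests on this formula.
\<close>

lemma fourier_integral_mult_formula:
  assumes f: "integrable lborel f" and g: "integrable lborel g"
  shows "(LINT \<xi>|lborel. fourier_integral f \<xi> * g \<xi>) = (LINT x|lborel. f x * fourier_integral g x)"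
proof -
  have [measurable]: "f \<in> borel_measurable borel" "g \<in> borel_measurable borel" using f g by auto
  have "integrable (lborel \<Otimes>\<^sub>M lborel) (case_prod (\<lambda>x \<xi>. cis (- (x \<bullet> \<xi>)) * f x * g \<xi>))"
  proof (rule lborel_pair.Fubini_integrable)
    show "(\<lambda>(x, \<xi>). cis (- (x \<bullet> \<xi>)) * f x * g \<xi>) \<in> borel_measurable (lborel \<Otimes>\<^sub>M lborel)" by measurable
    show "integrable lborel (\<lambda>x. LINT \<xi>|lborel. norm (case (x, \<xi>) of (x, \<xi>) \<Rightarrow> cis (- (x \<bullet> \<xi>)) * f x * g \<xi>))"
      using f by (simp add: norm_mult)
    have "integrable lborel (\<lambda>\<xi>. f x * (cis (- (x \<bullet> \<xi>)) * g \<xi>))" for x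
      by (intro integrable_mult_right integrable_cis_mult g) measurable
    then show "AE x in lborel. integrable lborel (\<lambda>\<xi>. case (x, \<xi>) of (x, \<xi>) \<Rightarrow> cis (- (x \<bullet> \<xi>)) * f x * g \<xi>)"
      by (simp add: mult_ac)
  qed
  from lborel_pair.Fubini_integral[OF this]
  have "(LINT \<xi>|lborel. LINT x|lborel. cis (- (x \<bullet> \<xi>)) * f x * g \<xi>) = (LINT x|lborel. LINT \<xi>|lborel. cis (- (x \<bullet> \<xi>)) * f x * g \<xi>)" .
  moreover have "(LINT \<xi>|lborel. cis (- (x \<bullet> \<xi>)) * f x * g \<xi>) = f x * fourier_integral g x" for x
    unfolding fourier_integral_def by (subst integral_mult_right_zero[symmetric]) (simp add: mult_ac inner_commute)
  ultimately show ?thesis by (simp add: fourier_integral_def)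
qed

definition gauss :: "real^3 \<Rightarrow> complex" where
  "gauss x = complex_of_real (exp (- (norm x)\<^sup>2 / 2))"

text \<open>
  This is the characteristic function of the standard normal distribution, freed of its
  normalization.
\<close>

lemma gauss_1d:
  "integrable lborel (\<lambda>x. cis (- (x * t)) * complex_of_real (exp (- x\<^sup>2 / 2)))"
  "(LINT x|lborel. cis (- (x * t)) * complex_of_real (exp (- x\<^sup>2 / 2)))
     = complex_of_real (sqrt (2 * pi) * exp (- t\<^sup>2 / 2))"
proof -
  have "integrable lborel (\<lambda>x. sqrt (2*pi) * std_normal_density x)"
    using integrable_normal_density by simp
  then have "integrable lborel (\<lambda>x. exp (- x\<^sup>2 / 2 :: real))"
    by (simp add: std_normal_density_def)
  then have "integrable lborel (\<lambda>x. complex_of_real (exp (- x\<^sup>2 / 2 :: real)))"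
    by (rule integrable_of_real)
  then show "integrable lborel (\<lambda>x. cis (- (x * t)) * complex_of_real (exp (- x\<^sup>2 / 2)))"
    by (rule Bochner_Integration.integrable_bound) (auto simp: norm_mult)
  have "complex_of_real (exp (- ((-t)^2) / 2)) = char std_normal_distribution (-t)"
    by (simp add: char_std_normal_distribution)
  also have "\<dots> = (LINT x|lborel. std_normal_density x *\<^sub>R cis (- (x * t)))"
    unfolding char_def by (subst integral_density) (auto simp: cis_conv_exp mult.commute)
  also have "\<dots> = (LINT x|lborel. complex_of_real (1 / sqrt (2 * pi)) * (cis (- (x * t)) * complex_of_real (exp (- x\<^sup>2 / 2))))"
    by (intro Bochner_Integration.integral_cong refl) (simp add: std_normal_density_def scaleR_conv_of_real mult_ac)
  also have "\<dots> = complex_of_real (1 / sqrt (2 * pi)) * (LINT x|lborel. cis (- (x * t)) * complex_of_real (exp (- x\<^sup>2 / 2)))"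
    by (rule integral_mult_right_zero)
  finally show "(LINT x|lborel. cis (- (x * t)) * complex_of_real (exp (- x\<^sup>2 / 2)))
     = complex_of_real (sqrt (2 * pi) * exp (- t\<^sup>2 / 2))"
    by (simp add: field_simps)
qed

lemma norm_sq_Basis: "(norm (x::'a::euclidean_space))\<^sup>2 = (\<Sum>b\<in>Basis. (x \<bullet> b)\<^sup>2)"
  by (subst power2_norm_eq_inner, subst euclidean_inner) (simp add: power2_eq_square)

lemma gauss_prod:
  "cis (- (x \<bullet> \<xi>)) * gauss x
     = (\<Prod>b\<in>Basis. cis (- ((x \<bullet> b) * (\<xi> \<bullet> b))) * complex_of_real (exp (- (x \<bullet> b)\<^sup>2 / 2)))"
proof -
  have "cis (- (x \<bullet> \<xi>)) = (\<Prod>b\<in>Basis. cis (- ((x \<bullet> b) * (\<xi> \<bullet> b))))"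
    unfolding cis_conv_exp euclidean_inner[of x \<xi>]
    by (subst exp_sum[symmetric]) (auto simp: sum_negf sum_distrib_left)
  moreover have "exp (- (norm x)\<^sup>2 / 2) = (\<Prod>b\<in>Basis. exp (- (x \<bullet> b)\<^sup>2 / 2))"
    unfolding norm_sq_Basis by (subst exp_sum[symmetric]) (auto simp: sum_negf sum_divide_distrib)
  ultimately show ?thesis by (simp add: gauss_def prod.distrib)
qed

lemma gauss_integrable: "integrable lborel gauss"
proof -
  have "integrable lborel (\<lambda>x. cis (- (x \<bullet> 0)) * gauss x)"
    unfolding gauss_prod by (intro integrable_lborel_prod gauss_1d)
  then show ?thesis by simp
qed

lemma gauss_measurable[measurable]: "gauss \<in> borel_measurable borel"
  using gauss_integrable by auto

lemma fourier_integral_gauss: "fourier_integral gauss \<xi> = complex_of_real (sqrt (2 * pi) ^ 3) * gauss \<xi>"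
proof -
  have "fourier_integral gauss \<xi> = (\<Prod>b\<in>Basis. complex_of_real (sqrt (2 * pi) * exp (- (\<xi> \<bullet> b)\<^sup>2 / 2)))"
    unfolding fourier_integral_def gauss_prod by (subst integral_lborel_prod) (simp_all only: gauss_1d)
  also have "\<dots> = complex_of_real (sqrt (2 * pi) ^ 3) * (\<Prod>b\<in>(Basis::(real^3) set). complex_of_real (exp (- (\<xi> \<bullet> b)\<^sup>2 / 2)))"
    by (simp add: prod.distrib)
  also have "(\<Prod>b\<in>(Basis::(real^3) set). complex_of_real (exp (- (\<xi> \<bullet> b)\<^sup>2 / 2))) = gauss \<xi>"
    unfolding gauss_def norm_sq_Basis of_real_prod[symmetric]
    by (subst exp_sum[symmetric]) (auto simp: sum_negf sum_divide_distrib)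
  finally show ?thesis .
qed

section \<open>Plancherel's identity for continuous functions of bounded support\<close>

lemma borel_measurable_cnj[measurable (raw)]:
  "f \<in> borel_measurable M \<Longrightarrow> (\<lambda>x. cnj (f x)) \<in> borel_measurable M"
  by (rule borel_measurable_continuous_on[OF continuous_on_cnj[OF continuous_on_id]])

text \<open>
  Apply the multiplication formula twice, once to move the outer transform and once, after the
  substitution \<open>y = x - c z\<close>, to move it onto the Gaussian. The right-hand side is the pairing
  of \<open>f\<close> with a mollification of itself at scale \<open>c\<close>.
\<close>

lemma gauss_regularized:
  fixes f :: "real^3 \<Rightarrow> complex"
  assumes f: "integrable lborel f" and c: "0 < c"
  shows "(LINT \<xi>|lborel. complex_of_real ((norm (fourier_integral f \<xi>))\<^sup>2) * gauss (c *\<^sub>R \<xi>))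
    = (LINT x|lborel. f x * (LINT z|lborel. cnj (f (x + (-c) *\<^sub>R z)) * fourier_integral gauss z))"
    and "integrable lborel (\<lambda>\<xi>. complex_of_real ((norm (fourier_integral f \<xi>))\<^sup>2) * gauss (c *\<^sub>R \<xi>))"
proof -
  have [measurable]: "f \<in> borel_measurable borel" using f by auto
  have gc: "integrable lborel (\<lambda>\<xi>. gauss (c *\<^sub>R \<xi>))"
    using integrable_lborel_affine[of c gauss 0] gauss_integrable c by simp
  define B where "B = (LINT x|lborel. norm (f x))"
  have B: "norm (fourier_integral f \<xi>) \<le> B" for \<xi> unfolding B_def by (rule norm_fourier_integral_le[OF f])
  then have B0: "0 \<le> B" using norm_ge_zero order_trans by blast
  define H where "H \<xi> = cnj (fourier_integral f \<xi>) * gauss (c *\<^sub>R \<xi>)" for \<xi>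
  have Hi: "integrable lborel H"
  proof (rule Bochner_Integration.integrable_bound)
    show "integrable lborel (\<lambda>\<xi>. B *\<^sub>R gauss (c *\<^sub>R \<xi>))" using gc by simp
    show "H \<in> borel_measurable lborel" unfolding H_def by measurable
    show "AE \<xi> in lborel. norm (H \<xi>) \<le> norm (B *\<^sub>R gauss (c *\<^sub>R \<xi>))"
      using B B0 by (auto simp: H_def norm_mult intro!: mult_right_mono)
  qed
  have eqH: "complex_of_real ((norm (fourier_integral f \<xi>))\<^sup>2) * gauss (c *\<^sub>R \<xi>) = fourier_integral f \<xi> * H \<xi>" for \<xi>
    unfolding H_def complex_norm_square by (simp add: mult.assoc)
  show "integrable lborel (\<lambda>\<xi>. complex_of_real ((norm (fourier_integral f \<xi>))\<^sup>2) * gauss (c *\<^sub>R \<xi>))"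
    unfolding eqH
  proof (rule Bochner_Integration.integrable_bound)
    show "integrable lborel (\<lambda>\<xi>. B *\<^sub>R H \<xi>)" using Hi by simp
    show "(\<lambda>\<xi>. fourier_integral f \<xi> * H \<xi>) \<in> borel_measurable lborel" unfolding H_def by measurable
    show "AE \<xi> in lborel. norm (fourier_integral f \<xi> * H \<xi>) \<le> norm (B *\<^sub>R H \<xi>)"
      using B B0 by (auto simp: norm_mult intro!: mult_right_mono)
  qed
  have inner: "fourier_integral H x = (LINT z|lborel. cnj (f (x + (-c) *\<^sub>R z)) * fourier_integral gauss z)" for x
  proof -
    define \<phi> where "\<phi> z = cnj (f (x + (-c) *\<^sub>R z))" for z
    have \<phi>i: "integrable lborel \<phi>"
      unfolding \<phi>_def using integrable_lborel_affine[of "-c" "\<lambda>z. cnj (f z)" x] c f by simp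
    then have [measurable]: "\<phi> \<in> borel_measurable borel" by auto
    have "cis (- (\<xi> \<bullet> x)) * cnj (fourier_integral f \<xi>) = c^3 *\<^sub>R fourier_integral \<phi> (c *\<^sub>R \<xi>)" for \<xi>
    proof -
      have "cis (- (\<xi> \<bullet> x)) * cnj (fourier_integral f \<xi>) = (LINT y|lborel. cis (- (\<xi> \<bullet> x)) * (cis (y \<bullet> \<xi>) * cnj (f y)))"
        unfolding fourier_integral_cnj by (simp add: fourier_integral_def)
      also have "\<dots> = (LINT y|lborel. cis ((y - x) \<bullet> \<xi>) * cnj (f y))"
        by (intro Bochner_Integration.integral_cong refl)
          (simp add: mult.assoc[symmetric] cis_mult inner_diff_left inner_commute[of \<xi> x])
      also have "\<dots> = \<bar>-c\<bar>^DIM(real^3) *\<^sub>R (LINT z|lborel. cis ((x + (-c) *\<^sub>R z - x) \<bullet> \<xi>) * cnj (f (x + (-c) *\<^sub>R z)))"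
        using c by (intro integral_lborel_affine) auto
      also have "\<dots> = c^3 *\<^sub>R fourier_integral \<phi> (c *\<^sub>R \<xi>)"
        using c by (simp add: fourier_integral_def \<phi>_def mult.commute)
      finally show ?thesis .
    qed
    then have "fourier_integral H x = (LINT \<xi>|lborel. c^3 *\<^sub>R (fourier_integral \<phi> (c *\<^sub>R \<xi>) * gauss (c *\<^sub>R \<xi>)))"
      unfolding fourier_integral_def[of H] H_def by (simp add: mult.assoc[symmetric])
    also have "\<dots> = c^3 *\<^sub>R (LINT \<xi>|lborel. fourier_integral \<phi> (0 + c *\<^sub>R \<xi>) * gauss (0 + c *\<^sub>R \<xi>))"
      by simp
    also have "\<dots> = (LINT \<eta>|lborel. fourier_integral \<phi> \<eta> * gauss \<eta>)"
      using c by (subst integral_lborel_affine[of c "\<lambda>\<eta>. fourier_integral \<phi> \<eta> * gauss \<eta>" 0]) auto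
    also have "\<dots> = (LINT z|lborel. \<phi> z * fourier_integral gauss z)"
      by (rule fourier_integral_mult_formula[OF \<phi>i gauss_integrable])
    finally show ?thesis by (simp add: \<phi>_def)
  qed
  show "(LINT \<xi>|lborel. complex_of_real ((norm (fourier_integral f \<xi>))\<^sup>2) * gauss (c *\<^sub>R \<xi>))
    = (LINT x|lborel. f x * (LINT z|lborel. cnj (f (x + (-c) *\<^sub>R z)) * fourier_integral gauss z))"
    unfolding eqH fourier_integral_mult_formula[OF f Hi] inner ..
qed

lemma integral_fourier_integral_gauss: "(LINT z|lborel. fourier_integral gauss z) = complex_of_real ((2 * pi) ^ 3)"
proof -
  have "(LINT z|lborel. gauss z) = fourier_integral gauss 0" by (simp add: fourier_integral_def)
  also have "\<dots> = complex_of_real (sqrt (2 * pi) ^ 3)" by (simp add: fourier_integral_gauss gauss_def)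
  finally have "(LINT z|lborel. fourier_integral gauss z) = complex_of_real (sqrt (2 * pi) ^ 3 * sqrt (2 * pi) ^ 3)"
    by (simp add: fourier_integral_gauss)
  also have "sqrt (2 * pi) ^ 3 * sqrt (2 * pi) ^ 3 = (sqrt (2 * pi) * sqrt (2 * pi)) ^ 3"
    by (rule power_mult_distrib[symmetric])
  finally show ?thesis by simp
qed

lemma integrable_indicator_cball: "integrable lborel (indicator (cball 0 R) :: real^3 \<Rightarrow> real)"
  by (simp add: integrable_indicator_iff emeasure_compact_finite[OF compact_cball, simplified])

lemma bounded_support_integrable:
  fixes f :: "real^3 \<Rightarrow> complex"
  assumes [measurable]: "f \<in> borel_measurable borel"
    and M: "\<And>x. norm (f x) \<le> M" and R: "\<And>x. R < norm x \<Longrightarrow> f x = 0"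
  shows "integrable lborel f" "L2 f"
proof -
  note cb = integrable_indicator_cball[of R]
  have M0: "0 \<le> M" using M[of 0] norm_ge_zero order_trans by blast
  have b: "norm (f x) \<le> M * indicator (cball 0 R) x" for x
    using M R by (cases "norm x \<le> R") (auto simp: indicator_def)
  show "integrable lborel f"
    by (rule Bochner_Integration.integrable_bound[of _ "\<lambda>x. M * indicator (cball 0 R) x"])
      (use cb b M0 in auto)
  show "L2 f"
  proof (rule L2_bound[where w="\<lambda>x. M\<^sup>2 * indicator (cball 0 R) x"])
    show "AE x in lborel. (norm (f x))\<^sup>2 \<le> M\<^sup>2 * indicator (cball 0 R) x"
    proof (rule AE_I2)
      fix x
      have "(norm (f x))\<^sup>2 \<le> (M * indicator (cball 0 R) x)\<^sup>2" by (rule power_mono[OF b norm_ge_zero])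
      then show "(norm (f x))\<^sup>2 \<le> M\<^sup>2 * indicator (cball 0 R) x"
        by (cases "x \<in> cball 0 R") (simp_all add: power_mult_distrib)
    qed
  qed (use cb in auto)
qed

definition plancherel_isometric :: "(real^3 \<Rightarrow> complex) \<Rightarrow> bool" where
  "plancherel_isometric f \<longleftrightarrow> L2 (fourier_integral f) \<and> L2_norm (fourier_integral f) = sqrt ((2 * pi) ^ 3) * L2_norm f"

text \<open>
  Let \<open>c \<rightarrow> 0\<close> in the regularized identity: the left side increases to \<open>\<parallel>F f\<parallel>\<^sup>2\<close> by monotone
  convergence, and the right side tends to \<open>(2\<pi>)\<^sup>3 \<parallel>f\<parallel>\<^sup>2\<close> by dominated convergence, since \<open>f\<close> is
  continuous.
\<close>

lemma plancherel_isometric_Cc: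
  assumes cont: "continuous_on UNIV f"
    and M: "\<And>x. norm (f x) \<le> M" and R: "\<And>x. R < norm x \<Longrightarrow> f x = 0"
  shows "plancherel_isometric f"
proof -
  have m[measurable]: "f \<in> borel_measurable borel" using cont by (rule borel_measurable_continuous_onI)
  have f: "integrable lborel f" "L2 f" using bounded_support_integrable[OF m M R] by auto
  define c where "c n = 1 / real (Suc n)" for n
  have c0: "0 < c n" for n by (simp add: c_def)
  have climit: "c \<longlonglongrightarrow> 0" unfolding c_def by (rule LIMSEQ_Suc[OF lim_1_over_n])
  have cdec: "c n \<le> c m" if "m \<le> n" for m n using that by (auto simp: c_def frac_le)
  define K where "K z = fourier_integral gauss z" for z
  have K: "integrable lborel K" unfolding K_def fourier_integral_gauss using gauss_integrable by simp
  have [measurable]: "K \<in> borel_measurable borel" using K by auto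
  have bd: "norm (cnj (f y) * K z) \<le> M * norm (K z)" for y z
    by (auto simp: norm_mult intro!: mult_right_mono M)
  have inner: "(\<lambda>n. LINT z|lborel. cnj (f (x + (- c n) *\<^sub>R z)) * K z) \<longlonglongrightarrow> (LINT z|lborel. cnj (f x) * K z)" for x
  proof (rule integral_dominated_convergence[where w="\<lambda>z. M * norm (K z)"])
    show "AE z in lborel. (\<lambda>n. cnj (f (x + (- c n) *\<^sub>R z)) * K z) \<longlonglongrightarrow> cnj (f x) * K z"
    proof (rule AE_I2)
      fix z
      have "(\<lambda>n. x + (- c n) *\<^sub>R z) \<longlonglongrightarrow> x + (- 0) *\<^sub>R z" by (intro tendsto_intros climit)
      then have "(\<lambda>n. f (x + (- c n) *\<^sub>R z)) \<longlonglongrightarrow> f x"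
        using continuous_on_tendsto_compose[OF cont, of "\<lambda>n. x + (- c n) *\<^sub>R z" x] by simp
      then show "(\<lambda>n. cnj (f (x + (- c n) *\<^sub>R z)) * K z) \<longlonglongrightarrow> cnj (f x) * K z"
        by (intro tendsto_intros)
    qed
    show "AE z in lborel. norm (cnj (f (x + (- c n) *\<^sub>R z)) * K z) \<le> M * norm (K z)" for n
      by (intro AE_I2 bd)
  qed (use K in auto)
  define J where "J = (LINT z|lborel. norm (K z))"
  have outer: "(\<lambda>n. LINT x|lborel. f x * (LINT z|lborel. cnj (f (x + (- c n) *\<^sub>R z)) * K z))
      \<longlonglongrightarrow> (LINT x|lborel. f x * (LINT z|lborel. cnj (f x) * K z))"
  proof (rule integral_dominated_convergence[where w="\<lambda>x. norm (f x) * (M * J)"])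
    show "AE x in lborel. (\<lambda>n. f x * (LINT z|lborel. cnj (f (x + (- c n) *\<^sub>R z)) * K z)) \<longlonglongrightarrow> f x * (LINT z|lborel. cnj (f x) * K z)"
      using inner by (intro AE_I2 tendsto_intros)
    show "AE x in lborel. norm (f x * (LINT z|lborel. cnj (f (x + (- c n) *\<^sub>R z)) * K z)) \<le> norm (f x) * (M * J)" for n
    proof (rule AE_I2)
      fix x
      have "norm (LINT z|lborel. cnj (f (x + (- c n) *\<^sub>R z)) * K z)
          \<le> (LINT z|lborel. norm (cnj (f (x + (- c n) *\<^sub>R z)) * K z))" by (rule integral_norm_bound)
      also have "\<dots> \<le> (LINT z|lborel. M * norm (K z))"
        using K by (intro integral_mono_AE' AE_I2 bd) (auto intro: order_trans[OF norm_ge_zero bd])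
      finally show "norm (f x * (LINT z|lborel. cnj (f (x + (- c n) *\<^sub>R z)) * K z)) \<le> norm (f x) * (M * J)"
        by (simp add: norm_mult J_def mult_left_mono)
    qed
  qed (use f in auto)
  have val: "(LINT x|lborel. f x * (LINT z|lborel. cnj (f x) * K z)) = complex_of_real ((2*pi)^3 * (L2_norm f)\<^sup>2)"
  proof -
    have "f x * (LINT z|lborel. cnj (f x) * K z) = complex_of_real ((2*pi)^3 * (norm (f x))\<^sup>2)" for x
      unfolding K_def integral_mult_right_zero integral_fourier_integral_gauss
      unfolding of_real_mult complex_norm_square by (simp add: mult_ac)
    then have "(LINT x|lborel. f x * (LINT z|lborel. cnj (f x) * K z))
        = complex_of_real (LINT x|lborel. (2*pi)^3 * (norm (f x))\<^sup>2)"
      by (simp only: integral_complex_of_real)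
    then show ?thesis by (simp only: integral_mult_right_zero L2_norm_sq)
  qed
  define F where "F n \<xi> = (norm (fourier_integral f \<xi>))\<^sup>2 * exp (- (norm (c n *\<^sub>R \<xi>))\<^sup>2 / 2)" for n \<xi>
  have Fc: "complex_of_real ((norm (fourier_integral f \<xi>))\<^sup>2) * gauss (c n *\<^sub>R \<xi>) = complex_of_real (F n \<xi>)" for n \<xi>
    by (simp add: F_def gauss_def)
  have Fi: "integrable lborel (F n)" for n
    using integrable_Re[OF gauss_regularized(2)[OF f(1) c0[of n]]] unfolding Fc by simp
  have "(\<lambda>n. complex_of_real (LINT \<xi>|lborel. F n \<xi>)) \<longlonglongrightarrow> complex_of_real ((2*pi)^3 * (L2_norm f)\<^sup>2)"
    using outer[unfolded val] unfolding K_def gauss_regularized(1)[OF f(1) c0, symmetric] Fc integral_complex_of_real .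
  then have lim: "(\<lambda>n. LINT \<xi>|lborel. F n \<xi>) \<longlonglongrightarrow> (2*pi)^3 * (L2_norm f)\<^sup>2"
    using tendsto_of_real_iff by blast
  have "has_bochner_integral lborel (\<lambda>\<xi>. (norm (fourier_integral f \<xi>))\<^sup>2) ((2*pi)^3 * (L2_norm f)\<^sup>2)"
  proof (rule has_bochner_integral_monotone_convergence[OF Fi _ _ lim])
    have "F m \<xi> \<le> F n \<xi>" if "m \<le> n" for m n \<xi>
    proof -
      have "(norm (c n *\<^sub>R \<xi>))\<^sup>2 \<le> (norm (c m *\<^sub>R \<xi>))\<^sup>2"
        using cdec[OF that] c0[of n] c0[of m] by (intro power_mono) (auto intro: mult_right_mono)
      then show ?thesis unfolding F_def by (intro mult_left_mono) auto
    qed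
    then show "AE \<xi> in lborel. mono (\<lambda>n. F n \<xi>)" by (intro AE_I2 monoI)
    show "AE \<xi> in lborel. (\<lambda>n. F n \<xi>) \<longlonglongrightarrow> (norm (fourier_integral f \<xi>))\<^sup>2"
    proof (rule AE_I2)
      fix \<xi>
      have "(\<lambda>n. F n \<xi>) \<longlonglongrightarrow> (norm (fourier_integral f \<xi>))\<^sup>2 * exp (- (norm (0 *\<^sub>R \<xi>))\<^sup>2 / 2)"
        unfolding F_def by (intro tendsto_intros climit) simp
      then show "(\<lambda>n. F n \<xi>) \<longlonglongrightarrow> (norm (fourier_integral f \<xi>))\<^sup>2" by simp
    qed
  qed measurable
  then have "integrable lborel (\<lambda>\<xi>. (norm (fourier_integral f \<xi>))\<^sup>2)" "(LINT \<xi>|lborel. (norm (fourier_integral f \<xi>))\<^sup>2) = (2*pi)^3 * (L2_norm f)\<^sup>2"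
    by (auto simp: has_bochner_integral_iff)
  then show ?thesis
    unfolding plancherel_isometric_def L2_def by (simp add: L2_norm_def[of "fourier_integral f"] real_sqrt_mult)
qed

section \<open>Plancherel's identity on \<open>L\<^sup>1 \<inter> L\<^sup>2\<close>\<close>

abbreviation plancherel_const :: real where "plancherel_const \<equiv> sqrt ((2 * pi) ^ 3)"

definition plancherel_contractive :: "(real^3 \<Rightarrow> complex) \<Rightarrow> bool" where
  "plancherel_contractive f \<longleftrightarrow> L2 (fourier_integral f) \<and> L2_norm (fourier_integral f) \<le> plancherel_const * L2_norm f"

text \<open>
  Convergence in \<open>L\<^sup>1\<close> makes the transforms converge pointwise, and Fatou's lemma then passes
  the \<open>L\<^sup>2\<close> bound to the limit. Only an inequality survives; it is upgraded to an identity in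
  the next lemma, by applying it to the differences.
\<close>

lemma plancherel_contractive_limit:
  assumes F: "\<And>n. integrable lborel (F n)" "\<And>n. L2 (F n)" "\<And>n. plancherel_isometric (F n)"
    and f: "integrable lborel f" "L2 f"
    and l1: "(\<lambda>n. LINT x|lborel. norm (F n x - f x)) \<longlonglongrightarrow> 0"
    and l2: "(\<lambda>n. L2_norm (\<lambda>x. F n x - f x)) \<longlonglongrightarrow> 0"
  shows "plancherel_contractive f"
proof -
  have [measurable]: "f \<in> borel_measurable borel" using f by auto
  have pt: "(\<lambda>n. fourier_integral (F n) \<xi>) \<longlonglongrightarrow> fourier_integral f \<xi>" for \<xi>
  proof (rule LIM_zero_cancel, rule Lim_null_comparison[OF _ l1], intro always_eventually allI)
    fix n
    show "norm (fourier_integral (F n) \<xi> - fourier_integral f \<xi>) \<le> (LINT x|lborel. norm (F n x - f x))"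
      using norm_fourier_integral_le[OF Bochner_Integration.integrable_diff[OF F(1)[of n] f(1)]] by (simp add: fourier_integral_diff F f)
  qed
  have nl: "(\<lambda>n. plancherel_const * L2_norm (F n)) \<longlonglongrightarrow> plancherel_const * L2_norm f"
    by (intro tendsto_intros L2_norm_tendsto F f l2)
  have C: "L2 (fourier_integral f) \<and> L2_norm (fourier_integral f) \<le> C" if "plancherel_const * L2_norm f < C" for C
  proof -
    have "\<forall>\<^sub>F n in sequentially. L2_norm (fourier_integral (F n)) \<le> C"
      using order_tendstoD(2)[OF nl that] by eventually_elim (use F(3) in \<open>auto simp: plancherel_isometric_def\<close>)
    from L2_Fatou[OF _ _ _ this, of "fourier_integral f"] show ?thesis
      using F(3) pt by (auto simp: plancherel_isometric_def)
  qed
  have "L2 (fourier_integral f)" using C[of "plancherel_const * L2_norm f + 1"] by simp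
  moreover have "L2_norm (fourier_integral f) \<le> plancherel_const * L2_norm f"
    by (rule dense_ge) (use C in blast)
  ultimately show ?thesis by (simp add: plancherel_contractive_def)
qed

lemma plancherel_isometric_limit:
  assumes F: "\<And>n. integrable lborel (F n)" "\<And>n. L2 (F n)" "\<And>n. plancherel_isometric (F n)"
    and f: "integrable lborel f" "L2 f" "plancherel_contractive f"
    and c: "\<And>n. plancherel_contractive (\<lambda>x. F n x - f x)"
    and l2: "(\<lambda>n. L2_norm (\<lambda>x. F n x - f x)) \<longlonglongrightarrow> 0"
  shows "plancherel_isometric f"
proof -
  have fL: "L2 (fourier_integral f)" using f(3) by (simp add: plancherel_contractive_def)
  have FL: "L2 (fourier_integral (F n))" for n using F(3) by (simp add: plancherel_isometric_def)
  have "(\<lambda>n. L2_norm (\<lambda>\<xi>. fourier_integral (F n) \<xi> - fourier_integral f \<xi>)) \<longlonglongrightarrow> 0"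
  proof (rule Lim_null_comparison)
    show "(\<lambda>n. plancherel_const * L2_norm (\<lambda>x. F n x - f x)) \<longlonglongrightarrow> 0"
      using tendsto_mult_right_zero[OF l2] .
    have "(\<lambda>\<xi>. fourier_integral (F n) \<xi> - fourier_integral f \<xi>) = fourier_integral (\<lambda>x. F n x - f x)" for n
      by (rule ext) (simp add: fourier_integral_diff F f)
    then show "\<forall>\<^sub>F n in sequentially. norm (L2_norm (\<lambda>\<xi>. fourier_integral (F n) \<xi> - fourier_integral f \<xi>)) \<le> plancherel_const * L2_norm (\<lambda>x. F n x - f x)"
      using c by (auto simp: plancherel_contractive_def)
  qed
  then have "(\<lambda>n. L2_norm (fourier_integral (F n))) \<longlonglongrightarrow> L2_norm (fourier_integral f)" by (rule L2_norm_tendsto[OF FL fL])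
  moreover have "(\<lambda>n. L2_norm (fourier_integral (F n))) \<longlonglongrightarrow> plancherel_const * L2_norm f"
    using F(3) unfolding plancherel_isometric_def by (simp only:) (intro tendsto_intros L2_norm_tendsto F f l2)
  ultimately have "L2_norm (fourier_integral f) = plancherel_const * L2_norm f" by (rule LIMSEQ_unique)
  then show ?thesis using fL by (simp add: plancherel_isometric_def)
qed

text \<open>
  A measurable function is almost everywhere a limit of continuous ones. Projecting their values
  to the ball of radius \<open>M\<close> and multiplying by a cutoff keeps the bound and the support, so that
  the convergence is dominated.
\<close>

lemma bounded_support_approx:
  fixes f :: "real^3 \<Rightarrow> complex"
  assumes fm: "f \<in> borel_measurable borel"
    and M: "\<And>x. norm (f x) \<le> M" and R: "\<And>x. R < norm x \<Longrightarrow> f x = 0"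
  shows "\<exists>F. (\<forall>n::nat. continuous_on UNIV (F n)) \<and> (\<forall>n x. norm (F n x) \<le> M)
    \<and> (\<forall>n x. R + 1 < norm x \<longrightarrow> F n x = 0) \<and> (AE x in lborel. (\<lambda>n. F n x) \<longlonglongrightarrow> f x)"
proof -
  have M0: "0 \<le> M" using M[of 0] norm_ge_zero order_trans by blast
  have "f \<in> borel_measurable lebesgue" using fm by (simp add: measurable_completion)
  then have "f measurable_on UNIV" by (simp add: lebesgue_measurable_imp_measurable_on)
  then obtain N g where N: "negligible N" and g: "\<And>n. continuous_on UNIV (g n)"
    and lim: "\<And>x. x \<notin> N \<Longrightarrow> (\<lambda>n. g n x) \<longlonglongrightarrow> f x"
    unfolding measurable_on_def by auto
  \<comment> \<open>The nearest-point map onto the ball of radius \<open>M\<close> is continuous and fixes the values of \<open>f\<close>.\<close>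
  define P where "P = closest_point (cball (0::complex) M)"
  have Pc: "continuous_on UNIV P" unfolding P_def
    using M0 by (intro continuous_on_closest_point) auto
  have Pb: "norm (P y) \<le> M" for y
    using closest_point_in_set[of "cball (0::complex) M" y] M0 by (simp add: P_def)
  have Pid: "P y = y" if "norm y \<le> M" for y unfolding P_def using that by (intro closest_point_self) auto
  define \<psi> where "\<psi> x = max 0 (min 1 (R + 1 - norm x))" for x :: "real^3"
  have \<psi>: "0 \<le> \<psi> x" "\<psi> x \<le> 1" for x by (auto simp: \<psi>_def)
  define F where "F n x = \<psi> x *\<^sub>R P (g n x)" for n x
  show ?thesis
  proof (intro exI[of _ F] conjI allI impI)
    show "continuous_on UNIV (F n)" for n
      unfolding F_def \<psi>_def
      by (intro continuous_intros continuous_on_compose2[OF Pc g]) auto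
    show "norm (F n x) \<le> M" for n x
      using mult_mono[OF \<psi>(2)[of x] Pb[of "g n x"]] \<psi>[of x] by (simp add: F_def)
    show "F n x = 0" if "R + 1 < norm x" for n x using that by (simp add: F_def \<psi>_def)
    have "N \<in> null_sets lebesgue" using N by (simp add: negligible_iff_null_sets)
    then have "AE x in lebesgue. x \<notin> N" by (rule AE_not_in)
    then have "AE x in lborel. x \<notin> N" by (simp add: AE_completion_iff)
    then show "AE x in lborel. (\<lambda>n. F n x) \<longlonglongrightarrow> f x"
    proof eventually_elim
      case (elim x)
      have "(\<lambda>n. P (g n x)) \<longlonglongrightarrow> P (f x)"
        using continuous_on_tendsto_compose[OF Pc lim[OF elim]] by simp
      then have "(\<lambda>n. F n x) \<longlonglongrightarrow> \<psi> x *\<^sub>R P (f x)" unfolding F_def by (intro tendsto_intros)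
      also have "\<psi> x *\<^sub>R P (f x) = f x"
        using M[of x] R[of x] by (cases "norm x \<le> R") (auto simp: Pid \<psi>_def M0)
      finally show ?case .
    qed
  qed
qed

lemma plancherel_isometric_bounded_support:
  fixes f :: "real^3 \<Rightarrow> complex"
  assumes m[measurable]: "f \<in> borel_measurable borel"
    and M: "\<And>x. norm (f x) \<le> M" and R: "\<And>x. R < norm x \<Longrightarrow> f x = 0"
  shows "plancherel_isometric f"
proof -
  \<comment> \<open>Stated for every such function, because it is applied to the differences from the limit as well.\<close>
  have plancherel_contractive: "plancherel_contractive f \<and> (\<exists>F. (\<forall>n. integrable lborel (F n) \<and> L2 (F n) \<and> plancherel_isometric (F n)
       \<and> (F n) \<in> borel_measurable borel \<and> (\<forall>x. norm (F n x) \<le> M) \<and> (\<forall>x. R + 1 < norm x \<longrightarrow> F n x = 0))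
       \<and> (\<lambda>n. L2_norm (\<lambda>x. F n x - f x)) \<longlonglongrightarrow> 0)"
    if fm[measurable]: "f \<in> borel_measurable borel"
      and M: "\<And>x. norm (f x) \<le> M" and R: "\<And>x. R < norm x \<Longrightarrow> f x = 0" for f :: "real^3 \<Rightarrow> complex" and M R
  proof -
    obtain F where F: "\<And>n::nat. continuous_on UNIV (F n)" "\<And>n x. norm (F n x) \<le> M"
      "\<And>n x. R + 1 < norm x \<Longrightarrow> F n x = 0" and lim: "AE x in lborel. (\<lambda>n. F n x) \<longlonglongrightarrow> f x"
      using bounded_support_approx[OF fm M R] by blast
    have Fm[measurable]: "F n \<in> borel_measurable borel" for n
      by (rule borel_measurable_continuous_onI[OF F(1)])
    have Fi: "integrable lborel (F n)" "L2 (F n)" for n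
      using bounded_support_integrable[OF Fm F(2,3)] by auto
    have fi: "integrable lborel f" "L2 f" using bounded_support_integrable[OF fm M R] by auto
    have Fiso: "plancherel_isometric (F n)" for n by (rule plancherel_isometric_Cc[OF F(1,2,3)])
    have M0: "0 \<le> M" using M[of 0] norm_ge_zero order_trans by blast
    define I where "I x = (indicator (cball 0 (R+1)) x :: real)" for x :: "real^3"
    have cb: "integrable lborel I"
      unfolding I_def by (rule integrable_indicator_cball)
    have FI: "norm (F n x) \<le> M * I x" for n x
      using F(2,3) by (cases "norm x \<le> R + 1") (auto simp: I_def indicator_def)
    have fI: "norm (f x) \<le> M * I x" for x
      using M R by (cases "norm x \<le> R + 1") (auto simp: I_def indicator_def)
    have l1: "(\<lambda>n. LINT x|lborel. norm (F n x - f x)) \<longlonglongrightarrow> (LINT (x::real^3)|lborel. (0::real))"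
    proof (rule integral_dominated_convergence[where w="\<lambda>x. 2 * M * I x"])
      show "AE x in lborel. (\<lambda>n. norm (F n x - f x)) \<longlonglongrightarrow> 0"
        using lim by eventually_elim (simp add: LIM_zero tendsto_norm_zero)
      show "AE x in lborel. norm (norm (F n x - f x)) \<le> 2 * M * I x" for n
      proof (rule AE_I2)
        fix x show "norm (norm (F n x - f x)) \<le> 2 * M * I x"
          using norm_triangle_ineq4[of "F n x" "f x"] FI[of n x] fI[of x] by simp
      qed
    qed (use cb in auto)
    have l2: "(\<lambda>n. L2_norm (\<lambda>x. F n x - f x)) \<longlonglongrightarrow> 0"
    proof (rule L2_dominated(2)[OF Fm fm lim, where w="\<lambda>x. M\<^sup>2 * I x"])
      show "AE x in lborel. (norm (F n x))\<^sup>2 \<le> M\<^sup>2 * I x" for n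
      proof (rule AE_I2)
        fix x
        have "(norm (F n x))\<^sup>2 \<le> (M * I x)\<^sup>2" by (rule power_mono[OF FI norm_ge_zero])
        then show "(norm (F n x))\<^sup>2 \<le> M\<^sup>2 * I x"
          by (cases "x \<in> cball 0 (R+1)") (simp_all add: power_mult_distrib I_def)
      qed
    qed (use cb in auto)
    have "plancherel_contractive f" by (rule plancherel_contractive_limit[OF Fi Fiso fi _ l2]) (use l1 in simp)
    then show ?thesis using l2 Fi Fiso Fm F by blast
  qed
  obtain F where F: "\<And>n. integrable lborel (F n)" "\<And>n. L2 (F n)" "\<And>n. plancherel_isometric (F n)"
    "\<And>n. (F n) \<in> borel_measurable borel" "\<And>n x. norm (F n x) \<le> M" "\<And>n x. R + 1 < norm x \<Longrightarrow> F n x = 0"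
    and l2: "(\<lambda>n. L2_norm (\<lambda>x. F n x - f x)) \<longlonglongrightarrow> 0"
    using conjunct2[OF plancherel_contractive[of f M R, OF m M R]] by auto
  have fi: "integrable lborel f" "L2 f" using bounded_support_integrable[OF m M R] by auto
  show ?thesis
  proof (rule plancherel_isometric_limit[OF F(1-3) fi conjunct1[OF plancherel_contractive[of f M R, OF m M R]] _ l2])
    fix n
    note F(4)[measurable]
    show "plancherel_contractive (\<lambda>x. F n x - f x)"
    proof (rule conjunct1[OF plancherel_contractive[of _ "2 * M" "R + 1"]])
      show "norm (F n x - f x) \<le> 2 * M" for x
        using norm_triangle_ineq4[of "F n x" "f x"] F(5)[of n x] M[of x] by simp
      show "F n x - f x = 0" if "R + 1 < norm x" for x using that F(6) R by simp
    qed measurable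
  qed
qed

text \<open>
  Truncate \<open>f\<close> in value and in space; the truncations are bounded with bounded support and
  converge in \<open>L\<^sup>1\<close> and in \<open>L\<^sup>2\<close>.
\<close>

theorem plancherel_isometric_L1_L2:
  fixes f :: "real^3 \<Rightarrow> complex"
  assumes f: "integrable lborel f" "L2 f"
  shows "plancherel_isometric f"
proof -
  \<comment> \<open>Stated for every such function, because it is applied to the differences from the limit as well.\<close>
  have plancherel_contractive: "plancherel_contractive f \<and> (\<exists>F. (\<forall>n. integrable lborel (F n) \<and> L2 (F n) \<and> plancherel_isometric (F n))
       \<and> (\<lambda>n. L2_norm (\<lambda>x. F n x - f x)) \<longlonglongrightarrow> 0)"
    if f: "integrable lborel f" "L2 f" for f :: "real^3 \<Rightarrow> complex"
  proof -
    have fm[measurable]: "f \<in> borel_measurable borel" using f by auto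
    define F where "F n x = (if norm x \<le> real n \<and> norm (f x) \<le> real n then f x else 0)" for n x
    have Fm[measurable]: "F n \<in> borel_measurable borel" for n unfolding F_def by measurable
    have b: "norm (F n x) \<le> real n" "real n < norm x \<Longrightarrow> F n x = 0" for n x by (auto simp: F_def)
    have Fi: "integrable lborel (F n)" "L2 (F n)" for n
      using bounded_support_integrable[OF Fm b] by auto
    have Fiso: "plancherel_isometric (F n)" for n by (rule plancherel_isometric_bounded_support[OF Fm b])
    have lim: "(\<lambda>n. F n x) \<longlonglongrightarrow> f x" for x
    proof (rule tendsto_eventually)
      have "\<forall>\<^sub>F n in sequentially. nat \<lceil>max (norm x) (norm (f x))\<rceil> \<le> n" by (rule eventually_ge_at_top)
      then show "\<forall>\<^sub>F n in sequentially. F n x = f x"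
        by eventually_elim (auto simp: F_def nat_le_iff ceiling_le_iff)
    qed
    have l1: "(\<lambda>n. LINT x|lborel. norm (F n x - f x)) \<longlonglongrightarrow> (LINT (x::real^3)|lborel. (0::real))"
    proof (rule integral_dominated_convergence[where w="\<lambda>x. norm (f x)"])
      show "AE x in lborel. (\<lambda>n. norm (F n x - f x)) \<longlonglongrightarrow> 0"
        using lim by (simp add: LIM_zero tendsto_norm_zero)
      show "AE x in lborel. norm (norm (F n x - f x)) \<le> norm (f x)" for n
        by (simp add: F_def)
    qed (use f in auto)
    have l2: "(\<lambda>n. L2_norm (\<lambda>x. F n x - f x)) \<longlonglongrightarrow> 0"
      by (rule L2_dominated(2)[OF Fm fm, where w="\<lambda>x. (norm (f x))\<^sup>2"])
        (use lim f in \<open>auto simp: F_def L2_def\<close>)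
    have "plancherel_contractive f" by (rule plancherel_contractive_limit[OF Fi Fiso f _ l2]) (use l1 in simp)
    then show ?thesis using l2 Fi Fiso by blast
  qed
  obtain F where F: "\<And>n. integrable lborel (F n)" "\<And>n. L2 (F n)" "\<And>n. plancherel_isometric (F n)"
    and l2: "(\<lambda>n. L2_norm (\<lambda>x. F n x - f x)) \<longlonglongrightarrow> 0"
    using conjunct2[OF plancherel_contractive[OF f]] by auto
  show ?thesis
    by (rule plancherel_isometric_limit[OF F f conjunct1[OF plancherel_contractive[OF f]] _ l2])
      (intro conjunct1[OF plancherel_contractive] Bochner_Integration.integrable_diff L2_diff F f)
qed

lemma fourier_integral_L2:
  "integrable lborel f \<Longrightarrow> L2 f \<Longrightarrow> L2 (fourier_integral f)"
  "integrable lborel f \<Longrightarrow> L2 f \<Longrightarrow> L2_norm (fourier_integral f) = plancherel_const * L2_norm f"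
  using plancherel_isometric_L1_L2[of f] by (auto simp: plancherel_isometric_def)

section \<open>The Plancherel transform of scalar functions\<close>

definition ball_truncation :: "real \<Rightarrow> (real^3 \<Rightarrow> complex) \<Rightarrow> real^3 \<Rightarrow> complex" where
  "ball_truncation R f x = indicator (cball 0 R) x *\<^sub>R f x"

lemma ball_truncation_L2: assumes "L2 f" shows "L2 (ball_truncation R f)" "integrable lborel (ball_truncation R f)"
proof -
  have [measurable]: "f \<in> borel_measurable borel" using assms by (rule L2_measurable)
  have [measurable]: "ball_truncation R f \<in> borel_measurable borel"
    unfolding ball_truncation_def[abs_def] by (intro borel_measurable_scaleR borel_measurable_indicator) auto
  show "L2 (ball_truncation R f)"
    by (rule L2_norm_mono(1)[OF _ assms]) (auto simp: ball_truncation_def indicator_def)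
  note cb = integrable_indicator_cball[of R]
  show "integrable lborel (ball_truncation R f)"
  proof (rule Bochner_Integration.integrable_bound)
    show "integrable lborel (\<lambda>x. indicator (cball 0 R) x + (norm (f x))\<^sup>2)"
      using assms cb by (auto simp: L2_def)
    show "AE x in lborel. norm (ball_truncation R f x) \<le> norm (indicator (cball 0 R) x + (norm (f x))\<^sup>2)"
    proof (rule AE_I2)
      fix x
      have "0 \<le> (norm (f x) - 1)\<^sup>2" by simp
      then have "2 * norm (f x) \<le> 1 + (norm (f x))\<^sup>2" by (simp add: power2_diff)
      then have "norm (f x) \<le> 1 + (norm (f x))\<^sup>2" using norm_ge_zero[of "f x"] by linarith
      then show "norm (ball_truncation R f x) \<le> norm (indicator (cball 0 R) x + (norm (f x))\<^sup>2)"
        by (simp add: ball_truncation_def indicator_def)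
    qed
  qed simp
qed

lemma ball_truncation_lim: assumes "L2 f" shows "((\<lambda>R. L2_norm (\<lambda>x. ball_truncation R f x - f x)) \<longlongrightarrow> 0) at_top"
proof (rule tendsto_at_topI_sequentially)
  fix X :: "nat \<Rightarrow> real" assume X: "filterlim X at_top sequentially"
  have m[measurable]: "f \<in> borel_measurable borel" using assms by (rule L2_measurable)
  show "(\<lambda>n. L2_norm (\<lambda>x. ball_truncation (X n) f x - f x)) \<longlonglongrightarrow> 0"
  proof (rule L2_dominated(2)[OF _ m, where w="\<lambda>x. (norm (f x))\<^sup>2"])
    show "AE x in lborel. (\<lambda>n. ball_truncation (X n) f x) \<longlonglongrightarrow> f x"
    proof (rule AE_I2, rule tendsto_eventually)
      fix x :: "real^3"
      have "\<forall>\<^sub>F n in sequentially. norm x \<le> X n" using X by (simp add: filterlim_at_top)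
      then show "\<forall>\<^sub>F n in sequentially. ball_truncation (X n) f x = f x"
        by eventually_elim (simp add: ball_truncation_def)
    qed
    show "ball_truncation (X n) f \<in> borel_measurable borel" for n by (rule L2_measurable[OF ball_truncation_L2(1)[OF assms]])
    show "integrable lborel (\<lambda>x. (norm (f x))\<^sup>2)" using assms by (simp add: L2_def)
    show "AE x in lborel. (norm (ball_truncation (X n) f x))\<^sup>2 \<le> (norm (f x))\<^sup>2" for n
      by (simp add: ball_truncation_def indicator_def)
  qed
qed

lemma ball_truncation_lim_seq: "L2 f \<Longrightarrow> (\<lambda>n. L2_norm (\<lambda>x. ball_truncation (real n) f x - f x)) \<longlonglongrightarrow> 0"
  using filterlim_compose[OF ball_truncation_lim filterlim_real_sequentially] .

text \<open>
  \<open>g\<close> is the Plancherel transform of \<open>f\<close>. Instead of choosing an approximating sequence, the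
  definition says that the Fourier integral of any \<open>h\<close> in \<open>L\<^sup>1 \<inter> L\<^sup>2\<close> is as far from \<open>g\<close> as \<open>h\<close>
  is from \<open>f\<close>, up to the constant; any approximation of \<open>f\<close> may then be used to compute \<open>g\<close>.
\<close>

definition plancherel_pair :: "(real^3 \<Rightarrow> complex) \<Rightarrow> (real^3 \<Rightarrow> complex) \<Rightarrow> bool" where
  "plancherel_pair f g \<longleftrightarrow> L2 f \<and> L2 g \<and>
     (\<forall>h. integrable lborel h \<longrightarrow> L2 h \<longrightarrow>
        L2_norm (\<lambda>\<xi>. fourier_integral h \<xi> - g \<xi>) = plancherel_const * L2_norm (\<lambda>x. h x - f x))"

lemma plancherel_pairD: "plancherel_pair f g \<Longrightarrow> L2 f" "plancherel_pair f g \<Longrightarrow> L2 g"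
  "plancherel_pair f g \<Longrightarrow> integrable lborel h \<Longrightarrow> L2 h \<Longrightarrow>
     L2_norm (\<lambda>\<xi>. fourier_integral h \<xi> - g \<xi>) = plancherel_const * L2_norm (\<lambda>x. h x - f x)"
  by (auto simp: plancherel_pair_def)

lemma fourier_integral_dist:
  assumes "integrable lborel f" "L2 f" "integrable lborel g" "L2 g"
  shows "L2_norm (\<lambda>\<xi>. fourier_integral f \<xi> - fourier_integral g \<xi>) = plancherel_const * L2_norm (\<lambda>x. f x - g x)"
  using fourier_integral_L2(2)[of "\<lambda>x. f x - g x"] assms by (simp add: fourier_integral_diff L2_diff cong: L2_norm_def)

lemma plancherel_pairI:
  assumes f: "L2 f" and g: "L2 g" and net: "net \<noteq> bot"
    and h: "\<And>n. integrable lborel (h n)" "\<And>n. L2 (h n)"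
    and hf: "((\<lambda>n. L2_norm (\<lambda>x. h n x - f x)) \<longlongrightarrow> 0) net"
    and hg: "((\<lambda>n. L2_norm (\<lambda>\<xi>. fourier_integral (h n) \<xi> - g \<xi>)) \<longlongrightarrow> 0) net"
  shows "plancherel_pair f g"
  unfolding plancherel_pair_def
proof (intro conjI f g allI impI)
  fix k :: "real^3 \<Rightarrow> complex" assume k: "integrable lborel k" "L2 k"
  have a: "((\<lambda>n. L2_norm (\<lambda>\<xi>. fourier_integral (h n) \<xi> - fourier_integral k \<xi>)) \<longlongrightarrow> L2_norm (\<lambda>\<xi>. g \<xi> - fourier_integral k \<xi>)) net"
    using k h g hg by (intro L2_norm_tendsto L2_diff fourier_integral_L2) simp_all
  have b: "((\<lambda>n. L2_norm (\<lambda>x. h n x - k x)) \<longlongrightarrow> L2_norm (\<lambda>x. f x - k x)) net"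
    using k h f hf by (intro L2_norm_tendsto L2_diff) simp_all
  have "((\<lambda>n. plancherel_const * L2_norm (\<lambda>x. h n x - k x)) \<longlongrightarrow> L2_norm (\<lambda>\<xi>. g \<xi> - fourier_integral k \<xi>)) net"
    using a by (simp add: fourier_integral_dist h k)
  moreover have "((\<lambda>n. plancherel_const * L2_norm (\<lambda>x. h n x - k x)) \<longlongrightarrow> plancherel_const * L2_norm (\<lambda>x. f x - k x)) net"
    by (intro tendsto_intros b)
  ultimately have "L2_norm (\<lambda>\<xi>. g \<xi> - fourier_integral k \<xi>) = plancherel_const * L2_norm (\<lambda>x. f x - k x)"
    by (rule tendsto_unique[OF net])
  then show "L2_norm (\<lambda>\<xi>. fourier_integral k \<xi> - g \<xi>) = plancherel_const * L2_norm (\<lambda>x. k x - f x)"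
    using L2_norm_minus_commute[of g "fourier_integral k"] L2_norm_minus_commute[of f k] by simp
qed

lemma plancherel_pair_lim:
  assumes p: "plancherel_pair f g" and h: "\<And>n. integrable lborel (h n)" "\<And>n. L2 (h n)"
    and hf: "((\<lambda>n. L2_norm (\<lambda>x. h n x - f x)) \<longlongrightarrow> 0) net"
  shows "((\<lambda>n. L2_norm (\<lambda>\<xi>. fourier_integral (h n) \<xi> - g \<xi>)) \<longlongrightarrow> 0) net"
  using tendsto_mult_right_zero[OF hf, of plancherel_const] by (simp add: plancherel_pairD(3)[OF p h])

lemma plancherel_pair_exists: assumes f: "L2 f" obtains g where "plancherel_pair f g"
proof -
  let ?h = "\<lambda>n. ball_truncation (real n) f"
  note h = ball_truncation_L2[OF f]
  obtain g where g: "L2 g" "(\<lambda>n. L2_norm (\<lambda>\<xi>. fourier_integral (?h n) \<xi> - g \<xi>)) \<longlonglongrightarrow> 0"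
  proof (rule L2_complete[of "\<lambda>n. fourier_integral (?h n)"])
    show "L2 (fourier_integral (?h n))" for n by (intro fourier_integral_L2 h)
    fix e :: real assume "0 < e"
    then have "0 < e / (2 * plancherel_const)" by simp
    from LIMSEQ_D[OF ball_truncation_lim_seq[OF f] this]
    obtain N where N: "\<And>n. n \<ge> N \<Longrightarrow> L2_norm (\<lambda>x. ?h n x - f x) < e / (2 * plancherel_const)" by auto
    have "L2_norm (\<lambda>\<xi>. fourier_integral (?h m) \<xi> - fourier_integral (?h n) \<xi>) < e" if "m \<ge> N" "n \<ge> N" for m n
    proof -
      have "L2_norm (\<lambda>x. ?h m x - ?h n x) \<le> L2_norm (\<lambda>x. ?h m x - f x) + L2_norm (\<lambda>x. f x - ?h n x)"
        by (intro L2_norm_triangle_diff h f)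
      also have "\<dots> < e / (2 * plancherel_const) + e / (2 * plancherel_const)"
        using N[OF that(1)] N[OF that(2)] by (intro add_strict_mono) (simp_all add: L2_norm_minus_commute[of f])
      also have "\<dots> = e / plancherel_const" by simp
      finally show ?thesis by (simp add: fourier_integral_dist h pos_less_divide_eq mult.commute)
    qed
    then show "\<exists>N. \<forall>m\<ge>N. \<forall>n\<ge>N. L2_norm (\<lambda>\<xi>. fourier_integral (?h m) \<xi> - fourier_integral (?h n) \<xi>) < e" by blast
  qed blast
  show ?thesis
    by (rule that, rule plancherel_pairI[OF f g(1) sequentially_bot h(2,1) ball_truncation_lim_seq[OF f] g(2)])
qed

lemma plancherel_pair_unique: assumes "plancherel_pair f g" "plancherel_pair f g'" shows "AE \<xi> in lborel. g \<xi> = g' \<xi>"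
proof (rule L2_lim_unique[OF _ _ _ sequentially_bot])
  note f = plancherel_pairD(1)[OF assms(1)]
  show "(\<lambda>n. L2_norm (\<lambda>\<xi>. fourier_integral (ball_truncation (real n) f) \<xi> - g \<xi>)) \<longlonglongrightarrow> 0"
    by (rule plancherel_pair_lim[OF assms(1) ball_truncation_L2(2,1)[OF f] ball_truncation_lim_seq[OF f]])
  show "(\<lambda>n. L2_norm (\<lambda>\<xi>. fourier_integral (ball_truncation (real n) f) \<xi> - g' \<xi>)) \<longlonglongrightarrow> 0"
    by (rule plancherel_pair_lim[OF assms(2) ball_truncation_L2(2,1)[OF f] ball_truncation_lim_seq[OF f]])
  show "L2 (fourier_integral (ball_truncation (real n) f))" for n by (intro fourier_integral_L2 ball_truncation_L2 f)
qed (use assms in \<open>auto dest: plancherel_pairD\<close>)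

lemma plancherel_pair_cong:
  assumes p: "plancherel_pair f g" and f': "f' \<in> borel_measurable borel" "AE x in lborel. f x = f' x"
    and g': "g' \<in> borel_measurable borel" "AE x in lborel. g x = g' x"
  shows "plancherel_pair f' g'"
proof -
  have m[measurable]: "f \<in> borel_measurable borel" "g \<in> borel_measurable borel"
    using p by (auto dest: plancherel_pairD intro: L2_measurable)
  note f'(1)[measurable] g'(1)[measurable]
  have "L2_norm (\<lambda>\<xi>. fourier_integral h \<xi> - g' \<xi>) = plancherel_const * L2_norm (\<lambda>x. h x - f' x)"
    if h: "integrable lborel h" "L2 h" for h
  proof -
    have [measurable]: "h \<in> borel_measurable borel" using h by auto
    have "L2_norm (\<lambda>\<xi>. fourier_integral h \<xi> - g' \<xi>) = L2_norm (\<lambda>\<xi>. fourier_integral h \<xi> - g \<xi>)"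
      by (rule L2_norm_cong_AE) (use g'(2) in auto)
    moreover have "L2_norm (\<lambda>x. h x - f' x) = L2_norm (\<lambda>x. h x - f x)"
      by (rule L2_norm_cong_AE) (use f'(2) in auto)
    ultimately show ?thesis using plancherel_pairD(3)[OF p h] by simp
  qed
  moreover have "L2 f'" by (rule L2_cong_AE[OF plancherel_pairD(1)[OF p] f'(2,1)])
  moreover have "L2 g'" by (rule L2_cong_AE[OF plancherel_pairD(2)[OF p] g'(2,1)])
  ultimately show ?thesis by (simp add: plancherel_pair_def)
qed

lemma plancherel_pair_norm: assumes "plancherel_pair f g" shows "L2_norm g = plancherel_const * L2_norm f"
  using plancherel_pairD(3)[OF assms, of "\<lambda>x. 0"] by (simp add: fourier_integral_def L2_norm_def)

lemma plancherel_pair_add: assumes "plancherel_pair f g" "plancherel_pair f' g'" shows "plancherel_pair (\<lambda>x. f x + f' x) (\<lambda>x. g x + g' x)"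
proof -
  note L = plancherel_pairD(1)[OF assms(1)] plancherel_pairD(1)[OF assms(2)] plancherel_pairD(2)[OF assms(1)] plancherel_pairD(2)[OF assms(2)]
  let ?h = "\<lambda>n. ball_truncation (real n) f" and ?h' = "\<lambda>n. ball_truncation (real n) f'"
  note h = ball_truncation_L2[OF L(1)] and h' = ball_truncation_L2[OF L(2)]
  have z: "(\<lambda>n. a n + b n) \<longlonglongrightarrow> 0" if "a \<longlonglongrightarrow> 0" "b \<longlonglongrightarrow> 0" for a b :: "nat \<Rightarrow> real"
    using tendsto_add[OF that] by simp
  show ?thesis
  proof (rule plancherel_pairI[OF L2_add[OF L(1,2)] L2_add[OF L(3,4)] sequentially_bot,
        of "\<lambda>n x. ?h n x + ?h' n x"])
    show "(\<lambda>n. L2_norm (\<lambda>x. ?h n x + ?h' n x - (f x + f' x))) \<longlonglongrightarrow> 0"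
    proof (rule Lim_null_comparison[OF _ z[OF ball_truncation_lim_seq[OF L(1)] ball_truncation_lim_seq[OF L(2)]]], intro always_eventually allI)
      fix n show "norm (L2_norm (\<lambda>x. ?h n x + ?h' n x - (f x + f' x)))
          \<le> L2_norm (\<lambda>x. ?h n x - f x) + L2_norm (\<lambda>x. ?h' n x - f' x)"
        using L2_norm_triangle[OF L2_diff[OF h(1)[of "real n"] L(1)] L2_diff[OF h'(1)[of "real n"] L(2)]]
        by (simp add: algebra_simps)
    qed
    show "(\<lambda>n. L2_norm (\<lambda>\<xi>. fourier_integral (\<lambda>x. ?h n x + ?h' n x) \<xi> - (g \<xi> + g' \<xi>))) \<longlonglongrightarrow> 0"
    proof (rule Lim_null_comparison[OF _ z[OF plancherel_pair_lim[OF assms(1) h(2,1) ball_truncation_lim_seq[OF L(1)]] plancherel_pair_lim[OF assms(2) h'(2,1) ball_truncation_lim_seq[OF L(2)]]]], intro always_eventually allI)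
      fix n show "norm (L2_norm (\<lambda>\<xi>. fourier_integral (\<lambda>x. ?h n x + ?h' n x) \<xi> - (g \<xi> + g' \<xi>)))
          \<le> L2_norm (\<lambda>x. fourier_integral (?h n) x - g x) + L2_norm (\<lambda>x. fourier_integral (?h' n) x - g' x)"
        using L2_norm_triangle[OF L2_diff[OF fourier_integral_L2(1)[OF h(2,1)[of "real n"]] L(3)] L2_diff[OF fourier_integral_L2(1)[OF h'(2,1)[of "real n"]] L(4)]]
        by (simp add: fourier_integral_add h h' algebra_simps)
    qed
  qed (use h h' in \<open>auto intro: L2_add\<close>)
qed

lemma L2_norm_cmult: fixes c :: complex shows "L2_norm (\<lambda>x. c * f x) = norm c * L2_norm f"
  by (simp add: L2_norm_def norm_mult power_mult_distrib real_sqrt_mult)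

lemma L2_cmult: fixes c :: complex assumes "L2 f" shows "L2 (\<lambda>x. c * f x)"
  using assms by (auto simp: L2_def norm_mult power_mult_distrib)

lemma plancherel_pair_cmult: assumes "plancherel_pair f g" shows "plancherel_pair (\<lambda>x. c * f x) (\<lambda>x. c * g x)"
proof -
  note L = plancherel_pairD(1)[OF assms] plancherel_pairD(2)[OF assms] and h = ball_truncation_L2[OF plancherel_pairD(1)[OF assms]]
  show ?thesis
  proof (rule plancherel_pairI[OF L2_cmult[OF L(1)] L2_cmult[OF L(2)] sequentially_bot,
        of "\<lambda>n x. c * ball_truncation (real n) f x"])
    show "(\<lambda>n. L2_norm (\<lambda>x. c * ball_truncation (real n) f x - c * f x)) \<longlonglongrightarrow> 0"
      using tendsto_mult_right_zero[OF ball_truncation_lim_seq[OF L(1)], of "norm c"]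
      by (simp add: right_diff_distrib[symmetric] L2_norm_cmult)
    show "(\<lambda>n. L2_norm (\<lambda>\<xi>. fourier_integral (\<lambda>x. c * ball_truncation (real n) f x) \<xi> - c * g \<xi>)) \<longlonglongrightarrow> 0"
      using tendsto_mult_right_zero[OF plancherel_pair_lim[OF assms h(2,1) ball_truncation_lim_seq[OF L(1)]], of "norm c"]
      by (simp add: fourier_integral_cmult right_diff_distrib[symmetric] L2_norm_cmult)
  qed (use h in \<open>auto intro: L2_cmult\<close>)
qed

lemma plancherel_pair_diff: assumes "plancherel_pair f g" "plancherel_pair f' g'" shows "plancherel_pair (\<lambda>x. f x - f' x) (\<lambda>x. g x - g' x)"
  using plancherel_pair_add[OF assms(1) plancherel_pair_cmult[OF assms(2), of "-1"]] by simp

lemma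
  fixes f :: "real^3 \<Rightarrow> 'b::euclidean_space"
  assumes c: "\<bar>c\<bar> = 1" and f: "f \<in> borel_measurable borel"
  shows L2_norm_affine: "L2_norm (\<lambda>x. f (t + c *\<^sub>R x)) = L2_norm f"
    and L2_affine: "L2 (\<lambda>x. f (t + c *\<^sub>R x)) \<longleftrightarrow> L2 f"
proof -
  note f[measurable]
  have c0: "c \<noteq> 0" using c by auto
  show "L2_norm (\<lambda>x. f (t + c *\<^sub>R x)) = L2_norm f"
    unfolding L2_norm_def using integral_lborel_affine[OF c0, of "\<lambda>x. (norm (f x))\<^sup>2" t] c by simp
  show "L2 (\<lambda>x. f (t + c *\<^sub>R x)) \<longleftrightarrow> L2 f"
    unfolding L2_def using integrable_lborel_affine[OF c0, of "\<lambda>x. (norm (f x))\<^sup>2" t] f by simp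
qed

lemma L2_translate: "L2 f \<Longrightarrow> L2 (\<lambda>x. f (x + a))"
  using L2_affine[of 1 f a] L2_measurable[of f] by (simp add: add.commute)

lemma L2_norm_translate: "L2 f \<Longrightarrow> L2_norm (\<lambda>x. f (x + a)) = L2_norm f"
  using L2_norm_affine[of 1 f a] L2_measurable[of f] by (simp add: add.commute)

lemma fourier_integral_translate: assumes "integrable lborel f" shows "fourier_integral (\<lambda>x. f (x + a)) \<xi> = cis (a \<bullet> \<xi>) * fourier_integral f \<xi>"
proof -
  have [measurable]: "f \<in> borel_measurable borel" using assms by auto
  have "fourier_integral f \<xi> = (LINT x|lborel. cis (- ((a + 1 *\<^sub>R x) \<bullet> \<xi>)) * f (a + 1 *\<^sub>R x))"
    unfolding fourier_integral_def by (subst integral_lborel_affine[of 1 _ a]) auto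
  also have "\<dots> = (LINT x|lborel. cis (- (a \<bullet> \<xi>)) * (cis (- (x \<bullet> \<xi>)) * f (x + a)))"
    by (intro Bochner_Integration.integral_cong refl)
      (simp add: inner_add_left mult.assoc[symmetric] cis_mult add.commute)
  also have "\<dots> = cis (- (a \<bullet> \<xi>)) * fourier_integral (\<lambda>x. f (x + a)) \<xi>" by (simp add: fourier_integral_def)
  finally show ?thesis by (simp add: mult.assoc[symmetric] cis_mult)
qed

lemma L2_cis_mult:
  fixes h :: "real^3 \<Rightarrow> real"
  assumes "L2 f" and [measurable]: "h \<in> borel_measurable borel" shows "L2 (\<lambda>x. cis (h x) * f x)"
  using assms L2_measurable[OF assms(1)] by (auto simp: L2_def norm_mult)

lemma plancherel_pair_translate: assumes "plancherel_pair f g" shows "plancherel_pair (\<lambda>x. f (x + a)) (\<lambda>\<xi>. cis (a \<bullet> \<xi>) * g \<xi>)"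
proof -
  note L = plancherel_pairD(1)[OF assms] plancherel_pairD(2)[OF assms] and h = ball_truncation_L2[OF plancherel_pairD(1)[OF assms]]
  have [measurable]: "ball_truncation R f \<in> borel_measurable borel" for R using h by auto
  show ?thesis
  proof (rule plancherel_pairI[OF L2_translate[OF L(1)] _ sequentially_bot,
        of _ "\<lambda>n x. ball_truncation (real n) f (x + a)"])
    show "L2 (\<lambda>\<xi>. cis (a \<bullet> \<xi>) * g \<xi>)" by (rule L2_cis_mult[OF L(2)]) measurable
    show "(\<lambda>n. L2_norm (\<lambda>x. ball_truncation (real n) f (x + a) - f (x + a))) \<longlonglongrightarrow> 0"
      using ball_truncation_lim_seq[OF L(1)] by (simp add: L2_norm_translate[OF L2_diff[OF h(1) L(1)]])
    have "L2_norm (\<lambda>\<xi>. cis (a \<bullet> \<xi>) * k \<xi>) = L2_norm k" for k by (simp add: L2_norm_def norm_mult)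
    then show "(\<lambda>n. L2_norm (\<lambda>\<xi>. fourier_integral (\<lambda>x. ball_truncation (real n) f (x + a)) \<xi> - cis (a \<bullet> \<xi>) * g \<xi>)) \<longlonglongrightarrow> 0"
      using plancherel_pair_lim[OF assms h(2,1) ball_truncation_lim_seq[OF L(1)]]
      by (simp add: fourier_integral_translate h right_diff_distrib[symmetric])
    show "integrable lborel (\<lambda>x. ball_truncation (real n) f (x + a))" for n
      using integrable_lborel_affine[of 1 "ball_truncation (real n) f" a] h(2) by (simp add: add.commute)
  qed (rule L2_translate[OF h(1)])
qed

lemma L2_cnj: "L2 f \<Longrightarrow> L2 (\<lambda>x. cnj (f x))"
  unfolding L2_def by (auto intro: borel_measurable_cnj)

lemma L2_norm_cnj: "L2_norm (\<lambda>x. cnj (f x)) = L2_norm f"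
  by (simp add: L2_norm_def)

lemma L2_reflect: "L2 f \<Longrightarrow> L2 (\<lambda>x. f (- x))"
  using L2_affine[of "-1" f 0] L2_measurable[of f] by simp

lemma L2_norm_reflect: "L2 f \<Longrightarrow> L2_norm (\<lambda>x. f (- x)) = L2_norm f"
  using L2_norm_affine[of "-1" f 0] L2_measurable[of f] by simp

lemma plancherel_pair_cnj: assumes "plancherel_pair f g" shows "plancherel_pair (\<lambda>x. cnj (f x)) (\<lambda>\<xi>. cnj (g (- \<xi>)))"
proof -
  note L = plancherel_pairD(1)[OF assms] plancherel_pairD(2)[OF assms] and h = ball_truncation_L2[OF plancherel_pairD(1)[OF assms]]
  show ?thesis
  proof (rule plancherel_pairI[OF L2_cnj[OF L(1)] L2_cnj[OF L2_reflect[OF L(2)]] sequentially_bot,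
        of "\<lambda>n x. cnj (ball_truncation (real n) f x)"])
    show "(\<lambda>n. L2_norm (\<lambda>x. cnj (ball_truncation (real n) f x) - cnj (f x))) \<longlonglongrightarrow> 0"
      using ball_truncation_lim_seq[OF L(1)] unfolding complex_cnj_diff[symmetric] L2_norm_cnj .
    have e: "fourier_integral (\<lambda>x. cnj (ball_truncation (real n) f x)) \<xi> = cnj (fourier_integral (ball_truncation (real n) f) (- \<xi>))" for n \<xi>
      by (simp add: fourier_integral_cnj)
    show "(\<lambda>n. L2_norm (\<lambda>\<xi>. fourier_integral (\<lambda>x. cnj (ball_truncation (real n) f x)) \<xi> - cnj (g (- \<xi>)))) \<longlonglongrightarrow> 0"
      using plancherel_pair_lim[OF assms h(2,1) ball_truncation_lim_seq[OF L(1)]]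
      unfolding e complex_cnj_diff[symmetric] L2_norm_cnj
      by (simp add: L2_norm_reflect[OF L2_diff[OF fourier_integral_L2(1)[OF h(2,1)] L(2)]])
  qed (use h in \<open>auto intro: L2_cnj\<close>)
qed

lemma plancherel_pair_mult_formula:
  assumes "plancherel_pair f f'" "plancherel_pair g g'"
  shows "L2_inner f' (\<lambda>x. cnj (g x)) = L2_inner f (\<lambda>x. cnj (g' x))"
proof -
  note L = plancherel_pairD(1)[OF assms(1)] plancherel_pairD(2)[OF assms(1)] plancherel_pairD(1)[OF assms(2)] plancherel_pairD(2)[OF assms(2)]
  note h = ball_truncation_L2[OF L(1)] and k = ball_truncation_L2[OF L(3)]
  have inn: "a \<bullet> cnj b = Re (a * b)" for a b by (simp add: inner_complex_def)
  have eq: "L2_inner (fourier_integral (ball_truncation n f)) (\<lambda>x. cnj (ball_truncation n g x)) = L2_inner (ball_truncation n f) (\<lambda>x. cnj (fourier_integral (ball_truncation n g) x))" for n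
  proof -
    have "L2_inner (fourier_integral (ball_truncation n f)) (\<lambda>x. cnj (ball_truncation n g x)) = Re (LINT \<xi>|lborel. fourier_integral (ball_truncation n f) \<xi> * ball_truncation n g \<xi>)"
    proof -
      have "integrable lborel (\<lambda>\<xi>. fourier_integral (ball_truncation n f) \<xi> * ball_truncation n g \<xi>)"
      proof (rule Bochner_Integration.integrable_bound)
        show "integrable lborel (\<lambda>\<xi>. (LINT x|lborel. norm (ball_truncation n f x)) * norm (ball_truncation n g \<xi>))" using k by auto
        show "(\<lambda>\<xi>. fourier_integral (ball_truncation n f) \<xi> * ball_truncation n g \<xi>) \<in> borel_measurable lborel"
          using L2_measurable[OF h(1)[of n]] L2_measurable[OF k(1)[of n]] by measurable
        show "AE \<xi> in lborel. norm (fourier_integral (ball_truncation n f) \<xi> * ball_truncation n g \<xi>) \<le> norm ((LINT x|lborel. norm (ball_truncation n f x)) * norm (ball_truncation n g \<xi>))"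
          using norm_fourier_integral_le[OF h(2)[of n]] by (auto simp: norm_mult intro!: mult_right_mono)
      qed
      then show ?thesis unfolding L2_inner_def inn by (rule integral_Re)
    qed
    also have "\<dots> = Re (LINT x|lborel. ball_truncation n f x * fourier_integral (ball_truncation n g) x)"
      by (simp add: fourier_integral_mult_formula h k)
    also have "\<dots> = L2_inner (ball_truncation n f) (\<lambda>x. cnj (fourier_integral (ball_truncation n g) x))"
    proof -
      have "integrable lborel (\<lambda>\<xi>. ball_truncation n f \<xi> * fourier_integral (ball_truncation n g) \<xi>)"
      proof (rule Bochner_Integration.integrable_bound)
        show "integrable lborel (\<lambda>\<xi>. norm (ball_truncation n f \<xi>) * (LINT x|lborel. norm (ball_truncation n g x)))" using h by auto
        show "(\<lambda>\<xi>. ball_truncation n f \<xi> * fourier_integral (ball_truncation n g) \<xi>) \<in> borel_measurable lborel"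
          using L2_measurable[OF h(1)[of n]] L2_measurable[OF k(1)[of n]] by measurable
        show "AE \<xi> in lborel. norm (ball_truncation n f \<xi> * fourier_integral (ball_truncation n g) \<xi>) \<le> norm (norm (ball_truncation n f \<xi>) * (LINT x|lborel. norm (ball_truncation n g x)))"
          using norm_fourier_integral_le[OF k(2)[of n]] by (auto simp: norm_mult intro!: mult_left_mono)
      qed
      then show ?thesis unfolding L2_inner_def inn by (rule integral_Re[symmetric])
    qed
    finally show ?thesis .
  qed
  have tg: "(\<lambda>n. L2_norm (\<lambda>x. cnj (ball_truncation (real n) g x) - cnj (g x))) \<longlonglongrightarrow> 0"
    using ball_truncation_lim_seq[OF L(3)] unfolding complex_cnj_diff[symmetric] L2_norm_cnj .
  have tg': "(\<lambda>n. L2_norm (\<lambda>x. cnj (fourier_integral (ball_truncation (real n) g) x) - cnj (g' x))) \<longlonglongrightarrow> 0"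
    using plancherel_pair_lim[OF assms(2) k(2,1) ball_truncation_lim_seq[OF L(3)]] unfolding complex_cnj_diff[symmetric] L2_norm_cnj .
  have "(\<lambda>n. L2_inner (fourier_integral (ball_truncation (real n) f)) (\<lambda>x. cnj (ball_truncation (real n) g x))) \<longlonglongrightarrow> L2_inner f' (\<lambda>x. cnj (g x))"
    by (intro L2_inner_tendsto fourier_integral_L2 L2_cnj h k L tg plancherel_pair_lim[OF assms(1) h(2,1) ball_truncation_lim_seq[OF L(1)]])
  moreover have "(\<lambda>n. L2_inner (ball_truncation (real n) f) (\<lambda>x. cnj (fourier_integral (ball_truncation (real n) g) x))) \<longlonglongrightarrow> L2_inner f (\<lambda>x. cnj (g' x))"
    by (intro L2_inner_tendsto fourier_integral_L2 L2_cnj h k L tg' ball_truncation_lim_seq[OF L(1)])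
  ultimately show ?thesis unfolding eq by (rule LIMSEQ_unique)
qed

text \<open>
  The candidate is \<open>h = (2\<pi>)\<^sup>-\<^sup>3 cnj (F (cnj G))\<close>, the formal inverse transform. If \<open>H\<close> is the
  transform of \<open>h\<close>, then \<open>\<parallel>H\<parallel> = \<parallel>G\<parallel>\<close> by isometry, and \<open>\<langle>H, G\<rangle> = \<parallel>G\<parallel>\<^sup>2\<close> by the multiplication
  formula. Hence \<open>\<parallel>H - G\<parallel>\<^sup>2 = 0\<close>.
\<close>

theorem plancherel_pair_surj: assumes G: "L2 G" obtains h where "plancherel_pair h G"
proof -
  obtain G' where G': "plancherel_pair (\<lambda>x. cnj (G x)) G'" using plancherel_pair_exists[OF L2_cnj[OF G]] .
  define K where "K = (2 * pi) ^ 3"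
  have K0: "0 < K" by (simp add: K_def)
  define h where "h x = (1 / K) *\<^sub>R cnj (G' x)" for x
  have hL: "L2 h" unfolding h_def by (intro L2_scaleR L2_cnj plancherel_pairD(2)[OF G'])
  obtain H where H: "plancherel_pair h H" using plancherel_pair_exists[OF hL] .
  have HL: "L2 H" by (rule plancherel_pairD(2)[OF H])
  have nG': "(L2_norm G')\<^sup>2 = K * (L2_norm G)\<^sup>2"
    using plancherel_pair_norm[OF G'] K0 by (simp add: L2_norm_cnj power_mult_distrib K_def)
  have nh: "(L2_norm h)\<^sup>2 = (L2_norm G)\<^sup>2 / K"
  proof -
    have "(L2_norm h)\<^sup>2 = (1 / K)\<^sup>2 * (L2_norm G')\<^sup>2"
      unfolding h_def L2_norm_scaleR L2_norm_cnj power_mult_distrib power2_abs ..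
    then show ?thesis unfolding nG' using K0 by (simp add: power2_eq_square)
  qed
  have nH: "(L2_norm H)\<^sup>2 = (L2_norm G)\<^sup>2"
    using plancherel_pair_norm[OF H] K0 by (simp add: power_mult_distrib nh K_def)
  have "L2_inner H (\<lambda>x. cnj (cnj (G x))) = L2_inner h (\<lambda>x. cnj (G' x))"
    by (rule plancherel_pair_mult_formula[OF H G'])
  also have "(\<lambda>x. cnj (G' x)) = (\<lambda>x. K *\<^sub>R h x)" using K0 by (simp add: h_def)
  finally have "L2_inner H G = K * (L2_norm h)\<^sup>2" by (simp add: L2_inner_scaleR_right L2_norm_sq_inner)
  then have "L2_inner H G = (L2_norm G)\<^sup>2" using nh K0 by simp
  then have "(L2_norm (\<lambda>x. H x - G x))\<^sup>2 = 0" using L2_norm_sq_diff[OF HL G] nH by simp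
  then have "AE x in lborel. H x = G x" using L2_norm_eq_0[OF L2_diff[OF HL G]] by simp
  then have "plancherel_pair h G" by (intro plancherel_pair_cong[OF H]) (use hL G in \<open>auto intro: L2_measurable\<close>)
  then show ?thesis by (rule that)
qed

section \<open>Classical derivatives and the Fourier transform\<close>

definition difference_quotient :: "nat \<Rightarrow> 3 \<Rightarrow> (real^3 \<Rightarrow> 'b::real_vector) \<Rightarrow> real^3 \<Rightarrow> 'b" where
  "difference_quotient n j f x = real (Suc n) *\<^sub>R (f (x + axis j (1 / real (Suc n))) - f x)"

text \<open>
  The multiplier of the difference quotient with step \<open>1 / (n + 1)\<close>.
\<close>

definition difference_symbol :: "nat \<Rightarrow> 3 \<Rightarrow> real^3 \<Rightarrow> complex" where
  "difference_symbol n j \<xi> = of_real (real (Suc n)) * (cis (\<xi> $ j / real (Suc n)) - 1)"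

lemma cis_minus_one_le: "norm (cis t - 1) \<le> \<bar>t\<bar>"
  using iexp_approx1[of t 0] by (simp add: cis_conv_exp)

lemma difference_symbol_le: "norm (difference_symbol n j \<xi>) \<le> \<bar>\<xi> $ j\<bar>"
proof -
  have "norm (difference_symbol n j \<xi>) = real (Suc n) * norm (cis (\<xi> $ j / real (Suc n)) - 1)"
    unfolding difference_symbol_def norm_mult norm_of_real by simp
  also have "\<dots> \<le> real (Suc n) * \<bar>\<xi> $ j / real (Suc n)\<bar>"
    by (intro mult_left_mono cis_minus_one_le) simp
  finally show ?thesis by (simp del: of_nat_Suc)
qed

lemma difference_symbol_lim: "(\<lambda>n. difference_symbol n j \<xi>) \<longlonglongrightarrow> \<i> * of_real (\<xi> $ j)"
proof -
  let ?c = "of_real (\<xi> $ j) :: complex"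
  have "((\<lambda>z. exp (\<i> * ?c * z)) has_field_derivative (\<i> * ?c)) (at 0)"
    by (auto intro!: derivative_eq_intros)
  then have "((\<lambda>h. (exp (\<i> * ?c * h) - 1) / h) \<longlongrightarrow> \<i> * ?c) (at 0)"
    by (simp add: DERIV_def)
  moreover have "filterlim (\<lambda>n. of_real (1 / real (Suc n)) :: complex) (at 0) sequentially"
    unfolding filterlim_at
  proof
    show "(\<lambda>n. of_real (1 / real (Suc n)) :: complex) \<longlonglongrightarrow> 0"
      using tendsto_of_real[OF LIMSEQ_Suc[OF lim_1_over_n[where 'a=real]], where 'a=complex] by simp
    show "\<forall>\<^sub>F n in sequentially. of_real (1 / real (Suc n)) \<in> (UNIV::complex set) \<and> of_real (1 / real (Suc n)) \<noteq> (0::complex)"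
      by (intro always_eventually) (simp del: of_nat_Suc)
  qed
  ultimately have "(\<lambda>n. (exp (\<i> * ?c * of_real (1 / real (Suc n))) - 1) / of_real (1 / real (Suc n))) \<longlonglongrightarrow> \<i> * ?c"
    by (rule filterlim_compose)
  moreover have "(exp (\<i> * ?c * of_real (1 / real (Suc n))) - 1) / of_real (1 / real (Suc n)) = difference_symbol n j \<xi>" for n
    by (simp add: difference_symbol_def cis_conv_exp mult.assoc mult.commute del: of_nat_Suc)
  ultimately show ?thesis by simp
qed

lemma difference_symbol_measurable[measurable]: "difference_symbol n j \<in> borel_measurable borel"
  unfolding difference_symbol_def by measurable

lemma plancherel_pair_difference_quotient: assumes "plancherel_pair f g" shows "plancherel_pair (difference_quotient n j f) (\<lambda>\<xi>. difference_symbol n j \<xi> * g \<xi>)"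
proof -
  have "plancherel_pair (\<lambda>x. of_real (real (Suc n)) * (f (x + axis j (1 / real (Suc n))) - f x))
      (\<lambda>\<xi>. of_real (real (Suc n)) * (cis (axis j (1 / real (Suc n)) \<bullet> \<xi>) * g \<xi> - g \<xi>))"
    by (intro plancherel_pair_cmult plancherel_pair_diff plancherel_pair_translate assms)
  moreover have "(\<lambda>x. of_real (real (Suc n)) * (f (x + axis j (1 / real (Suc n))) - f x)) = difference_quotient n j f"
    by (rule ext) (simp add: difference_quotient_def scaleR_conv_of_real)
  moreover have "(\<lambda>\<xi>. of_real (real (Suc n)) * (cis (axis j (1 / real (Suc n)) \<bullet> \<xi>) * g \<xi> - g \<xi>)) = (\<lambda>\<xi>. difference_symbol n j \<xi> * g \<xi>)"
    by (rule ext) (simp add: difference_symbol_def inner_axis' algebra_simps)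
  ultimately show ?thesis by simp
qed

lemma plancherel_pair_dist: assumes "plancherel_pair f g" "plancherel_pair f' g'" shows "L2_norm (\<lambda>\<xi>. g \<xi> - g' \<xi>) = plancherel_const * L2_norm (\<lambda>x. f x - f' x)"
  by (rule plancherel_pair_norm[OF plancherel_pair_diff[OF assms]])

text \<open>
  The transforms of the difference quotients converge in \<open>L\<^sup>2\<close> to the transform of \<open>w\<close>, and
  pointwise to \<open>i \<xi>\<^sub>j g\<close>. This form serves for test functions, where no decay of \<open>g\<close> is known in
  advance.
\<close>

lemma plancherel_pair_L2_derivative:
  assumes p: "plancherel_pair f g" and w: "L2 w" and lim: "(\<lambda>n. L2_norm (\<lambda>x. difference_quotient n j f x - w x)) \<longlonglongrightarrow> 0"
  shows "plancherel_pair w (\<lambda>\<xi>. \<i> * of_real (\<xi> $ j) * g \<xi>)"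
proof -
  obtain k where k: "plancherel_pair w k" using plancherel_pair_exists[OF w] .
  have "(\<lambda>n. L2_norm (\<lambda>\<xi>. difference_symbol n j \<xi> * g \<xi> - k \<xi>)) \<longlonglongrightarrow> 0"
    using tendsto_mult_right_zero[OF lim, of plancherel_const] by (simp add: plancherel_pair_dist[OF plancherel_pair_difference_quotient[OF p] k])
  then obtain r where r: "strict_mono r" "AE \<xi> in lborel. (\<lambda>n. difference_symbol (r n) j \<xi> * g \<xi>) \<longlonglongrightarrow> k \<xi>"
    using L2_lim_AE_subseq[of "\<lambda>n \<xi>. difference_symbol n j \<xi> * g \<xi>" k, OF plancherel_pairD(2)[OF plancherel_pair_difference_quotient[OF p]] plancherel_pairD(2)[OF k]] by blast
  have "AE \<xi> in lborel. k \<xi> = \<i> * of_real (\<xi> $ j) * g \<xi>"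
    using r(2)
  proof eventually_elim
    case (elim \<xi>)
    have "(\<lambda>n. difference_symbol (r n) j \<xi> * g \<xi>) \<longlonglongrightarrow> \<i> * of_real (\<xi> $ j) * g \<xi>"
      by (intro tendsto_intros LIMSEQ_subseq_LIMSEQ[OF difference_symbol_lim r(1), unfolded o_def])
    then show ?case using LIMSEQ_unique elim by blast
  qed
  then show ?thesis
    by (intro plancherel_pair_cong[OF k]) (use L2_measurable[OF w] L2_measurable[OF plancherel_pairD(2)[OF p]] in auto)
qed

text \<open>
  Conversely, if \<open>\<xi>\<^sub>j g\<close> is square-integrable, it is the transform of some \<open>w\<close>, and the
  difference quotients converge to \<open>w\<close> in \<open>L\<^sup>2\<close> because their symbols are dominated by \<open>|\<xi>\<^sub>j|\<close>.
  As they converge pointwise to the classical derivative, that derivative is \<open>w\<close>.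
\<close>

lemma plancherel_pair_pointwise_derivative:
  assumes p: "plancherel_pair f g" and L: "L2 (\<lambda>\<xi>. \<i> * of_real (\<xi> $ j) * g \<xi>)"
    and lim: "\<And>x. (\<lambda>n. difference_quotient n j f x) \<longlonglongrightarrow> f' x"
  shows "plancherel_pair f' (\<lambda>\<xi>. \<i> * of_real (\<xi> $ j) * g \<xi>)"
proof -
  let ?k = "\<lambda>\<xi>. \<i> * of_real (\<xi> $ j) * g \<xi>"
  obtain w where w: "plancherel_pair w ?k" using plancherel_pair_surj[OF L] .
  have g_measurable[measurable]: "g \<in> borel_measurable borel" by (rule L2_measurable[OF plancherel_pairD(2)[OF p]])
  have dm[measurable]: "difference_quotient n j f \<in> borel_measurable borel" for n
    by (rule L2_measurable[OF plancherel_pairD(1)[OF plancherel_pair_difference_quotient[OF p]]])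
  have "(\<lambda>n. L2_norm (\<lambda>\<xi>. difference_symbol n j \<xi> * g \<xi> - ?k \<xi>)) \<longlonglongrightarrow> 0"
  proof (rule L2_dominated(2)[where w="\<lambda>\<xi>. (norm (?k \<xi>))\<^sup>2"])
    show "AE \<xi> in lborel. (\<lambda>n. difference_symbol n j \<xi> * g \<xi>) \<longlonglongrightarrow> ?k \<xi>"
      by (intro AE_I2 tendsto_intros difference_symbol_lim)
    show "integrable lborel (\<lambda>\<xi>. (norm (?k \<xi>))\<^sup>2)" using L by (simp add: L2_def)
    show "AE \<xi> in lborel. (norm (difference_symbol n j \<xi> * g \<xi>))\<^sup>2 \<le> (norm (?k \<xi>))\<^sup>2" for n
      unfolding norm_mult using difference_symbol_le by (intro AE_I2 power_mono mult_right_mono) auto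
  qed measurable
  then have "(\<lambda>n. plancherel_const * L2_norm (\<lambda>x. difference_quotient n j f x - w x)) \<longlonglongrightarrow> 0"
    by (simp add: plancherel_pair_dist[OF plancherel_pair_difference_quotient[OF p] w])
  then have "(\<lambda>n. L2_norm (\<lambda>x. difference_quotient n j f x - w x)) \<longlonglongrightarrow> 0"
    using tendsto_mult_right_zero[of "\<lambda>n. plancherel_const * L2_norm (\<lambda>x. difference_quotient n j f x - w x)" sequentially "1 / plancherel_const"]
    by simp
  then obtain r where r: "strict_mono r" "AE x in lborel. (\<lambda>n. difference_quotient (r n) j f x) \<longlonglongrightarrow> w x"
    using L2_lim_AE_subseq[of "\<lambda>n. difference_quotient n j f" w, OF plancherel_pairD(1)[OF plancherel_pair_difference_quotient[OF p]] plancherel_pairD(1)[OF w]] by blast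
  have "AE x in lborel. w x = f' x"
    using r(2)
  proof eventually_elim
    case (elim x)
    show ?case using LIMSEQ_unique[OF elim LIMSEQ_subseq_LIMSEQ[OF lim[of x] r(1), unfolded o_def]] .
  qed
  moreover have "f' \<in> borel_measurable borel"
    by (rule borel_measurable_LIMSEQ_metric[OF dm]) (use lim in auto)
  ultimately show ?thesis by (intro plancherel_pair_cong[OF w]) auto
qed

lemma DERIV_along_axis:
  fixes f :: "real^3 \<Rightarrow> real"
  assumes "f differentiable (at (x + t *\<^sub>R axis j 1))"
  shows "((\<lambda>h. f (x + h *\<^sub>R axis j 1)) has_field_derivative partial j f (x + t *\<^sub>R axis j 1)) (at t)"
proof -
  let ?x = "x + t *\<^sub>R axis j 1"
  have d: "(f has_derivative frechet_derivative f (at ?x)) (at ?x)"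
    using assms by (simp add: frechet_derivative_works)
  have "((\<lambda>h. f (x + h *\<^sub>R axis j 1)) has_derivative (\<lambda>h. frechet_derivative f (at ?x) (h *\<^sub>R axis j 1))) (at t)"
    by (rule has_derivative_compose[of "\<lambda>h. x + h *\<^sub>R axis j 1" _ t UNIV f, simplified])
      (auto intro!: derivative_eq_intros d)
  moreover have "(\<lambda>h. frechet_derivative f (at ?x) (h *\<^sub>R axis j 1)) = (\<lambda>h. h * partial j f ?x)"
    using linear_frechet_derivative[OF assms] by (simp add: linear_scale partial_def)
  ultimately show ?thesis
    by (simp add: has_field_derivative_def mult.commute[of _ "partial j f ?x"])
qed

lemma axis_eq_scaleR: "axis j r = r *\<^sub>R (axis j 1 :: real^3)"
  by (simp add: vec_eq_iff axis_def)

lemma difference_quotient_tendsto_partial: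
  fixes f :: "real^3 \<Rightarrow> real"
  assumes "f differentiable (at x)"
  shows "(\<lambda>n. difference_quotient n j f x) \<longlonglongrightarrow> partial j f x"
proof -
  have "((\<lambda>h. (f (x + h *\<^sub>R axis j 1) - f x) / h) \<longlongrightarrow> partial j f x) (at 0)"
    using DERIV_along_axis[of f x 0 j] assms by (simp add: DERIV_def)
  moreover have "filterlim (\<lambda>n. 1 / real (Suc n)) (at 0) sequentially"
    unfolding filterlim_at using LIMSEQ_Suc[OF lim_1_over_n[where 'a=real]]
    by (auto simp: eventually_sequentially)
  ultimately have "(\<lambda>n. (f (x + (1 / real (Suc n)) *\<^sub>R axis j 1) - f x) / (1 / real (Suc n))) \<longlonglongrightarrow> partial j f x"
    by (rule filterlim_compose)
  then show ?thesis
    by (simp add: difference_quotient_def axis_eq_scaleR[of j "1 / real (Suc _)"] mult.commute del: of_nat_Suc)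
qed

abbreviation cx :: "(real^3 \<Rightarrow> real) \<Rightarrow> real^3 \<Rightarrow> complex" where
  "cx f \<equiv> \<lambda>x. complex_of_real (f x)"

lemma difference_quotient_cx: "difference_quotient n j (cx f) x = complex_of_real (difference_quotient n j f x)"
  by (simp add: difference_quotient_def scaleR_conv_of_real)

lemma plancherel_pair_partial:
  assumes p: "plancherel_pair (cx f) g" and L: "L2 (\<lambda>\<xi>. \<i> * of_real (\<xi> $ j) * g \<xi>)"
    and d: "\<And>x. f differentiable (at x)"
  shows "plancherel_pair (cx (partial j f)) (\<lambda>\<xi>. \<i> * of_real (\<xi> $ j) * g \<xi>)"
  by (rule plancherel_pair_pointwise_derivative[OF p L])
    (unfold difference_quotient_cx, intro tendsto_of_real difference_quotient_tendsto_partial d)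


section \<open>Fourier transform of vector fields\<close>

lemma borel_vec_nth[measurable (raw)]:
  fixes f :: "'a \<Rightarrow> ('b::euclidean_space)^'n"
  shows "f \<in> borel_measurable M \<Longrightarrow> (\<lambda>x. f x $ i) \<in> borel_measurable M"
  by (rule borel_measurable_continuous_on[OF linear_continuous_on[OF bounded_linear_vec_nth]])

lemma borel_vecI:
  fixes f :: "'a \<Rightarrow> ('b::euclidean_space)^'n"
  assumes "\<And>i. (\<lambda>x. f x $ i) \<in> borel_measurable M"
  shows "f \<in> borel_measurable M"
proof -
  have "(\<lambda>x. f x \<bullet> axis i u) \<in> borel_measurable M" for i u
    unfolding inner_axis using assms by measurable
  then show ?thesis
    by (subst borel_measurable_euclidean_space) (auto simp: Basis_vec_def)
qed

lemma norm_sq_vec: "(norm (v::('b::real_inner)^'n))\<^sup>2 = (\<Sum>i\<in>UNIV. (norm (v $ i))\<^sup>2)"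
  by (simp add: power2_norm_eq_inner inner_vec_def)

lemma L2_vec_iff:
  fixes f :: "real^3 \<Rightarrow> ('b::euclidean_space)^'n"
  shows "L2 f \<longleftrightarrow> (\<forall>i. L2 (\<lambda>x. f x $ i))"
proof
  assume f: "L2 f"
  show "\<forall>i. L2 (\<lambda>x. f x $ i)"
    using L2_measurable[OF f] by (auto intro!: L2_norm_mono(1)[OF _ f] simp: Finite_Cartesian_Product.norm_nth_le)
next
  assume f: "\<forall>i. L2 (\<lambda>x. f x $ i)"
  then have [measurable]: "f \<in> borel_measurable borel"
    by (intro borel_vecI) (auto intro: L2_measurable)
  show "L2 f" unfolding L2_def norm_sq_vec
    using f by (auto simp: L2_def intro!: Bochner_Integration.integrable_sum)
qed

lemma L2_norm_sq_vec:
  fixes f :: "real^3 \<Rightarrow> ('b::euclidean_space)^'n"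
  assumes "L2 f"
  shows "(L2_norm f)\<^sup>2 = (\<Sum>i\<in>UNIV. (L2_norm (\<lambda>x. f x $ i))\<^sup>2)"
  unfolding L2_norm_sq norm_sq_vec
  using assms by (intro Bochner_Integration.integral_sum) (auto simp: L2_vec_iff L2_def)

lemma L2_norm_component_le:
  fixes f :: "real^3 \<Rightarrow> ('b::euclidean_space)^'n"
  assumes "L2 f" shows "L2_norm (\<lambda>x. f x $ i) \<le> L2_norm f"
  using L2_measurable[OF assms]
  by (intro L2_norm_mono(2)[OF _ assms]) (auto simp: Finite_Cartesian_Product.norm_nth_le)

lemma L2_cx: "L2 (cx f) \<longleftrightarrow> L2 f"
proof -
  have "f \<in> borel_measurable borel" if "cx f \<in> borel_measurable borel"
  proof -
    have "(\<lambda>x. Re (cx f x)) \<in> borel_measurable borel" using that by measurable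
    then show ?thesis by simp
  qed
  moreover have "cx f \<in> borel_measurable borel" if "f \<in> borel_measurable borel"
    using that by measurable
  ultimately have "cx f \<in> borel_measurable borel \<longleftrightarrow> f \<in> borel_measurable borel" by blast
  then show ?thesis by (simp add: L2_def)
qed

lemma fourier_ball_nth: "fourier_ball R f \<xi> $ j = fourier_integral (ball_truncation R (cx (\<lambda>x. f x $ j))) \<xi>"
  unfolding fourier_ball_def fourier_integral_def ball_truncation_def set_lebesgue_integral_def
  by (simp add: mult_ac)

text \<open>
  The integrals over balls are the Fourier integrals of the truncated components, so the
  transform of a field is the Plancherel transform taken in each component.
\<close>

lemma is_fourier_iff: "is_fourier f g \<longleftrightarrow> (\<forall>j. plancherel_pair (cx (\<lambda>x. f x $ j)) (\<lambda>\<xi>. g \<xi> $ j))"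
proof -
  have conv: "((\<lambda>R. \<integral>\<^sup>+ \<xi>. ennreal ((norm (fourier_ball R f \<xi> - g \<xi>))\<^sup>2) \<partial>lborel) \<longlongrightarrow> 0) at_top
      \<longleftrightarrow> ((\<lambda>R. L2_norm (\<lambda>\<xi>. fourier_ball R f \<xi> - g \<xi>)) \<longlongrightarrow> 0) at_top"
    and LB: "\<And>R. L2 (fourier_ball R f)"
    if f: "L2 f" and g: "L2 g"
  proof -
    show LB: "L2 (fourier_ball R f)" for R
      using f by (auto simp: L2_vec_iff fourier_ball_nth L2_cx intro!: fourier_integral_L2 ball_truncation_L2)
    have "((\<lambda>R. \<integral>\<^sup>+ \<xi>. ennreal ((norm (fourier_ball R f \<xi> - g \<xi>))\<^sup>2) \<partial>lborel) \<longlongrightarrow> 0) at_top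
      \<longleftrightarrow> ((\<lambda>R. ennreal ((L2_norm (\<lambda>\<xi>. fourier_ball R f \<xi> - g \<xi>))\<^sup>2)) \<longlongrightarrow> ennreal 0) at_top"
      by (simp add: nn_integral_norm_sq L2_diff LB g)
    also have "\<dots> \<longleftrightarrow> ((\<lambda>R. (L2_norm (\<lambda>\<xi>. fourier_ball R f \<xi> - g \<xi>))\<^sup>2) \<longlongrightarrow> 0) at_top"
      by (rule tendsto_ennreal_iff) auto
    also have "\<dots> \<longleftrightarrow> ((\<lambda>R. L2_norm (\<lambda>\<xi>. fourier_ball R f \<xi> - g \<xi>)) \<longlongrightarrow> 0) at_top"
    proof
      assume "((\<lambda>R. (L2_norm (\<lambda>\<xi>. fourier_ball R f \<xi> - g \<xi>))\<^sup>2) \<longlongrightarrow> 0) at_top"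
      from tendsto_real_sqrt[OF this]
      show "((\<lambda>R. L2_norm (\<lambda>\<xi>. fourier_ball R f \<xi> - g \<xi>)) \<longlongrightarrow> 0) at_top" by simp
    next
      assume "((\<lambda>R. L2_norm (\<lambda>\<xi>. fourier_ball R f \<xi> - g \<xi>)) \<longlongrightarrow> 0) at_top"
      from tendsto_power[OF this, of 2]
      show "((\<lambda>R. (L2_norm (\<lambda>\<xi>. fourier_ball R f \<xi> - g \<xi>))\<^sup>2) \<longlongrightarrow> 0) at_top" by simp
    qed
    finally show "((\<lambda>R. \<integral>\<^sup>+ \<xi>. ennreal ((norm (fourier_ball R f \<xi> - g \<xi>))\<^sup>2) \<partial>lborel) \<longlongrightarrow> 0) at_top
      \<longleftrightarrow> ((\<lambda>R. L2_norm (\<lambda>\<xi>. fourier_ball R f \<xi> - g \<xi>)) \<longlongrightarrow> 0) at_top" .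
  qed
  show ?thesis
  proof
    assume "is_fourier f g"
    then have L: "L2 f" "L2 g" and lim: "((\<lambda>R. L2_norm (\<lambda>\<xi>. fourier_ball R f \<xi> - g \<xi>)) \<longlongrightarrow> 0) at_top"
      using conv by (auto simp: is_fourier_def)
    show "\<forall>j. plancherel_pair (cx (\<lambda>x. f x $ j)) (\<lambda>\<xi>. g \<xi> $ j)"
    proof
      fix j
      have fj: "L2 (cx (\<lambda>x. f x $ j))" using L by (simp add: L2_cx L2_vec_iff)
      show "plancherel_pair (cx (\<lambda>x. f x $ j)) (\<lambda>\<xi>. g \<xi> $ j)"
      proof (rule plancherel_pairI[OF fj _ trivial_limit_at_top_linorder ball_truncation_L2(2,1)[OF fj] ball_truncation_lim[OF fj]])
        show "L2 (\<lambda>\<xi>. g \<xi> $ j)" using L by (simp add: L2_vec_iff)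
        show "((\<lambda>R. L2_norm (\<lambda>\<xi>. fourier_integral (ball_truncation R (cx (\<lambda>x. f x $ j))) \<xi> - g \<xi> $ j)) \<longlongrightarrow> 0) at_top"
        proof (rule Lim_null_comparison[OF _ lim], intro always_eventually allI)
          fix R
          show "norm (L2_norm (\<lambda>\<xi>. fourier_integral (ball_truncation R (cx (\<lambda>x. f x $ j))) \<xi> - g \<xi> $ j))
              \<le> L2_norm (\<lambda>\<xi>. fourier_ball R f \<xi> - g \<xi>)"
            using L2_norm_component_le[OF L2_diff[OF LB[OF L] L(2)], of R j] by (simp add: fourier_ball_nth)
        qed
      qed
    qed
  next
    assume p: "\<forall>j. plancherel_pair (cx (\<lambda>x. f x $ j)) (\<lambda>\<xi>. g \<xi> $ j)"
    then have fj: "L2 (cx (\<lambda>x. f x $ j))" for j by (auto dest: plancherel_pairD)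
    have L: "L2 f" "L2 g" using fj p by (auto simp: L2_vec_iff L2_cx dest: plancherel_pairD)
    have "((\<lambda>R. sqrt (\<Sum>j\<in>UNIV. (L2_norm (\<lambda>\<xi>. fourier_integral (ball_truncation R (cx (\<lambda>x. f x $ j))) \<xi> - g \<xi> $ j))\<^sup>2)) \<longlongrightarrow> sqrt (\<Sum>j\<in>(UNIV::3 set). 0\<^sup>2)) at_top"
      by (intro tendsto_intros plancherel_pair_lim[OF p[rule_format] ball_truncation_L2(2,1)[OF fj] ball_truncation_lim[OF fj]])
    moreover have "sqrt (\<Sum>j\<in>UNIV. (L2_norm (\<lambda>\<xi>. fourier_integral (ball_truncation R (cx (\<lambda>x. f x $ j))) \<xi> - g \<xi> $ j))\<^sup>2) = L2_norm (\<lambda>\<xi>. fourier_ball R f \<xi> - g \<xi>)" for R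
      using L2_norm_sq_vec[OF L2_diff[OF LB[OF L] L(2)], of R]
      by (intro real_sqrt_unique) (simp_all add: fourier_ball_nth)
    ultimately show "is_fourier f g" using L conv by (simp add: is_fourier_def)
  qed
qed

lemma is_fourier_L2: "is_fourier f g \<Longrightarrow> L2 f" "is_fourier f g \<Longrightarrow> L2 g"
  by (auto simp: is_fourier_def)

lemma fourier_is: assumes "L2 f" shows "is_fourier f (fourier f)"
proof -
  have "\<forall>j. \<exists>g. plancherel_pair (cx (\<lambda>x. f x $ j)) g"
    using assms by (metis plancherel_pair_exists L2_cx L2_vec_iff)
  then obtain g where "\<And>j. plancherel_pair (cx (\<lambda>x. f x $ j)) (g j)" by metis
  then have "is_fourier f (\<lambda>\<xi>. \<chi> j. g j \<xi>)" by (simp add: is_fourier_iff)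
  then show ?thesis unfolding fourier_def by (rule someI[of "is_fourier f"])
qed

lemma is_fourier_unique: assumes "is_fourier f g" "is_fourier f g'" shows "AE \<xi> in lborel. g \<xi> = g' \<xi>"
proof -
  have "AE \<xi> in lborel. g \<xi> $ j = g' \<xi> $ j" for j
    using assms by (intro plancherel_pair_unique[of "cx (\<lambda>x. f x $ j)"]) (auto simp: is_fourier_iff)
  then have "AE \<xi> in lborel. \<forall>j. g \<xi> $ j = g' \<xi> $ j" by (rule eventually_all_finite)
  then show ?thesis by (simp add: vec_eq_iff)
qed

lemma fourier_AE: "is_fourier f g \<Longrightarrow> AE \<xi> in lborel. fourier f \<xi> = g \<xi>"
  using is_fourier_unique fourier_is is_fourier_L2 by blast

lemma is_fourier_cong:
  assumes p: "is_fourier f g" and f': "f' \<in> borel_measurable borel" "AE x in lborel. f x = f' x"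
    and g': "g' \<in> borel_measurable borel" "AE x in lborel. g x = g' x"
  shows "is_fourier f' g'"
  unfolding is_fourier_iff
proof
  fix j
  note f'(1)[measurable] g'(1)[measurable]
  show "plancherel_pair (cx (\<lambda>x. f' x $ j)) (\<lambda>\<xi>. g' \<xi> $ j)"
  proof (rule plancherel_pair_cong)
    show "plancherel_pair (cx (\<lambda>x. f x $ j)) (\<lambda>\<xi>. g \<xi> $ j)" using p by (simp add: is_fourier_iff)
    show "AE x in lborel. complex_of_real (f x $ j) = complex_of_real (f' x $ j)" using f'(2) by eventually_elim simp
    show "AE x in lborel. g x $ j = g' x $ j" using g'(2) by eventually_elim simp
  qed measurable
qed

lemma is_fourier_add: "is_fourier f g \<Longrightarrow> is_fourier f' g' \<Longrightarrow> is_fourier (\<lambda>x. f x + f' x) (\<lambda>\<xi>. g \<xi> + g' \<xi>)"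
  using plancherel_pair_add by (fastforce simp: is_fourier_iff)

lemma is_fourier_diff: "is_fourier f g \<Longrightarrow> is_fourier f' g' \<Longrightarrow> is_fourier (\<lambda>x. f x - f' x) (\<lambda>\<xi>. g \<xi> - g' \<xi>)"
  using plancherel_pair_diff by (fastforce simp: is_fourier_iff)

lemma is_fourier_scaleR: assumes "is_fourier f g" shows "is_fourier (\<lambda>x. c *\<^sub>R f x) (\<lambda>\<xi>. c *\<^sub>R g \<xi>)"
  unfolding is_fourier_iff
proof
  fix j
  have "plancherel_pair (\<lambda>x. of_real c * cx (\<lambda>x. f x $ j) x) (\<lambda>\<xi>. of_real c * g \<xi> $ j)"
    using assms by (intro plancherel_pair_cmult) (simp add: is_fourier_iff)
  then show "plancherel_pair (cx (\<lambda>x. (c *\<^sub>R f x) $ j)) (\<lambda>\<xi>. (c *\<^sub>R g \<xi>) $ j)"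
    by (simp add: scaleR_conv_of_real[where 'a=complex])
qed

lemma plancherel_pair_Parseval: assumes "plancherel_pair f g" "plancherel_pair f' g'" shows "L2_inner g g' = (2 * pi) ^ 3 * L2_inner f f'"
proof -
  have n: "(L2_norm b)\<^sup>2 = (2 * pi) ^ 3 * (L2_norm a)\<^sup>2" if "plancherel_pair a b" for a b
    using plancherel_pair_norm[OF that] by (simp add: power_mult_distrib)
  have "2 * L2_inner g g' = (L2_norm (\<lambda>x. g x + g' x))\<^sup>2 - (L2_norm g)\<^sup>2 - (L2_norm g')\<^sup>2"
    using assms by (subst L2_norm_sq_add) (auto dest: plancherel_pairD)
  also have "\<dots> = (2 * pi) ^ 3 * ((L2_norm (\<lambda>x. f x + f' x))\<^sup>2 - (L2_norm f)\<^sup>2 - (L2_norm f')\<^sup>2)"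
    by (simp add: n[OF plancherel_pair_add[OF assms]] n[OF assms(1)] n[OF assms(2)] right_diff_distrib)
  also have "\<dots> = (2 * pi) ^ 3 * (2 * L2_inner f f')"
    using assms by (subst L2_norm_sq_add) (auto dest: plancherel_pairD)
  finally show ?thesis by simp
qed

lemma L2_inner_vec:
  fixes f g :: "real^3 \<Rightarrow> ('b::euclidean_space)^'n"
  assumes "L2 f" "L2 g"
  shows "L2_inner f g = (\<Sum>j\<in>UNIV. L2_inner (\<lambda>x. f x $ j) (\<lambda>x. g x $ j))"
  unfolding L2_inner_def inner_vec_def
  using assms by (intro Bochner_Integration.integral_sum L2_inner_integrable) (auto simp: L2_vec_iff)

lemma L2_inner_cx: "L2_inner (cx f) (cx g) = L2_inner f g"
  by (simp add: L2_inner_def inner_complex_def)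

theorem Parseval:
  assumes "is_fourier f g" "is_fourier f' g'"
  shows "L2_inner f f' = L2_inner g g' / (2 * pi) ^ 3"
proof -
  note L = is_fourier_L2[OF assms(1)] is_fourier_L2[OF assms(2)]
  have "L2_inner g g' = (\<Sum>j\<in>UNIV. (2 * pi) ^ 3 * L2_inner (cx (\<lambda>x. f x $ j)) (cx (\<lambda>x. f' x $ j)))"
    unfolding L2_inner_vec[OF L(2,4)] using assms by (intro sum.cong refl plancherel_pair_Parseval) (auto simp: is_fourier_iff)
  also have "\<dots> = (2 * pi) ^ 3 * L2_inner f f'"
    unfolding L2_inner_vec[OF L(1,3)] L2_inner_cx by (rule sum_distrib_left[symmetric])
  finally show ?thesis by simp
qed

corollary Plancherel: "is_fourier f g \<Longrightarrow> (L2_norm f)\<^sup>2 = (L2_norm g)\<^sup>2 / (2 * pi) ^ 3"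
  unfolding L2_norm_sq_inner by (rule Parseval)

corollary Plancherel_norm: assumes "is_fourier f g" shows "L2_norm f = L2_norm g / plancherel_const"
proof -
  have "L2_norm f = sqrt ((L2_norm g)\<^sup>2 / (2 * pi) ^ 3)"
    unfolding Plancherel[OF assms, symmetric] by simp
  then show ?thesis by (simp only: real_sqrt_divide real_sqrt_abs abs_of_nonneg L2_norm_nonneg)
qed

text \<open>
  A field on \<open>\<real>\<^sup>3\<close> is real exactly if its transform satisfies \<open>g (- \<xi>) = cnj_vec (g \<xi>)\<close> almost
  everywhere; the two theorems below are the two directions.
\<close>

definition cnj_vec :: "complex^3 \<Rightarrow> complex^3" where "cnj_vec v = (\<chi> j. cnj (v $ j))"

lemma is_fourier_hermitian: assumes "is_fourier f g" shows "AE \<xi> in lborel. g (- \<xi>) = cnj_vec (g \<xi>)"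
proof -
  have "AE \<xi> in lborel. g \<xi> $ j = cnj (g (- \<xi>) $ j)" for j
  proof (rule plancherel_pair_unique)
    show p: "plancherel_pair (cx (\<lambda>x. f x $ j)) (\<lambda>\<xi>. g \<xi> $ j)" using assms by (simp add: is_fourier_iff)
    show "plancherel_pair (cx (\<lambda>x. f x $ j)) (\<lambda>\<xi>. cnj (g (- \<xi>) $ j))" using plancherel_pair_cnj[OF p] by simp
  qed
  then have "AE \<xi> in lborel. \<forall>j. g \<xi> $ j = cnj (g (- \<xi>) $ j)" by (rule eventually_all_finite)
  then show ?thesis by eventually_elim (simp add: vec_eq_iff cnj_vec_def)
qed

text \<open>
  Invert each component and take real parts. By the symmetry of \<open>G\<close>, the real part still has
  transform \<open>G\<close>.
\<close>

theorem is_fourier_surj: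
  assumes G: "L2 G" and sym: "AE \<xi> in lborel. G (- \<xi>) = cnj_vec (G \<xi>)"
  obtains f where "is_fourier f G"
proof -
  have "\<forall>j. \<exists>h. plancherel_pair h (\<lambda>\<xi>. G \<xi> $ j)"
    using G by (metis plancherel_pair_surj L2_vec_iff)
  then obtain h where h: "\<And>j. plancherel_pair (h j) (\<lambda>\<xi>. G \<xi> $ j)" by metis
  have "is_fourier (\<lambda>x. \<chi> j. Re (h j x)) G"
    unfolding is_fourier_iff
  proof
    fix j
    have "plancherel_pair (\<lambda>x. (1/2) * (h j x + cnj (h j x))) (\<lambda>\<xi>. (1/2) * (G \<xi> $ j + cnj (G (- \<xi>) $ j)))"
      by (intro plancherel_pair_cmult plancherel_pair_add plancherel_pair_cnj[of "h j" "\<lambda>\<xi>. G \<xi> $ j"] h)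
    moreover have "(\<lambda>x. (1/2) * (h j x + cnj (h j x))) = cx (\<lambda>x. Re (h j x))"
      by (rule ext) (simp add: complex_eq_iff)
    ultimately have p: "plancherel_pair (cx (\<lambda>x. Re (h j x))) (\<lambda>\<xi>. (1/2) * (G \<xi> $ j + cnj (G (- \<xi>) $ j)))" by simp
    have "AE \<xi> in lborel. (1/2) * (G \<xi> $ j + cnj (G (- \<xi>) $ j)) = G \<xi> $ j"
      using sym by eventually_elim (simp add: cnj_vec_def)
    then have "plancherel_pair (cx (\<lambda>x. Re (h j x))) (\<lambda>\<xi>. G \<xi> $ j)"
      using L2_measurable[OF plancherel_pairD(1)[OF p]] L2_measurable[OF plancherel_pairD(2)[OF h[of j]]]
      by (intro plancherel_pair_cong[OF p]) auto
    then show "plancherel_pair (cx (\<lambda>x. (\<chi> j. Re (h j x)) $ j)) (\<lambda>\<xi>. G \<xi> $ j)" by simp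
  qed
  then show ?thesis by (rule that)
qed

text \<open>
  The function chosen in the definition of a multiplier exists and is unique up to null sets as
  soon as the symbol respects real fields and the product is square-integrable.
\<close>

theorem multiplier_is_fourier:
  assumes f: "is_fourier f g" and L: "L2 (\<lambda>\<xi>. m \<xi> (g \<xi>))"
    and sym: "\<And>\<xi> v. m (- \<xi>) (cnj_vec v) = cnj_vec (m \<xi> v)"
  shows "is_fourier (multiplier m f) (\<lambda>\<xi>. m \<xi> (g \<xi>))"
proof -
  have "AE \<xi> in lborel. m (- \<xi>) (g (- \<xi>)) = cnj_vec (m \<xi> (g \<xi>))"
    using is_fourier_hermitian[OF f] by eventually_elim (simp add: sym)
  then obtain h where h: "is_fourier h (\<lambda>\<xi>. m \<xi> (g \<xi>))" using is_fourier_surj[OF L] by blast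
  have gf: "AE \<xi> in lborel. fourier f \<xi> = g \<xi>" by (rule fourier_AE[OF f])
  have "AE \<xi> in lborel. fourier h \<xi> = m \<xi> (fourier f \<xi>)"
    using fourier_AE[OF h] gf by eventually_elim simp
  then have "\<exists>h. L2 h \<and> (AE \<xi> in lborel. fourier h \<xi> = m \<xi> (fourier f \<xi>))"
    using is_fourier_L2[OF h] by blast
  then have M: "L2 (multiplier m f)" "AE \<xi> in lborel. fourier (multiplier m f) \<xi> = m \<xi> (fourier f \<xi>)"
    unfolding multiplier_def
    using someI_ex[of "\<lambda>h. L2 h \<and> (AE \<xi> in lborel. fourier h \<xi> = m \<xi> (fourier f \<xi>))"] by blast+
  have "AE \<xi> in lborel. fourier (multiplier m f) \<xi> = m \<xi> (g \<xi>)"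
    using M(2) gf by eventually_elim simp
  then show ?thesis
    by (intro is_fourier_cong[OF fourier_is[OF M(1)]])
      (use L2_measurable[OF M(1)] L2_measurable[OF L] in auto)
qed


section \<open>Curl and divergence on the Fourier side\<close>

text \<open>
  The symbol of the divergence, up to the factor \<open>i\<close>. Both arguments enter linearly, with no
  complex conjugation.
\<close>

definition freq_dot :: "real^3 \<Rightarrow> complex^3 \<Rightarrow> complex" where
  "freq_dot \<xi> v = (\<Sum>j\<in>UNIV. complex_of_real (\<xi> $ j) * v $ j)"

lemma L2_component_symbol:
  assumes g: "L2 g" and L: "L2 (\<lambda>\<xi>. norm \<xi> *\<^sub>R g \<xi>)"
  shows "L2 (\<lambda>\<xi>. \<i> * of_real (\<xi> $ j) * g \<xi> $ k)"
proof (rule L2_norm_mono(1)[OF _ L])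
  show "AE \<xi> in lborel. norm (\<i> * of_real (\<xi> $ j) * g \<xi> $ k) \<le> norm (norm \<xi> *\<^sub>R g \<xi>)"
    by (intro AE_I2) (simp add: norm_mult mult_mono component_le_norm_cart Finite_Cartesian_Product.norm_nth_le)
  show "(\<lambda>\<xi>. \<i> * of_real (\<xi> $ j) * g \<xi> $ k) \<in> borel_measurable borel"
    using L2_measurable[OF g] by measurable
qed

lemma plancherel_pair_partial_component:
  assumes f: "is_fourier f g" and L: "L2 (\<lambda>\<xi>. norm \<xi> *\<^sub>R g \<xi>)"
    and d: "\<And>k x. (\<lambda>y. f y $ k) differentiable (at x)"
  shows "plancherel_pair (cx (partial j (\<lambda>y. f y $ k))) (\<lambda>\<xi>. \<i> * of_real (\<xi> $ j) * g \<xi> $ k)"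
  using f by (intro plancherel_pair_partial L2_component_symbol[OF is_fourier_L2(2)[OF f] L] d) (simp add: is_fourier_iff)

theorem is_fourier_curl:
  assumes f: "is_fourier f g" and L: "L2 (\<lambda>\<xi>. norm \<xi> *\<^sub>R g \<xi>)"
    and d: "\<And>k x. (\<lambda>y. f y $ k) differentiable (at x)"
  shows "is_fourier (curl f) (\<lambda>\<xi>. curl_symbol \<xi> (g \<xi>))"
proof -
  have c: "plancherel_pair (cx (\<lambda>x. partial a (\<lambda>y. f y $ b) x - partial b (\<lambda>y. f y $ a) x))
      (\<lambda>\<xi>. \<i> * (of_real (\<xi> $ a) * g \<xi> $ b - of_real (\<xi> $ b) * g \<xi> $ a))" for a b
    using plancherel_pair_diff[OF plancherel_pair_partial_component[OF f L d, of a b] plancherel_pair_partial_component[OF f L d, of b a]]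
    by (simp add: right_diff_distrib mult.assoc)
  show ?thesis unfolding is_fourier_iff forall_3
    using c[of 2 3] c[of 3 1] c[of 1 2] by (simp add: curl_def curl_symbol_def)
qed

lemma freq_dot_divergence_free:
  assumes f: "is_fourier f g" and L: "L2 (\<lambda>\<xi>. norm \<xi> *\<^sub>R g \<xi>)"
    and d: "\<And>k x. (\<lambda>y. f y $ k) differentiable (at x)"
    and div: "\<And>x. divergence f x = 0"
  shows "AE \<xi> in lborel. freq_dot \<xi> (g \<xi>) = 0"
proof -
  note p = plancherel_pair_partial_component[OF f L d]
  have "plancherel_pair (\<lambda>x. cx (partial 1 (\<lambda>y. f y $ 1)) x + cx (partial 2 (\<lambda>y. f y $ 2)) x + cx (partial 3 (\<lambda>y. f y $ 3)) x)
     (\<lambda>\<xi>. \<i> * of_real (\<xi> $ 1) * g \<xi> $ 1 + \<i> * of_real (\<xi> $ 2) * g \<xi> $ 2 + \<i> * of_real (\<xi> $ 3) * g \<xi> $ 3)"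
    by (intro plancherel_pair_add p)
  moreover have "cx (partial 1 (\<lambda>y. f y $ 1)) x + cx (partial 2 (\<lambda>y. f y $ 2)) x + cx (partial 3 (\<lambda>y. f y $ 3)) x = 0" for x
    unfolding of_real_add[symmetric] using div[of x] by (simp add: divergence_def sum_3)
  ultimately have "plancherel_pair (\<lambda>x. 0) (\<lambda>\<xi>. \<i> * freq_dot \<xi> (g \<xi>))"
    by (simp add: freq_dot_def sum_3 distrib_left mult.assoc)
  from L2_norm_eq_0[OF plancherel_pairD(2)[OF this]] plancherel_pair_norm[OF this]
  show ?thesis by (simp add: L2_norm_def)
qed


section \<open>Test functions and weakly divergence-free fields\<close>

lemma test_function_props:
  assumes "test_function \<phi>"
  shows test_function_differentiable: "\<phi> differentiable (at x)"
    and test_function_partial_continuous: "continuous_on UNIV (partial j \<phi>)"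
    and test_function_continuous: "continuous_on UNIV \<phi>"
proof -
  have "Ck_on UNIV (Suc 0) \<phi>" "Ck_on UNIV 0 \<phi>" using assms unfolding test_function_def smooth_on_def by blast+
  then obtain f' where f': "\<And>x. (\<phi> has_derivative f' x) (at x)" and c: "\<And>v. continuous_on UNIV (\<lambda>x. f' x v)"
    by auto
  show "\<phi> differentiable (at x)" using f' by (auto simp: differentiable_def)
  have "partial j \<phi> = (\<lambda>x. f' x (axis j 1))"
    using frechet_derivative_at[OF f'] by (auto simp: partial_def)
  then show "continuous_on UNIV (partial j \<phi>)" using c by simp
  show "continuous_on UNIV \<phi>" using \<open>Ck_on UNIV 0 \<phi>\<close> by simp
qed

text \<open>
  Outside the ball the difference quotients vanish eventually, and so does the derivative.
\<close>

lemma test_function_support: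
  assumes "test_function \<phi>"
  shows "\<exists>R\<ge>0. \<forall>x. R < norm x \<longrightarrow> \<phi> x = 0 \<and> (\<forall>j. partial j \<phi> x = 0)"
proof -
  have "bounded (closure {x. \<phi> x \<noteq> 0})" using assms by (auto simp: test_function_def compact_imp_bounded)
  then have "bounded {x. \<phi> x \<noteq> 0}" using bounded_subset closure_subset by blast
  then obtain R where R: "0 < R" "\<And>x. \<phi> x \<noteq> 0 \<Longrightarrow> norm x \<le> R" unfolding bounded_pos by auto
  have z: "\<phi> x = 0" if "R < norm x" for x using R(2)[of x] that by force
  have "partial j \<phi> x = 0" if "R < norm x" for j x
  proof (rule LIMSEQ_unique[OF difference_quotient_tendsto_partial[OF test_function_differentiable[OF assms]]])
    have "(\<lambda>n. x + (1 / real (Suc n)) *\<^sub>R axis j 1) \<longlonglongrightarrow> x + 0 *\<^sub>R axis j 1"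
      by (intro tendsto_intros LIMSEQ_Suc[OF lim_1_over_n])
    then have "(\<lambda>n. norm (x + (1 / real (Suc n)) *\<^sub>R axis j 1)) \<longlonglongrightarrow> norm x"
      using tendsto_norm by fastforce
    from order_tendstoD(1)[OF this that]
    have "\<forall>\<^sub>F n in sequentially. difference_quotient n j \<phi> x = 0"
    proof eventually_elim
      case (elim n)
      show ?case using elim z that by (simp add: difference_quotient_def axis_eq_scaleR[of j "1 / real (Suc n)"] del: of_nat_Suc)
    qed
    then show "(\<lambda>n. difference_quotient n j \<phi> x) \<longlonglongrightarrow> 0" by (rule tendsto_eventually)
  qed
  with z R(1) show ?thesis by (intro exI[of _ R]) auto
qed

lemma continuous_bounded_support_bound:
  fixes g :: "real^3 \<Rightarrow> real"
  assumes c: "continuous_on UNIV g" and R: "\<And>x. R < norm x \<Longrightarrow> g x = 0"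
  shows "\<exists>M\<ge>0. \<forall>x. \<bar>g x\<bar> \<le> M"
proof -
  have "compact (g ` cball 0 R)" by (intro compact_continuous_image continuous_on_subset[OF c]) auto
  then have "bounded (g ` cball 0 R)" by (rule compact_imp_bounded)
  then obtain M where M: "0 < M" "\<And>x. norm x \<le> R \<Longrightarrow> \<bar>g x\<bar> \<le> M" unfolding bounded_pos by auto
  have "\<bar>g x\<bar> \<le> M" for x using M R[of x] by (cases "norm x \<le> R") auto
  with M(1) show ?thesis by (intro exI[of _ M]) auto
qed

lemma test_function_L2:
  assumes "test_function \<phi>" shows "L2 (cx \<phi>)" "L2 (cx (partial j \<phi>))"
proof -
  obtain R where R: "\<And>x. R < norm x \<Longrightarrow> \<phi> x = 0" "\<And>j x. R < norm x \<Longrightarrow> partial j \<phi> x = 0"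
    using test_function_support[OF assms] by auto
  note c = test_function_continuous[OF assms] test_function_partial_continuous[OF assms, of j]
  note m = borel_measurable_continuous_onI[OF c(1)] borel_measurable_continuous_onI[OF c(2)]
  obtain M where M: "\<And>x. \<bar>\<phi> x\<bar> \<le> M" using continuous_bounded_support_bound[OF c(1) R(1)] by auto
  obtain M' where M': "\<And>x. \<bar>partial j \<phi> x\<bar> \<le> M'" using continuous_bounded_support_bound[OF c(2) R(2)] by auto
  note m[measurable]
  show "L2 (cx \<phi>)"
  proof (rule bounded_support_integrable(2))
    show "norm (cx \<phi> x) \<le> M" for x using M[of x] by simp
    show "cx \<phi> x = 0" if "R < norm x" for x using R(1)[OF that] by simp
  qed measurable
  show "L2 (cx (partial j \<phi>))"
  proof (rule bounded_support_integrable(2))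
    show "norm (cx (partial j \<phi>) x) \<le> M'" for x using M'[of x] by simp
    show "cx (partial j \<phi>) x = 0" if "R < norm x" for x using R(2)[OF that] by simp
  qed measurable
qed

text \<open>
  By the mean value theorem the difference quotients are bounded by the supremum of the
  derivative; they live in a slightly larger ball, so they converge to it in \<open>L\<^sup>2\<close>.
\<close>

lemma plancherel_pair_partial_test_function:
  assumes t: "test_function \<phi>" and p: "plancherel_pair (cx \<phi>) g"
  shows "plancherel_pair (cx (partial j \<phi>)) (\<lambda>\<xi>. \<i> * of_real (\<xi> $ j) * g \<xi>)"
proof (rule plancherel_pair_L2_derivative[OF p test_function_L2(2)[OF t]])
  obtain R where R: "0 \<le> R" "\<And>x. R < norm x \<Longrightarrow> \<phi> x = 0" "\<And>j x. R < norm x \<Longrightarrow> partial j \<phi> x = 0"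
    using test_function_support[OF t] by auto
  note c = test_function_continuous[OF t] test_function_partial_continuous[OF t, of j]
  obtain M where M: "0 \<le> M" "\<And>x. \<bar>partial j \<phi> x\<bar> \<le> M" using continuous_bounded_support_bound[OF c(2) R(3)] by auto
  have [measurable]: "\<phi> \<in> borel_measurable borel" "partial j \<phi> \<in> borel_measurable borel"
    using borel_measurable_continuous_onI[OF c(1)] borel_measurable_continuous_onI[OF c(2)] .
  define I where "I x = (indicator (cball 0 (R+1)) x :: real)" for x :: "real^3"
  have cb: "integrable lborel I"
    unfolding I_def by (rule integrable_indicator_cball)
  have bd: "\<bar>difference_quotient n j \<phi> x\<bar> \<le> M" for n x
  proof -
    let ?h = "1 / real (Suc n)"
    obtain z where "\<phi> (x + ?h *\<^sub>R axis j 1) - \<phi> (x + 0 *\<^sub>R axis j 1) = (?h - 0) * partial j \<phi> (x + z *\<^sub>R axis j 1)"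
      using MVT2[of 0 ?h "\<lambda>h. \<phi> (x + h *\<^sub>R axis j 1)" "\<lambda>h. partial j \<phi> (x + h *\<^sub>R axis j 1)"]
        DERIV_along_axis[OF test_function_differentiable[OF t]] by auto
    then have "difference_quotient n j \<phi> x = partial j \<phi> (x + z *\<^sub>R axis j 1)"
      by (simp add: difference_quotient_def axis_eq_scaleR[of j "1 / real (Suc n)"] del: of_nat_Suc)
    then show ?thesis using M(2) by simp
  qed
  have z: "difference_quotient n j \<phi> x = 0" if "R + 1 < norm x" for n x
  proof -
    have "norm (axis j (1 / real (Suc n)) :: real^3) \<le> 1"
      by (simp add: axis_eq_scaleR[of j "1 / real (Suc n)"] del: of_nat_Suc)
    then have "R < norm (x + axis j (1 / real (Suc n)))"
      using that norm_diff_ineq[of x "axis j (1 / real (Suc n))"] by linarith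
    then show ?thesis using R that by (simp add: difference_quotient_def)
  qed
  show "(\<lambda>n. L2_norm (\<lambda>x. difference_quotient n j (cx \<phi>) x - cx (partial j \<phi>) x)) \<longlonglongrightarrow> 0"
    unfolding difference_quotient_cx
  proof (rule L2_dominated(2)[where w="\<lambda>x. M\<^sup>2 * I x"])
    show "(\<lambda>x. complex_of_real (difference_quotient n j \<phi> x)) \<in> borel_measurable borel" for n unfolding difference_quotient_def by measurable
    show "AE x in lborel. (\<lambda>n. complex_of_real (difference_quotient n j \<phi> x)) \<longlonglongrightarrow> complex_of_real (partial j \<phi> x)"
      by (intro AE_I2 tendsto_of_real difference_quotient_tendsto_partial test_function_differentiable[OF t])
    show "AE x in lborel. (norm (complex_of_real (difference_quotient n j \<phi> x)))\<^sup>2 \<le> M\<^sup>2 * I x" for n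
    proof (rule AE_I2)
      fix x
      show "(norm (complex_of_real (difference_quotient n j \<phi> x)))\<^sup>2 \<le> M\<^sup>2 * I x"
        using power_mono[OF bd[of n x] abs_ge_zero, of 2] z[of x n]
        by (cases "norm x \<le> R + 1") (auto simp: I_def)
    qed
  qed (use cb in auto)
qed

text \<open>
  By Parseval the pairing with a gradient is the integral of \<open>\<xi> \<cdot> g\<close> against a multiple of the
  transform of the potential.
\<close>

theorem L2_div_freeI:
  assumes f: "is_fourier f g" and div: "AE \<xi> in lborel. freq_dot \<xi> (g \<xi>) = 0"
  shows "L2_div_free f"
  unfolding L2_div_free_def
proof (intro conjI allI impI)
  show fL: "L2 f" using f by (rule is_fourier_L2)
  fix \<phi> assume t: "test_function \<phi>"
  obtain p where p: "plancherel_pair (cx \<phi>) p" using plancherel_pair_exists[OF test_function_L2(1)[OF t]] .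
  have gL: "L2 (gradient \<phi>)" using test_function_L2(2)[OF t] by (simp add: L2_vec_iff gradient_def L2_cx)
  note pp = plancherel_pair_partial_test_function[OF t p]
  have gj: "L2 (\<lambda>\<xi>. g \<xi> $ j)" for j using is_fourier_L2[OF f] by (simp add: L2_vec_iff)
  have "(2 * pi) ^ 3 * L2_inner f (gradient \<phi>)
      = (\<Sum>j\<in>UNIV. (2 * pi) ^ 3 * L2_inner (cx (\<lambda>x. f x $ j)) (cx (partial j \<phi>)))"
    unfolding L2_inner_vec[OF fL gL] L2_inner_cx by (simp add: gradient_def sum_distrib_left)
  also have "\<dots> = (\<Sum>j\<in>UNIV. L2_inner (\<lambda>\<xi>. g \<xi> $ j) (\<lambda>\<xi>. \<i> * of_real (\<xi> $ j) * p \<xi>))"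
    using f by (intro sum.cong refl plancherel_pair_Parseval[symmetric] pp) (auto simp: is_fourier_iff)
  also have "\<dots> = (LINT \<xi>|lborel. (\<Sum>j\<in>UNIV. g \<xi> $ j \<bullet> (\<i> * of_real (\<xi> $ j) * p \<xi>)))"
    unfolding L2_inner_def by (intro Bochner_Integration.integral_sum[symmetric] L2_inner_integrable gj plancherel_pairD(2)[OF pp])
  also have "\<dots> = (LINT (\<xi>::real^3)|lborel. (0::real))"
  proof (rule integral_cong_AE)
    have "(\<Sum>j\<in>UNIV. g \<xi> $ j \<bullet> (\<i> * of_real (\<xi> $ j) * p \<xi>)) = freq_dot \<xi> (g \<xi>) \<bullet> (\<i> * p \<xi>)" for \<xi>
      by (simp add: freq_dot_def sum_3 inner_complex_def algebra_simps)
    then show "AE \<xi> in lborel. (\<Sum>j\<in>UNIV. g \<xi> $ j \<bullet> (\<i> * of_real (\<xi> $ j) * p \<xi>)) = 0"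
      using div by auto
    show "(\<lambda>\<xi>. \<Sum>j\<in>UNIV. g \<xi> $ j \<bullet> (\<i> * of_real (\<xi> $ j) * p \<xi>)) \<in> borel_measurable lborel"
      using L2_measurable[OF gj] L2_measurable[OF plancherel_pairD(2)[OF p]] by measurable
  qed simp
  finally show "(LINT x|lborel. f x \<bullet> gradient \<phi> x) = 0" by (simp add: L2_inner_def)
qed

section \<open>The Leray projection\<close>

lemma test_gradient_L2: assumes "test_function \<phi>" shows "L2 (gradient \<phi>)"
  using test_function_L2(2)[OF assms] by (simp add: L2_vec_iff gradient_def L2_cx)

lemma L2_div_free_iff:
  "L2_div_free g \<longleftrightarrow> L2 g \<and> (\<forall>\<phi>. test_function \<phi> \<longrightarrow> L2_inner g (gradient \<phi>) = 0)"
  by (simp add: L2_div_free_def L2_inner_def)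

lemma L2_div_free_zero: "L2_div_free (\<lambda>x. 0)"
  by (simp add: L2_div_free_iff L2_inner_def)

lemma L2_div_free_add: "L2_div_free f \<Longrightarrow> L2_div_free g \<Longrightarrow> L2_div_free (\<lambda>x. f x + g x)"
  by (auto simp: L2_div_free_iff L2_inner_add_left L2_add test_gradient_L2)

lemma L2_div_free_scaleR: "L2_div_free f \<Longrightarrow> L2_div_free (\<lambda>x. c *\<^sub>R f x)"
  by (auto simp: L2_div_free_iff L2_inner_scaleR_left L2_scaleR)

lemma L2_div_free_diff: "L2_div_free f \<Longrightarrow> L2_div_free g \<Longrightarrow> L2_div_free (\<lambda>x. f x - g x)"
  by (auto simp: L2_div_free_iff L2_inner_diff_left L2_diff test_gradient_L2)

lemma L2_div_free_limit:
  assumes F: "\<And>n::nat. L2_div_free (F n)" and f: "L2 f"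
    and lim: "(\<lambda>n. L2_norm (\<lambda>x. F n x - f x)) \<longlonglongrightarrow> 0"
  shows "L2_div_free f"
  unfolding L2_div_free_iff
proof (intro conjI f allI impI)
  fix \<phi> assume t: "test_function \<phi>"
  have FL: "L2 (F n)" for n using F by (simp add: L2_div_free_iff)
  have z: "(\<lambda>n. L2_norm (\<lambda>x. gradient \<phi> x - gradient \<phi> x)) \<longlonglongrightarrow> 0" by (simp add: L2_norm_def)
  have "(\<lambda>n. L2_inner (F n) (gradient \<phi>)) \<longlonglongrightarrow> L2_inner f (gradient \<phi>)"
    by (intro L2_inner_tendsto FL f lim z test_gradient_L2[OF t])
  moreover have "L2_inner (F n) (gradient \<phi>) = 0" for n using F t by (simp add: L2_div_free_iff)
  ultimately show "L2_inner f (gradient \<phi>) = 0" by (simp add: LIMSEQ_const_iff)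
qed

text \<open>
  Orthogonal projection onto a closed subspace: a minimizing sequence is Cauchy by the
  parallelogram law, and its limit \<open>g\<close> is a closest point, so that \<open>f - g\<close> is orthogonal to the
  subspace.
\<close>

theorem L2_div_free_projection:
  assumes f: "L2 f"
  shows "\<exists>g. L2_div_free g \<and> (\<forall>h. L2_div_free h \<longrightarrow> L2_inner (\<lambda>x. f x - g x) h = 0)"
proof -
  define S where "S = {(L2_norm (\<lambda>x. f x - h x))\<^sup>2 | h. L2_div_free h}"
  define d where "d = Inf S"
  have bdd: "bdd_below S" by (rule bdd_belowI[of _ 0]) (auto simp: S_def)
  have S: "S \<noteq> {}" using L2_div_free_zero by (auto simp: S_def)
  have d_le: "d \<le> (L2_norm (\<lambda>x. f x - h x))\<^sup>2" if "L2_div_free h" for h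
    unfolding d_def using that by (intro cInf_lower bdd) (auto simp: S_def)
  have "\<exists>h. L2_div_free h \<and> (L2_norm (\<lambda>x. f x - h x))\<^sup>2 < d + 1 / real (Suc n)" for n
    using cInf_lessD[OF S, of "d + 1 / real (Suc n)"] unfolding d_def[symmetric] by (force simp: S_def)
  then obtain h where hV: "\<And>n. L2_div_free (h n)"
    and hd: "\<And>n. (L2_norm (\<lambda>x. f x - h n x))\<^sup>2 < d + 1 / real (Suc n)" by metis
  have hL: "L2 (h n)" for n using hV by (simp add: L2_div_free_iff)
  have par: "(L2_norm (\<lambda>x. h m x - h n x))\<^sup>2 \<le> 2 / real (Suc m) + 2 / real (Suc n)" for m n
  proof -
    let ?a = "\<lambda>x. f x - h m x" and ?b = "\<lambda>x. f x - h n x"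
    have L: "L2 ?a" "L2 ?b" by (intro L2_diff f hL)+
    have "d \<le> (L2_norm (\<lambda>x. f x - (1/2) *\<^sub>R (h m x + h n x)))\<^sup>2"
      by (intro d_le L2_div_free_scaleR L2_div_free_add hV)
    also have "(\<lambda>x. f x - (1/2) *\<^sub>R (h m x + h n x)) = (\<lambda>x. (1/2) *\<^sub>R (?a x + ?b x))"
      by (rule ext) (simp add: vec_eq_iff field_simps)
    also have "(L2_norm (\<lambda>x. (1/2) *\<^sub>R (?a x + ?b x)))\<^sup>2 = (1/4) * (L2_norm (\<lambda>x. ?a x + ?b x))\<^sup>2"
      unfolding L2_norm_scaleR by (simp add: power_mult_distrib power2_eq_square)
    finally have "4 * d \<le> (L2_norm ?a)\<^sup>2 + 2 * L2_inner ?a ?b + (L2_norm ?b)\<^sup>2"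
      unfolding L2_norm_sq_add[OF L] by simp
    moreover have "(L2_norm (\<lambda>x. ?b x - ?a x))\<^sup>2 = (L2_norm ?b)\<^sup>2 - 2 * L2_inner ?a ?b + (L2_norm ?a)\<^sup>2"
      unfolding L2_norm_sq_diff[OF L(2,1)] by (simp add: L2_inner_commute[of ?b ?a])
    moreover have "(\<lambda>x. ?b x - ?a x) = (\<lambda>x. h m x - h n x)" by auto
    ultimately show ?thesis using hd[of m] hd[of n] by simp
  qed
  obtain g where g: "L2 g" and hg: "(\<lambda>n. L2_norm (\<lambda>x. h n x - g x)) \<longlonglongrightarrow> 0"
  proof (rule L2_complete[of h, OF hL])
    fix e :: real assume e: "0 < e"
    then obtain N where N: "4 / e\<^sup>2 < real N" using reals_Archimedean2 by blast
    have "L2_norm (\<lambda>x. h m x - h n x) < e" if "m \<ge> N" "n \<ge> N" for m n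
    proof -
      have "4 / e\<^sup>2 < real (Suc N)" using N by simp
      then have "4 < e\<^sup>2 * real (Suc N)" using e by (simp add: pos_divide_less_eq mult.commute del: of_nat_Suc)
      then have q: "2 / real (Suc N) < e\<^sup>2 / 2" by (simp add: pos_divide_less_eq field_simps del: of_nat_Suc)
      have "2 / real (Suc m) \<le> 2 / real (Suc N)" "2 / real (Suc n) \<le> 2 / real (Suc N)"
        using that by (intro divide_left_mono; simp)+
      then have "(L2_norm (\<lambda>x. h m x - h n x))\<^sup>2 < e\<^sup>2" using par[of m n] q by linarith
      then show ?thesis by (rule power2_less_imp_less) (use e in simp)
    qed
    then show "\<exists>N. \<forall>m\<ge>N. \<forall>n\<ge>N. L2_norm (\<lambda>x. h m x - h n x) < e" by blast
  qed blast
  have gV: "L2_div_free g" by (rule L2_div_free_limit[OF hV g hg])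
  have gd: "(L2_norm (\<lambda>x. f x - g x))\<^sup>2 \<le> d"
  proof (rule LIMSEQ_le)
    show "(\<lambda>n. (L2_norm (\<lambda>x. f x - h n x))\<^sup>2) \<longlonglongrightarrow> (L2_norm (\<lambda>x. f x - g x))\<^sup>2"
    proof (intro tendsto_power L2_norm_tendsto L2_diff f g hL)
      have "(\<lambda>x. f x - h n x - (f x - g x)) = (\<lambda>x. g x - h n x)" for n by auto
      then show "(\<lambda>n. L2_norm (\<lambda>x. f x - h n x - (f x - g x))) \<longlonglongrightarrow> 0"
        using hg by (simp add: L2_norm_minus_commute[of g])
    qed
    have "(\<lambda>n. d + 1 / real (Suc n)) \<longlonglongrightarrow> d + 0"
      by (intro tendsto_intros LIMSEQ_Suc[OF lim_1_over_n])
    then show "(\<lambda>n. d + 1 / real (Suc n)) \<longlonglongrightarrow> d" by simp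
    show "\<exists>N. \<forall>n\<ge>N. (L2_norm (\<lambda>x. f x - h n x))\<^sup>2 \<le> d + 1 / real (Suc n)"
      using hd by (intro exI[of _ 0]) (auto intro: less_imp_le)
  qed
  have "L2_inner (\<lambda>x. f x - g x) k = 0" if k: "L2_div_free k" for k
  proof (rule ccontr)
    let ?r = "\<lambda>x. f x - g x" and ?p = "L2_inner (\<lambda>x. f x - g x) k"
    assume p: "?p \<noteq> 0"
    have kL: "L2 k" using k by (simp add: L2_div_free_iff)
    have q: "2 * t * ?p \<le> t\<^sup>2 * (L2_norm k)\<^sup>2" for t
    proof -
      have "d \<le> (L2_norm (\<lambda>x. f x - (g x + t *\<^sub>R k x)))\<^sup>2"
        by (intro d_le L2_div_free_add gV L2_div_free_scaleR k)
      also have "(\<lambda>x. f x - (g x + t *\<^sub>R k x)) = (\<lambda>x. ?r x - t *\<^sub>R k x)" by auto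
      also have "(L2_norm (\<lambda>x. ?r x - t *\<^sub>R k x))\<^sup>2 = (L2_norm ?r)\<^sup>2 - 2 * t * ?p + t\<^sup>2 * (L2_norm k)\<^sup>2"
        by (subst L2_norm_sq_diff)
          (simp_all add: L2_diff f g L2_scaleR kL L2_inner_scaleR_right L2_norm_scaleR power_mult_distrib)
      finally show ?thesis using gd by linarith
    qed
    \<comment> \<open>Near \<open>t = p / \<parallel>k\<parallel>\<^sup>2\<close> the quadratic term is too small; the summand 1 covers the case that \<open>k\<close> is null.\<close>
    define K where "K = (L2_norm k)\<^sup>2 + 1"
    have K: "0 < K" "(L2_norm k)\<^sup>2 \<le> K" by (auto simp: K_def intro: add_nonneg_pos)
    have "2 * (?p / K) * ?p \<le> (?p / K)\<^sup>2 * (L2_norm k)\<^sup>2" by (rule q)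
    also have "\<dots> \<le> (?p / K)\<^sup>2 * K" by (intro mult_left_mono K) simp
    finally have "2 * ?p\<^sup>2 \<le> ?p\<^sup>2" using K(1) by (simp add: power2_eq_square field_simps)
    then show False using p by simp
  qed
  with gV show ?thesis by blast
qed

lemma leray_props:
  assumes "L2 f"
  shows leray_div_free: "L2_div_free (leray f)"
    and leray_orthogonal: "L2_div_free h \<Longrightarrow> L2_inner (\<lambda>x. f x - leray f x) h = 0"
proof -
  have "L2_div_free (leray f) \<and> (\<forall>h. L2_div_free h \<longrightarrow> L2_inner (\<lambda>x. f x - leray f x) h = 0)"
    unfolding leray_def L2_inner_def
    by (rule someI_ex[OF L2_div_free_projection[OF assms, unfolded L2_inner_def]])
  then show "L2_div_free (leray f)" "L2_div_free h \<Longrightarrow> L2_inner (\<lambda>x. f x - leray f x) h = 0" by auto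
qed

lemma leray_L2: "L2 f \<Longrightarrow> L2 (leray f)"
  using leray_div_free by (auto simp: L2_div_free_iff)

lemma leray_inner: assumes "L2 f" "L2_div_free h" shows "L2_inner (leray f) h = L2_inner f h"
  using leray_orthogonal[OF assms] assms by (simp add: L2_inner_diff_left leray_L2 L2_div_free_iff)

lemma leray_contraction:
  assumes "L2 f" "L2 g"
  shows "L2_norm (\<lambda>x. leray f x - leray g x) \<le> L2_norm (\<lambda>x. f x - g x)"
proof -
  let ?p = "\<lambda>x. leray f x - leray g x"
  have V: "L2_div_free ?p" by (intro L2_div_free_diff leray_div_free assms)
  then have L: "L2 ?p" by (simp add: L2_div_free_iff)
  have "(L2_norm ?p)\<^sup>2 = L2_inner ?p ?p" by (rule L2_norm_sq_inner)
  also have "\<dots> = L2_inner (\<lambda>x. f x - g x) ?p"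
    using assms L by (simp add: L2_inner_diff_left leray_L2 leray_inner V)
  also have "\<dots> \<le> L2_norm (\<lambda>x. f x - g x) * L2_norm ?p"
    using L2_Cauchy_Schwarz[OF L2_diff[OF assms] L] by linarith
  finally have "L2_norm ?p * L2_norm ?p \<le> L2_norm (\<lambda>x. f x - g x) * L2_norm ?p" by (simp add: power2_eq_square)
  then show ?thesis
    by (cases "L2_norm ?p = 0") (auto simp: mult_le_cancel_right order_less_le)
qed

lemma leray_id: assumes "L2_div_free f" shows "AE x in lborel. leray f x = f x"
proof -
  have fL: "L2 f" using assms by (simp add: L2_div_free_iff)
  have "L2_inner (\<lambda>x. f x - leray f x) (\<lambda>x. f x - leray f x) = 0"
    by (intro leray_orthogonal fL L2_div_free_diff assms leray_div_free)
  then have "L2_norm (\<lambda>x. f x - leray f x) = 0" by (simp flip: L2_norm_sq_inner)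
  then have "AE x in lborel. f x - leray f x = 0" using L2_norm_eq_0[OF L2_diff[OF fL leray_L2[OF fL]]] by simp
  then show ?thesis by eventually_elim simp
qed


section \<open>Algebra of the symbols\<close>

lemma curl_symbol_nth:
  "curl_symbol \<xi> v $ 1 = \<i> * (of_real (\<xi> $ 2) * v $ 3 - of_real (\<xi> $ 3) * v $ 2)"
  "curl_symbol \<xi> v $ 2 = \<i> * (of_real (\<xi> $ 3) * v $ 1 - of_real (\<xi> $ 1) * v $ 3)"
  "curl_symbol \<xi> v $ 3 = \<i> * (of_real (\<xi> $ 1) * v $ 2 - of_real (\<xi> $ 2) * v $ 1)"
  by (simp_all add: curl_symbol_def)

lemma curl_symbol_diff: "curl_symbol \<xi> (v - w) = curl_symbol \<xi> v - curl_symbol \<xi> w"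
  unfolding vec_eq_iff forall_3 by (simp add: curl_symbol_nth algebra_simps)

lemma curl_symbol_cnj_vec: "curl_symbol (- \<xi>) (cnj_vec v) = cnj_vec (curl_symbol \<xi> v)"
  unfolding vec_eq_iff forall_3 by (simp add: curl_symbol_nth cnj_vec_def algebra_simps)

lemma cnj_vec_scaleR: "cnj_vec (c *\<^sub>R v) = c *\<^sub>R cnj_vec v"
  by (simp add: cnj_vec_def vec_eq_iff)

lemma inner_curl_symbol: "curl_symbol \<xi> v \<bullet> w = v \<bullet> curl_symbol \<xi> w"
  by (simp add: inner_vec_def sum_3 curl_symbol_nth inner_complex_def algebra_simps)

lemma freq_dot_curl_symbol: "freq_dot \<xi> (curl_symbol \<xi> v) = 0"
  by (simp add: freq_dot_def sum_3 curl_symbol_nth algebra_simps)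

lemma freq_dot_add: "freq_dot \<xi> (v + w) = freq_dot \<xi> v + freq_dot \<xi> w"
  by (simp add: freq_dot_def sum_3 algebra_simps)

lemma freq_dot_scaleR: "freq_dot \<xi> (c *\<^sub>R v) = c *\<^sub>R freq_dot \<xi> v"
  by (simp add: freq_dot_def sum_3 algebra_simps)

text \<open>
  The Fourier form of \<open>curl curl = - \<Delta> + grad div\<close>.
\<close>

lemma curl_symbol_twice:
  "curl_symbol \<xi> (curl_symbol \<xi> v) = (norm \<xi>)\<^sup>2 *\<^sub>R v - (\<chi> j. of_real (\<xi> $ j) * freq_dot \<xi> v)"
proof -
  have n: "(norm \<xi>)\<^sup>2 = (\<xi> $ 1)\<^sup>2 + (\<xi> $ 2)\<^sup>2 + (\<xi> $ 3)\<^sup>2" by (simp add: norm_sq_vec sum_3)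
  show ?thesis unfolding vec_eq_iff forall_3 n
    by (auto simp: curl_symbol_nth freq_dot_def sum_3 complex_eq_iff power2_eq_square algebra_simps)
qed

lemma norm_curl_symbol: assumes "freq_dot \<xi> v = 0" shows "norm (curl_symbol \<xi> v) = norm \<xi> * norm v"
proof -
  have "(norm (curl_symbol \<xi> v))\<^sup>2 = v \<bullet> curl_symbol \<xi> (curl_symbol \<xi> v)"
    by (simp only: power2_norm_eq_inner inner_curl_symbol)
  also have "\<dots> = (norm \<xi> * norm v)\<^sup>2"
    unfolding curl_symbol_twice assms by (simp add: power_mult_distrib power2_norm_eq_inner zero_vec_def[symmetric])
  finally show ?thesis by (rule power2_eq_imp_eq) auto
qed

lemma norm_curl_symbol_le: "norm (curl_symbol \<xi> v) \<le> norm \<xi> * norm v"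
proof -
  have "(norm (curl_symbol \<xi> v))\<^sup>2 = v \<bullet> curl_symbol \<xi> (curl_symbol \<xi> v)"
    by (simp only: power2_norm_eq_inner inner_curl_symbol)
  also have "\<dots> = (norm \<xi> * norm v)\<^sup>2 - v \<bullet> (\<chi> j. of_real (\<xi> $ j) * freq_dot \<xi> v)"
    unfolding curl_symbol_twice inner_diff_right by (simp add: power_mult_distrib power2_norm_eq_inner)
  also have "v \<bullet> (\<chi> j. of_real (\<xi> $ j) * freq_dot \<xi> v) = freq_dot \<xi> v \<bullet> freq_dot \<xi> v"
    by (simp add: inner_vec_def sum_3 freq_dot_def inner_complex_def algebra_simps)
  also have "(norm \<xi> * norm v)\<^sup>2 - freq_dot \<xi> v \<bullet> freq_dot \<xi> v \<le> (norm \<xi> * norm v)\<^sup>2" by simp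
  finally show ?thesis by (rule power2_le_imp_le) simp
qed

lemma curl_symbol_measurable[measurable (raw)]:
  assumes [measurable]: "h \<in> borel_measurable M" "g \<in> borel_measurable M"
  shows "(\<lambda>x. curl_symbol (h x) (g x)) \<in> borel_measurable M"
proof (rule borel_vecI)
  have "\<forall>i. (\<lambda>x. curl_symbol (h x) (g x) $ i) \<in> borel_measurable M"
    unfolding forall_3 curl_symbol_nth by (intro conjI) measurable
  then show "(\<lambda>x. curl_symbol (h x) (g x) $ i) \<in> borel_measurable M" for i by blast
qed

text \<open>
  For \<open>\<sigma> = \<plusminus>1\<close> and \<open>\<xi> \<noteq> 0\<close>, on vectors orthogonal to \<open>\<xi>\<close>, this is the spectral projection of the
  Hermitian matrix \<open>curl_symbol \<xi>\<close> onto its eigenvalue \<open>\<sigma> |\<xi>|\<close>.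
\<close>

definition Q_symbol :: "real \<Rightarrow> real^3 \<Rightarrow> complex^3 \<Rightarrow> complex^3" where
  "Q_symbol \<sigma> \<xi> v = (1/2) *\<^sub>R (v + \<sigma> *\<^sub>R (norm \<xi> powr (-1)) *\<^sub>R curl_symbol \<xi> v)"

text \<open>
  \<open>Q_symbol\<close> is an orthogonal projection on the vectors orthogonal to \<open>\<xi>\<close>: there
  \<open>\<sigma> |\<xi>|\<^sup>-\<^sup>1 curl_symbol \<xi>\<close> is a symmetric isometry.
\<close>

lemma norm_Q_symbol_sq:
  assumes "freq_dot \<xi> v = 0" "\<sigma>\<^sup>2 = 1" "\<xi> \<noteq> 0"
  shows "(norm (Q_symbol \<sigma> \<xi> v))\<^sup>2 = v \<bullet> Q_symbol \<sigma> \<xi> v"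
proof -
  define w where "w = \<sigma> *\<^sub>R (norm \<xi> powr (-1)) *\<^sub>R curl_symbol \<xi> v"
  have s: "\<bar>\<sigma>\<bar> = 1" using assms(2) by (simp add: power2_eq_1_iff abs_if) auto
  have "norm w = norm v"
    unfolding w_def norm_scaleR norm_curl_symbol[OF assms(1)] using assms(3) s
    by (simp add: powr_minus_divide)
  then have "v \<bullet> v = w \<bullet> w" by (metis power2_norm_eq_inner)
  then show ?thesis
    unfolding Q_symbol_def w_def[symmetric] power2_norm_eq_inner inner_scaleR_left inner_scaleR_right
      inner_add_left inner_add_right by (simp add: inner_commute[of w v] add_divide_distrib)
qed


section \<open>Sobolev weights and the supremum bound\<close>

text \<open>
  The weight of \<open>H\<^sup>3\<close>. A single order of regularity serves throughout: it exceeds \<open>3/2\<close>, as the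
  bound on the supremum requires, and it dominates every multiplier of order at most 3.
\<close>

definition sobolev_weight :: "real^3 \<Rightarrow> real" where "sobolev_weight \<xi> = (1 + (norm \<xi>)\<^sup>2) powr (3/2)"

lemma sobolev_weight_measurable[measurable]: "sobolev_weight \<in> borel_measurable borel"
  unfolding sobolev_weight_def by measurable

lemma sobolev_weight_pos: "0 < sobolev_weight \<xi>"
proof -
  have "0 < 1 + (norm \<xi>)\<^sup>2" by (simp add: add_pos_nonneg)
  then show ?thesis by (simp add: sobolev_weight_def)
qed

lemma powr_le_sobolev_weight: assumes "0 \<le> s" "s \<le> 3" shows "norm \<xi> powr s \<le> sobolev_weight \<xi>"
proof -
  have "norm \<xi> = (norm \<xi>)\<^sup>2 powr (1/2)" by (simp add: powr_half_sqrt)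
  then have "norm \<xi> powr s = (norm \<xi>)\<^sup>2 powr (s / 2)" by (metis powr_powr mult.commute times_divide_eq_left mult_1)
  also have "\<dots> \<le> (1 + (norm \<xi>)\<^sup>2) powr (s / 2)" using assms by (intro powr_mono2) auto
  also have "\<dots> \<le> sobolev_weight \<xi>" unfolding sobolev_weight_def using assms by (intro powr_mono) auto
  finally show ?thesis .
qed

lemma sobolev_weight_ge_1: "1 \<le> sobolev_weight \<xi>"
  unfolding sobolev_weight_def by (rule ge_one_powr_ge_zero) auto

lemma norm_le_sobolev_weight: "norm \<xi> \<le> sobolev_weight \<xi>" "(norm \<xi>)\<^sup>2 \<le> sobolev_weight \<xi>"
  using powr_le_sobolev_weight[of 1 \<xi>] powr_le_sobolev_weight[of 2 \<xi>] by (auto simp: powr_numeral)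

lemma sobolev_3:
  assumes f: "is_fourier f g"
  shows "sobolev 3 f \<Longrightarrow> L2 (\<lambda>\<xi>. sobolev_weight \<xi> *\<^sub>R g \<xi>)"
    and "sobolev_norm 3 f = L2_norm (\<lambda>\<xi>. sobolev_weight \<xi> *\<^sub>R g \<xi>) / plancherel_const"
proof -
  have g_measurable[measurable]: "g \<in> borel_measurable borel" by (rule L2_measurable[OF is_fourier_L2(2)[OF f]])
  have [measurable]: "fourier f \<in> borel_measurable borel"
    using L2_measurable[OF is_fourier_L2(2)[OF fourier_is[OF is_fourier_L2(1)[OF f]]]] .
  have e: "(norm (sobolev_weight \<xi> *\<^sub>R v))\<^sup>2 = (1 + (norm \<xi>)\<^sup>2) powr 3 * (norm v)\<^sup>2" for \<xi> and v :: "complex^3"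
  proof -
    have "(sobolev_weight \<xi>)\<^sup>2 = (1 + (norm \<xi>)\<^sup>2) powr 3"
      unfolding sobolev_weight_def power2_eq_square by (subst powr_add[symmetric]) simp
    then show ?thesis by (simp add: power_mult_distrib)
  qed
  have ae: "AE \<xi> in lborel. (1 + (norm \<xi>)\<^sup>2) powr 3 * (norm (fourier f \<xi>))\<^sup>2 = (norm (sobolev_weight \<xi> *\<^sub>R g \<xi>))\<^sup>2"
    using fourier_AE[OF f] unfolding e by eventually_elim simp
  show "L2 (\<lambda>\<xi>. sobolev_weight \<xi> *\<^sub>R g \<xi>)" if s: "sobolev 3 f"
  proof -
    have "integrable lborel (\<lambda>\<xi>. (norm (sobolev_weight \<xi> *\<^sub>R g \<xi>))\<^sup>2)"
      by (subst integrable_cong_AE[OF _ _ ae, symmetric]) (use s in \<open>auto simp: sobolev_def\<close>)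
    then show ?thesis unfolding L2_def by simp
  qed
  have "(LINT \<xi>|lborel. (1 + (norm \<xi>)\<^sup>2) powr 3 * (norm (fourier f \<xi>))\<^sup>2) = (L2_norm (\<lambda>\<xi>. sobolev_weight \<xi> *\<^sub>R g \<xi>))\<^sup>2"
    unfolding L2_norm_sq by (rule integral_cong_AE[OF _ _ ae]) measurable
  then show "sobolev_norm 3 f = L2_norm (\<lambda>\<xi>. sobolev_weight \<xi> *\<^sub>R g \<xi>) / plancherel_const"
    unfolding sobolev_norm_def by (simp only: real_sqrt_divide real_sqrt_abs abs_of_nonneg L2_norm_nonneg)
qed

lemma L2_sobolev_weight_mono:
  assumes L: "L2 (\<lambda>\<xi>. sobolev_weight \<xi> *\<^sub>R g \<xi>)" and m: "(\<lambda>\<xi>. m \<xi> (g \<xi>)) \<in> borel_measurable borel"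
    and le: "\<And>\<xi> v. norm (m \<xi> v) \<le> sobolev_weight \<xi> * norm v"
  shows "L2 (\<lambda>\<xi>. m \<xi> (g \<xi>))" "L2_norm (\<lambda>\<xi>. m \<xi> (g \<xi>)) \<le> L2_norm (\<lambda>\<xi>. sobolev_weight \<xi> *\<^sub>R g \<xi>)"
  using le sobolev_weight_pos by (intro L2_norm_mono[OF _ L m] AE_I2, simp add: less_imp_le)+

text \<open>
  The square of \<open>1 / sobolev_weight\<close> is \<open>(1 + |\<xi>|\<^sup>2)\<^sup>-\<^sup>3\<close>, which is at most the product of the
  three one-dimensional functions \<open>1 / (1 + \<xi>\<^sub>j\<^sup>2)\<close>.
\<close>

lemma sobolev_weight_inverse_L2: "L2 (\<lambda>\<xi>. 1 / sobolev_weight \<xi>)"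
proof (rule L2_bound)
  have i: "integrable lborel (\<lambda>x::real. inverse (1 + x\<^sup>2))"
    using integrable_inverse_1_plus_square by (simp add: set_integrable_def)
  show "integrable lborel (\<lambda>\<xi>::real^3. \<Prod>b\<in>Basis. inverse (1 + (\<xi> \<bullet> b)\<^sup>2))"
    by (rule integrable_lborel_prod[OF i])
  show "AE \<xi> in lborel. (norm (1 / sobolev_weight \<xi>))\<^sup>2 \<le> (\<Prod>b\<in>Basis. inverse (1 + (\<xi> \<bullet> b)\<^sup>2))"
  proof (rule AE_I2)
    fix \<xi> :: "real^3"
    let ?n = "1 + (norm \<xi>)\<^sup>2"
    have n: "0 < ?n" by (simp add: add_pos_nonneg)
    have "(norm (1 / sobolev_weight \<xi>))\<^sup>2 = 1 / (sobolev_weight \<xi>)\<^sup>2" by (simp add: power_divide)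
    also have "(sobolev_weight \<xi>)\<^sup>2 = ?n powr 3" unfolding sobolev_weight_def power2_eq_square by (subst powr_add[symmetric]) simp
    also have "\<dots> = ?n ^ 3" using n by (simp add: powr_numeral)
    also have "1 / ?n ^ 3 = (\<Prod>b\<in>(Basis::(real^3) set). inverse ?n)" by (simp add: power_inverse divide_inverse)
    also have "\<dots> \<le> (\<Prod>b\<in>Basis. inverse (1 + (\<xi> \<bullet> b)\<^sup>2))"
    proof (rule prod_mono)
      fix b :: "real^3" assume b: "b \<in> Basis"
      have "(\<xi> \<bullet> b)\<^sup>2 \<le> (norm \<xi>)\<^sup>2" using Basis_le_norm[OF b, of \<xi>] by (metis abs_ge_zero power2_abs power_mono)
      moreover have "0 < 1 + (\<xi> \<bullet> b)\<^sup>2" by (simp add: add_pos_nonneg)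
      ultimately show "0 \<le> inverse ?n \<and> inverse ?n \<le> inverse (1 + (\<xi> \<bullet> b)\<^sup>2)"
        using n by (auto intro!: le_imp_inverse_le)
    qed
    finally show "(norm (1 / sobolev_weight \<xi>))\<^sup>2 \<le> (\<Prod>b\<in>Basis. inverse (1 + (\<xi> \<bullet> b)\<^sup>2))" .
  qed
qed measurable

lemma plancherel_pair_fourier_integral: "integrable lborel f \<Longrightarrow> L2 f \<Longrightarrow> plancherel_pair f (fourier_integral f)"
  by (auto simp: plancherel_pair_def fourier_integral_dist intro: fourier_integral_L2)

text \<open>
  By duality, without an inversion formula: test \<open>f\<close> against the indicator function \<open>\<phi>\<close> of the
  set where \<open>f\<close> exceeds the bound, cut off to a ball. Parseval and \<open>|F \<phi>| \<le> \<integral>\<phi>\<close> show that the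
  excess of \<open>f\<close> has integral at most zero on that set, which is therefore null.
\<close>

lemma L1_fourier_upper_bound:
  assumes p: "plancherel_pair (cx f) g" and g: "integrable lborel g"
  shows "AE x in lborel. f x \<le> (LINT \<xi>|lborel. norm (g \<xi>)) / (2 * pi) ^ 3"
proof -
  define B where "B = (LINT \<xi>|lborel. norm (g \<xi>)) / (2 * pi) ^ 3"
  have fL: "L2 f" using plancherel_pairD(1)[OF p] by (simp add: L2_cx)
  have [measurable]: "f \<in> borel_measurable borel" by (rule L2_measurable[OF fL])
  have "AE x in lborel. \<not> (B < f x \<and> norm x \<le> real n)" for n
  proof -
    \<comment> \<open>The ball makes the indicator function integrable.\<close>
    define A where "A = {x. B < f x \<and> norm x \<le> real n}"
    define \<phi> where "\<phi> x = (indicator A x :: real)" for x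
    have A[measurable]: "A \<in> sets borel" unfolding A_def by measurable
    have [measurable]: "\<phi> \<in> borel_measurable borel" unfolding \<phi>_def by measurable
    have \<phi>: "integrable lborel (cx \<phi>)" "L2 (cx \<phi>)"
    proof -
      have m: "cx \<phi> \<in> borel_measurable borel" by measurable
      have b: "norm (cx \<phi> x) \<le> 1" for x by (simp add: \<phi>_def indicator_def)
      have z: "cx \<phi> x = 0" if "real n < norm x" for x using that by (simp add: \<phi>_def A_def indicator_def)
      show "integrable lborel (cx \<phi>)" "L2 (cx \<phi>)"
        by (rule bounded_support_integrable[where R="real n", OF m b z], assumption)+
    qed
    have \<phi>i: "integrable lborel \<phi>" using integrable_Re[OF \<phi>(1)] by simp
    have n: "norm (fourier_integral (cx \<phi>) \<xi>) \<le> (LINT x|lborel. \<phi> x)" for \<xi>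
      using norm_fourier_integral_le[OF \<phi>(1), of \<xi>] by (simp add: \<phi>_def)
    have fi: "integrable lborel (\<lambda>x. f x * \<phi> x)"
      using L2_inner_integrable[OF fL \<phi>(2)[unfolded L2_cx]] by simp
    have "(2 * pi) ^ 3 * (LINT x|lborel. f x * \<phi> x) = L2_inner g (fourier_integral (cx \<phi>))"
      using plancherel_pair_Parseval[OF p plancherel_pair_fourier_integral[OF \<phi>]] unfolding L2_inner_cx by (simp add: L2_inner_def)
    also have "\<dots> \<le> (LINT \<xi>|lborel. norm (g \<xi>) * (LINT x|lborel. \<phi> x))"
      unfolding L2_inner_def
    proof (rule integral_mono)
      show "integrable lborel (\<lambda>x. g x \<bullet> fourier_integral (cx \<phi>) x)"
        by (rule L2_inner_integrable[OF plancherel_pairD(2)[OF p] plancherel_pairD(2)[OF plancherel_pair_fourier_integral[OF \<phi>]]])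
      show "g \<xi> \<bullet> fourier_integral (cx \<phi>) \<xi> \<le> norm (g \<xi>) * (LINT x|lborel. \<phi> x)" for \<xi>
        by (rule order_trans[OF norm_cauchy_schwarz mult_left_mono[OF n]]) simp
    qed (use g in auto)
    also have "\<dots> = (2 * pi) ^ 3 * (B * (LINT x|lborel. \<phi> x))" by (simp add: B_def)
    finally have "(LINT x|lborel. f x * \<phi> x) \<le> B * (LINT x|lborel. \<phi> x)" by simp
    then have le: "(LINT x|lborel. (f x - B) * \<phi> x) \<le> 0"
      unfolding left_diff_distrib by (subst Bochner_Integration.integral_diff) (use fi \<phi>i in auto)
    have nn: "0 \<le> (f x - B) * \<phi> x" for x by (simp add: \<phi>_def A_def indicator_def)
    have ii: "integrable lborel (\<lambda>x. (f x - B) * \<phi> x)" unfolding left_diff_distrib using fi \<phi>i by auto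
    have "(LINT x|lborel. (f x - B) * \<phi> x) = 0"
      by (rule antisym[OF le]) (simp add: nn integral_nonneg)
    then have "AE x in lborel. (f x - B) * \<phi> x = 0"
      using integral_nonneg_eq_0_iff_AE[OF ii] nn by auto
    then show ?thesis by eventually_elim (auto simp: \<phi>_def A_def indicator_def split: if_splits)
  qed
  then have "AE x in lborel. \<forall>n. \<not> (B < f x \<and> norm x \<le> real n)" unfolding AE_all_countable by blast
  then have "AE x in lborel. f x \<le> B"
  proof eventually_elim
    case (elim x)
    obtain n where "norm x \<le> real n" using real_arch_simple by blast
    then show ?case using elim by force
  qed
  then show ?thesis by (simp add: B_def)
qed

definition sup_const :: real where "sup_const = L2_norm (\<lambda>\<xi>::real^3. 1 / sobolev_weight \<xi>) / (2 * pi) ^ 3"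

lemma L2_normI: "L2 f \<Longrightarrow> L2 (\<lambda>x. norm (f x))"
  unfolding L2_def by (auto intro: borel_measurable_norm)

text \<open>
  By Cauchy-Schwarz the transform is integrable, since \<open>1 / sobolev_weight\<close> is
  square-integrable; the factor 3 comes from summing over the components.
\<close>

theorem sobolev_sup_bound:
  assumes f: "is_fourier f g" and L: "L2 (\<lambda>\<xi>. sobolev_weight \<xi> *\<^sub>R g \<xi>)"
  shows "AE x in lborel. norm (f x) \<le> 3 * (sup_const * L2_norm (\<lambda>\<xi>. sobolev_weight \<xi> *\<^sub>R g \<xi>))"
proof -
  let ?N = "L2_norm (\<lambda>\<xi>. sobolev_weight \<xi> *\<^sub>R g \<xi>)"
  have "AE x in lborel. \<bar>f x $ j\<bar> \<le> sup_const * ?N" for j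
  proof -
    have p: "plancherel_pair (cx (\<lambda>x. f x $ j)) (\<lambda>\<xi>. g \<xi> $ j)" using f by (simp add: is_fourier_iff)
    have g_measurable: "(\<lambda>\<xi>. g \<xi> $ j) \<in> borel_measurable borel" by (rule L2_measurable[OF plancherel_pairD(2)[OF p]])
    have w: "L2 (\<lambda>\<xi>. norm (sobolev_weight \<xi> *\<^sub>R g \<xi> $ j))" "L2_norm (\<lambda>\<xi>. norm (sobolev_weight \<xi> *\<^sub>R g \<xi> $ j)) \<le> ?N"
    proof -
      have "L2 (\<lambda>\<xi>. sobolev_weight \<xi> *\<^sub>R g \<xi> $ j)" using L unfolding L2_vec_iff by (simp add: vector_scaleR_component)
      then show "L2 (\<lambda>\<xi>. norm (sobolev_weight \<xi> *\<^sub>R g \<xi> $ j))" by (rule L2_normI)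
      show "L2_norm (\<lambda>\<xi>. norm (sobolev_weight \<xi> *\<^sub>R g \<xi> $ j)) \<le> ?N"
        using L2_norm_component_le[OF L, of j] by (simp add: L2_norm_def)
    qed
    have e: "norm (g \<xi> $ j) = (1 / sobolev_weight \<xi>) \<bullet> norm (sobolev_weight \<xi> *\<^sub>R g \<xi> $ j)" for \<xi>
      using sobolev_weight_pos[of \<xi>] by simp
    have "integrable lborel (\<lambda>\<xi>. norm (g \<xi> $ j))"
      unfolding e by (rule L2_inner_integrable[OF sobolev_weight_inverse_L2 w(1)])
    then have gi: "integrable lborel (\<lambda>\<xi>. g \<xi> $ j)" using g_measurable by (simp add: integrable_norm_iff)
    have "(LINT \<xi>|lborel. norm (g \<xi> $ j)) = L2_inner (\<lambda>\<xi>. 1 / sobolev_weight \<xi>) (\<lambda>\<xi>. norm (sobolev_weight \<xi> *\<^sub>R g \<xi> $ j))"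
      unfolding e L2_inner_def ..
    also have "\<dots> \<le> L2_norm (\<lambda>\<xi>::real^3. 1 / sobolev_weight \<xi>) * L2_norm (\<lambda>\<xi>. norm (sobolev_weight \<xi> *\<^sub>R g \<xi> $ j))"
      using L2_Cauchy_Schwarz[OF sobolev_weight_inverse_L2 w(1)] by linarith
    also have "\<dots> \<le> L2_norm (\<lambda>\<xi>::real^3. 1 / sobolev_weight \<xi>) * ?N" by (intro mult_left_mono w) simp
    finally have b: "(LINT \<xi>|lborel. norm (g \<xi> $ j)) / (2 * pi) ^ 3 \<le> sup_const * ?N"
      by (simp add: sup_const_def divide_right_mono)
    have p': "plancherel_pair (cx (\<lambda>x. - f x $ j)) (\<lambda>\<xi>. - g \<xi> $ j)" using plancherel_pair_cmult[OF p, of "-1"] by simp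
    have "AE x in lborel. - f x $ j \<le> (LINT \<xi>|lborel. norm (g \<xi> $ j)) / (2 * pi) ^ 3"
      using L1_fourier_upper_bound[OF p'] gi by simp
    then show ?thesis using L1_fourier_upper_bound[OF p gi]
      by eventually_elim (use b in auto)
  qed
  then have "AE x in lborel. \<forall>j. \<bar>f x $ j\<bar> \<le> sup_const * ?N" by (rule eventually_all_finite)
  then show ?thesis
  proof eventually_elim
    case (elim x)
    have "norm (f x) \<le> (\<Sum>j\<in>UNIV. \<bar>f x $ j\<bar>)" by (rule norm_le_l1_cart)
    also have "\<dots> \<le> (\<Sum>j\<in>(UNIV::3 set). sup_const * ?N)" using elim by (intro sum_mono) auto
    finally show ?case by simp
  qed
qed

lemma norm_cross3_le: "norm (cross3 a b) \<le> norm a * norm b"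
proof (rule power2_le_imp_le)
  show "(norm (cross3 a b))\<^sup>2 \<le> (norm a * norm b)\<^sup>2" using norm_cross_dot[of a b] by (metis le_add_same_cancel1 zero_le_power2)
qed simp

lemma cross3_measurable[measurable (raw)]:
  assumes [measurable]: "f \<in> borel_measurable M" "g \<in> borel_measurable M"
  shows "(\<lambda>x. cross3 (f x) (g x)) \<in> borel_measurable M"
proof (rule borel_vecI)
  have "\<forall>i. (\<lambda>x. cross3 (f x) (g x) $ i) \<in> borel_measurable M"
    unfolding forall_3 cross3_def vector_3 by (intro conjI) measurable
  then show "(\<lambda>x. cross3 (f x) (g x) $ i) \<in> borel_measurable M" for i by blast
qed

lemma L2_cross3:
  assumes a: "L2 a" and b: "b \<in> borel_measurable borel" "AE x in lborel. norm (b x) \<le> M"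
  shows "L2 (\<lambda>x. cross3 (a x) (b x))" "L2_norm (\<lambda>x. cross3 (a x) (b x)) \<le> \<bar>M\<bar> * L2_norm a"
proof -
  note b(1)[measurable] L2_measurable[OF a, measurable]
  have ae: "AE x in lborel. norm (cross3 (a x) (b x)) \<le> norm (M *\<^sub>R a x)"
    using b(2)
  proof eventually_elim
    case (elim x)
    have "norm (cross3 (a x) (b x)) \<le> norm (a x) * norm (b x)" by (rule norm_cross3_le)
    also have "\<dots> \<le> norm (a x) * \<bar>M\<bar>" using elim by (intro mult_left_mono) auto
    finally show ?case by (simp add: mult.commute)
  qed
  note m = L2_norm_mono[OF ae L2_scaleR[OF a]]
  show "L2 (\<lambda>x. cross3 (a x) (b x))" by (rule m(1)) measurable
  have "L2_norm (\<lambda>x. cross3 (a x) (b x)) \<le> L2_norm (\<lambda>x. M *\<^sub>R a x)" by (rule m(2)) measurable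
  then show "L2_norm (\<lambda>x. cross3 (a x) (b x)) \<le> \<bar>M\<bar> * L2_norm a" by (simp add: L2_norm_scaleR)
qed

section \<open>Derivatives in space and in time\<close>

lemma Ck_on_space_derivative:
  fixes w :: "real \<Rightarrow> real^3 \<Rightarrow> 'b::real_normed_vector"
  assumes "Ck_on (I \<times> UNIV) (Suc k) (\<lambda>(t, x). w t x)"
  shows "\<exists>D. (\<forall>v. Ck_on (I \<times> UNIV) k (\<lambda>(t, x). D t x v)) \<and>
     (\<forall>t\<in>I. \<forall>x. (w t has_derivative D t x) (at x))"
proof -
  from assms obtain f' where
    f': "\<And>p. p \<in> I \<times> UNIV \<Longrightarrow> ((\<lambda>(t, x). w t x) has_derivative f' p) (at p within I \<times> UNIV)"
    and c: "\<And>v. Ck_on (I \<times> UNIV) k (\<lambda>p. f' p v)" unfolding Ck_on.simps by blast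
  have "(w t has_derivative (\<lambda>v. f' (t, x) (0, v))) (at x)" if "t \<in> I" for t x
  proof -
    have "((\<lambda>x. case_prod w (t, x)) has_derivative (\<lambda>v. f' (t, x) (0, v))) (at x within UNIV)"
    proof (rule has_derivative_in_compose2[where t="I \<times> UNIV" and g'=f'])
      show "((\<lambda>x. (t, x)) has_derivative (\<lambda>v. (0, v))) (at x within UNIV)"
        by (intro has_derivative_Pair has_derivative_const has_derivative_ident)
    qed (use that f' in auto)
    then show ?thesis by simp
  qed
  moreover have "Ck_on (I \<times> UNIV) k (\<lambda>(t, x). f' (t, x) (0, v))" for v
    using c[of "(0, v)"] by (simp add: case_prod_unfold)
  ultimately show ?thesis by (intro exI[of _ "\<lambda>t x v. f' (t, x) (0, v)"]) auto
qed

lemma C1_on_time_derivative: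
  fixes w :: "real \<Rightarrow> real^3 \<Rightarrow> 'b::real_normed_vector"
  assumes "Ck_on (I \<times> UNIV) 1 (\<lambda>(t, x). w t x)"
  shows "\<exists>V. continuous_on (I \<times> UNIV) (\<lambda>(t, x). V t x) \<and>
     (\<forall>t\<in>I. \<forall>x. ((\<lambda>\<tau>. w \<tau> x) has_vector_derivative V t x) (at t within I))"
proof -
  from assms obtain f' where
    f': "\<And>p. p \<in> I \<times> UNIV \<Longrightarrow> ((\<lambda>(t, x). w t x) has_derivative f' p) (at p within I \<times> UNIV)"
    and c: "\<And>v. continuous_on (I \<times> UNIV) (\<lambda>p. f' p v)"
    unfolding One_nat_def Ck_on.simps by blast
  have "((\<lambda>\<tau>. w \<tau> x) has_vector_derivative f' (t, x) (1, 0)) (at t within I)" if t: "t \<in> I" for t x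
  proof -
    have "((\<lambda>\<tau>. case_prod w (\<tau>, x)) has_derivative (\<lambda>h. f' (t, x) (h, 0))) (at t within I)"
    proof (rule has_derivative_in_compose2[where t="I \<times> UNIV" and g'=f'])
      show "((\<lambda>\<tau>. (\<tau>, x)) has_derivative (\<lambda>h. (h, 0))) (at t within I)"
        by (intro has_derivative_Pair has_derivative_const has_derivative_ident)
    qed (use t f' in auto)
    moreover have "(\<lambda>h. f' (t, x) (h, 0)) = (\<lambda>h. h *\<^sub>R f' (t, x) (1, 0))"
    proof
      fix h
      have "linear (f' (t, x))" using t by (intro has_derivative_linear[OF f']) simp
      from linear_scale[OF this, of h "(1, 0)"] show "f' (t, x) (h, 0) = h *\<^sub>R f' (t, x) (1, 0)" by simp
    qed
    ultimately show ?thesis unfolding has_vector_derivative_def by (simp only: prod.case)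
  qed
  moreover have "continuous_on (I \<times> UNIV) (\<lambda>(t, x). f' (t, x) (1, 0))"
    using c[of "(1, 0)"] by (simp add: case_prod_unfold)
  ultimately show ?thesis by (intro exI[of _ "\<lambda>t x. f' (t, x) (1, 0)"]) auto
qed

lemma C2_components_differentiable:
  fixes u :: "real \<Rightarrow> real^3 \<Rightarrow> real^3"
  assumes smooth_Ck: "Ck_on (I \<times> UNIV) 2 (\<lambda>(t, x). u t x)" and t: "t \<in> I"
  shows "(\<lambda>y. u t y $ k) differentiable (at x)" "(\<lambda>y. curl (u t) y $ k) differentiable (at x)"
proof -
  obtain D where D: "\<And>v. Ck_on (I \<times> UNIV) 1 (\<lambda>(t, x). D t x v)"
    and d: "\<And>t x. t \<in> I \<Longrightarrow> (u t has_derivative D t x) (at x)"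
    using Ck_on_space_derivative[of I 1 u] smooth_Ck unfolding numeral_2_eq_2 One_nat_def by blast
  have dc: "((\<lambda>y. u t y $ j) has_derivative (\<lambda>v. D t x v $ j)) (at x)" for j x
    by (rule bounded_linear.has_derivative[OF bounded_linear_vec_nth d[OF t]])
  then show "(\<lambda>y. u t y $ k) differentiable (at x)" by (auto simp: differentiable_def)
  have p: "partial i (\<lambda>y. u t y $ j) = (\<lambda>y. D t y (axis i 1) $ j)" for i j
    using frechet_derivative_at[OF dc] by (auto simp: partial_def fun_eq_iff)
  have pd: "(\<lambda>y. D t y (axis i 1) $ j) differentiable (at x)" for i j
  proof -
    obtain D' where "\<And>t x. t \<in> I \<Longrightarrow> ((\<lambda>x. D t x (axis i 1)) has_derivative D' t x) (at x)"
      using Ck_on_space_derivative[of I 0 "\<lambda>t x. D t x (axis i 1)"] D[of "axis i 1"] unfolding One_nat_def by blast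
    from bounded_linear.has_derivative[OF bounded_linear_vec_nth this[OF t]]
    show ?thesis unfolding differentiable_def by blast
  qed
  have "\<forall>k. (\<lambda>y. curl (u t) y $ k) differentiable (at x)"
    unfolding forall_3 curl_def vector_3 p by (intro conjI differentiable_diff pd)
  then show "(\<lambda>y. curl (u t) y $ k) differentiable (at x)" by blast
qed

lemma norm_curl_symbol_twice_le: "norm (curl_symbol \<xi> (curl_symbol \<xi> v)) \<le> (norm \<xi>)\<^sup>2 * norm v"
proof -
  have "norm (curl_symbol \<xi> (curl_symbol \<xi> v)) \<le> norm \<xi> * norm (curl_symbol \<xi> v)" by (rule norm_curl_symbol_le)
  also have "\<dots> \<le> norm \<xi> * (norm \<xi> * norm v)" by (intro mult_left_mono norm_curl_symbol_le) simp
  finally show ?thesis by (simp add: power2_eq_square)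
qed

section \<open>Divergence-free fields of class \<open>H\<^sup>3\<close>\<close>

definition vorticity_cross :: "(real^3 \<Rightarrow> real^3) \<Rightarrow> real^3 \<Rightarrow> real^3" where
  "vorticity_cross f x = cross3 (curl f x) (f x)"

text \<open>
  For divergence-free \<open>f\<close> this is \<open>C_sign \<sigma> 1 f\<close> up to a null set, because
  \<open>|D| curl |D|\<^sup>-\<^sup>1 = curl\<close>. It is the field against which the equation is tested.
\<close>

definition C_sign_one :: "real \<Rightarrow> (real^3 \<Rightarrow> real^3) \<Rightarrow> real^3 \<Rightarrow> real^3" where
  "C_sign_one \<sigma> f x = (1/2) *\<^sub>R (abs_D_powr 1 f x + \<sigma> *\<^sub>R curl f x)"

locale solenoidal_field =
  fixes f :: "real^3 \<Rightarrow> real^3" and g :: "real^3 \<Rightarrow> complex^3"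
  assumes fourier: "is_fourier f g"
    and weight: "L2 (\<lambda>\<xi>. sobolev_weight \<xi> *\<^sub>R g \<xi>)"
    and d1: "\<And>k x. (\<lambda>y. f y $ k) differentiable (at x)"
    and d2: "\<And>k x. (\<lambda>y. curl f y $ k) differentiable (at x)"
    and div0: "\<And>x. divergence f x = 0"
begin

lemma g_measurable[measurable]: "g \<in> borel_measurable borel"
  by (rule L2_measurable[OF is_fourier_L2(2)[OF fourier]])

lemma L2f: "L2 f" by (rule is_fourier_L2[OF fourier])

lemma symbol_L2:
  assumes "(\<lambda>\<xi>. m \<xi> (g \<xi>)) \<in> borel_measurable borel" "\<And>\<xi> v. norm (m \<xi> v) \<le> sobolev_weight \<xi> * norm v"
  shows "L2 (\<lambda>\<xi>. m \<xi> (g \<xi>))"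
  by (rule L2_sobolev_weight_mono(1)[OF weight assms])

lemma powr_L2: assumes "0 \<le> s" "s \<le> 3" shows "L2 (\<lambda>\<xi>. (norm \<xi> powr s) *\<^sub>R g \<xi>)"
  by (rule symbol_L2[of "\<lambda>\<xi> v. (norm \<xi> powr s) *\<^sub>R v"]) (use powr_le_sobolev_weight[OF assms] in \<open>auto intro!: mult_right_mono\<close>)

lemma norm_L2: "L2 (\<lambda>\<xi>. norm \<xi> *\<^sub>R g \<xi>)"
  using powr_L2[of 1] by simp

lemma is_fourier_curl_f: "is_fourier (curl f) (\<lambda>\<xi>. curl_symbol \<xi> (g \<xi>))"
  by (rule is_fourier_curl[OF fourier norm_L2 d1])

lemma is_fourier_curl_curl_f: "is_fourier (curl (curl f)) (\<lambda>\<xi>. curl_symbol \<xi> (curl_symbol \<xi> (g \<xi>)))"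
proof (rule is_fourier_curl[OF is_fourier_curl_f _ d2])
  show "L2 (\<lambda>\<xi>. norm \<xi> *\<^sub>R curl_symbol \<xi> (g \<xi>))"
  proof (rule symbol_L2[of "\<lambda>\<xi> v. norm \<xi> *\<^sub>R curl_symbol \<xi> v"])
    fix \<xi> and v :: "complex^3"
    have "norm (norm \<xi> *\<^sub>R curl_symbol \<xi> v) \<le> norm \<xi> * (norm \<xi> * norm v)"
      using mult_left_mono[OF norm_curl_symbol_le[of \<xi> v], of "norm \<xi>"] by simp
    also have "\<dots> \<le> sobolev_weight \<xi> * norm v"
      using mult_right_mono[OF norm_le_sobolev_weight(2)[of \<xi>], of "norm v"] by (simp add: power2_eq_square mult.assoc)
    finally show "norm (norm \<xi> *\<^sub>R curl_symbol \<xi> v) \<le> sobolev_weight \<xi> * norm v" .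
  qed measurable
qed

lemma freq_dot_zero: "AE \<xi> in lborel. freq_dot \<xi> (g \<xi>) = 0"
  by (rule freq_dot_divergence_free[OF fourier norm_L2 d1 div0])

lemma is_fourier_abs_D: assumes "0 \<le> s" "s \<le> 3"
  shows "is_fourier (abs_D_powr s f) (\<lambda>\<xi>. (norm \<xi> powr s) *\<^sub>R g \<xi>)"
  unfolding abs_D_powr_def
  by (rule multiplier_is_fourier[OF fourier, of "\<lambda>\<xi> v. (norm \<xi> powr s) *\<^sub>R v"])
    (simp_all add: cnj_vec_scaleR powr_L2 assms)

lemma is_fourier_C_sign_one:
  "is_fourier (C_sign_one \<sigma> f) (\<lambda>\<xi>. (1/2) *\<^sub>R ((norm \<xi> powr 1) *\<^sub>R g \<xi> + \<sigma> *\<^sub>R curl_symbol \<xi> (g \<xi>)))"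
  unfolding C_sign_one_def[abs_def]
  by (intro is_fourier_scaleR is_fourier_add is_fourier_abs_D is_fourier_curl_f) auto

lemma C_sign_one_div_free: "L2_div_free (C_sign_one \<sigma> f)"
proof (rule L2_div_freeI[OF is_fourier_C_sign_one])
  show "AE \<xi> in lborel. freq_dot \<xi> ((1/2) *\<^sub>R ((norm \<xi> powr 1) *\<^sub>R g \<xi> + \<sigma> *\<^sub>R curl_symbol \<xi> (g \<xi>))) = 0"
    using freq_dot_zero by eventually_elim (simp add: freq_dot_add freq_dot_scaleR freq_dot_curl_symbol)
qed

lemma is_fourier_leray: "is_fourier (leray f) g"
proof (rule is_fourier_cong[OF fourier])
  have V: "L2_div_free f" by (rule L2_div_freeI[OF fourier freq_dot_zero])
  show "leray f \<in> borel_measurable borel" by (rule L2_measurable[OF leray_L2[OF L2f]])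
  show "AE x in lborel. f x = leray f x" using leray_id[OF V] by eventually_elim simp
qed auto

lemma norm_curl_inv_le: "norm ((norm \<xi> powr (-1)) *\<^sub>R curl_symbol \<xi> v) \<le> norm v"
proof (cases "\<xi> = 0")
  case False
  have "norm ((norm \<xi> powr (-1)) *\<^sub>R curl_symbol \<xi> v) = norm \<xi> powr (-1) * norm (curl_symbol \<xi> v)" by simp
  also have "\<dots> \<le> norm \<xi> powr (-1) * (norm \<xi> * norm v)" by (intro mult_left_mono norm_curl_symbol_le) simp
  also have "\<dots> = norm v" using False by (simp add: powr_minus_divide)
  finally show ?thesis .
qed simp

lemma is_fourier_Q_sign: "is_fourier (Q_sign \<sigma> f) (\<lambda>\<xi>. Q_symbol \<sigma> \<xi> (g \<xi>))"
proof -
  have "is_fourier (curl_inv_abs_D f) (\<lambda>\<xi>. (norm \<xi> powr (-1)) *\<^sub>R curl_symbol \<xi> (g \<xi>))"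
    unfolding curl_inv_abs_D_def
  proof (rule multiplier_is_fourier[OF fourier])
    show "L2 (\<lambda>\<xi>. (norm \<xi> powr (-1)) *\<^sub>R curl_symbol \<xi> (g \<xi>))"
    proof (rule L2_norm_mono(1)[OF _ is_fourier_L2(2)[OF fourier]])
      show "AE \<xi> in lborel. norm ((norm \<xi> powr (-1)) *\<^sub>R curl_symbol \<xi> (g \<xi>)) \<le> norm (g \<xi>)"
        by (intro AE_I2 norm_curl_inv_le)
    qed measurable
  qed (simp add: curl_symbol_cnj_vec cnj_vec_scaleR)
  then show ?thesis
    unfolding Q_sign_def Q_symbol_def by (intro is_fourier_scaleR is_fourier_add is_fourier_leray)
qed

lemma norm_Q_symbol_le: assumes "\<bar>\<sigma>\<bar> = 1" shows "norm (Q_symbol \<sigma> \<xi> v) \<le> norm v"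
proof -
  have "norm (v + \<sigma> *\<^sub>R (norm \<xi> powr (-1)) *\<^sub>R curl_symbol \<xi> v)
     \<le> norm v + norm (\<sigma> *\<^sub>R ((norm \<xi> powr (-1)) *\<^sub>R curl_symbol \<xi> v))" by (rule norm_triangle_ineq)
  also have "\<dots> = norm v + norm ((norm \<xi> powr (-1)) *\<^sub>R curl_symbol \<xi> v)"
    unfolding norm_scaleR[of \<sigma>] assms by simp
  also have "\<dots> \<le> 2 * norm v" using norm_curl_inv_le[of \<xi> v] by linarith
  finally show ?thesis unfolding Q_symbol_def norm_scaleR by simp
qed

lemma is_fourier_C_sign:
  assumes \<sigma>: "\<bar>\<sigma>\<bar> = 1" and s: "0 \<le> s" "s \<le> 3"
  shows "is_fourier (C_sign \<sigma> s f) (\<lambda>\<xi>. (norm \<xi> powr s) *\<^sub>R Q_symbol \<sigma> \<xi> (g \<xi>))"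
  unfolding C_sign_def abs_D_powr_def
proof (rule multiplier_is_fourier[OF is_fourier_Q_sign])
  show "L2 (\<lambda>\<xi>. (norm \<xi> powr s) *\<^sub>R Q_symbol \<sigma> \<xi> (g \<xi>))"
  proof (rule symbol_L2[of "\<lambda>\<xi> v. (norm \<xi> powr s) *\<^sub>R Q_symbol \<sigma> \<xi> v"])
    show "norm ((norm \<xi> powr s) *\<^sub>R Q_symbol \<sigma> \<xi> v) \<le> sobolev_weight \<xi> * norm v" for \<xi> v
      using mult_mono[OF powr_le_sobolev_weight[OF s] norm_Q_symbol_le[OF \<sigma>]] sobolev_weight_pos[of \<xi>] by (simp add: less_imp_le)
    show "(\<lambda>\<xi>. (norm \<xi> powr s) *\<^sub>R Q_symbol \<sigma> \<xi> (g \<xi>)) \<in> borel_measurable borel"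
      unfolding Q_symbol_def by measurable
  qed
qed (simp add: cnj_vec_scaleR)

lemma AE_nonzero: "AE \<xi> in lborel. \<xi> \<noteq> (0::real^3)"
  by (rule AE_lborel_singleton)

text \<open>
  Both follow from \<open>|Q v|\<^sup>2 = v \<cdot> Q v\<close> for the symbol \<open>Q\<close>; the second also uses
  \<open>curl curl = |D|\<^sup>2\<close> on divergence-free fields.
\<close>

lemma C_sign_norm_sq:
  assumes \<sigma>: "\<bar>\<sigma>\<bar> = 1"
  shows "(L2_norm (C_sign \<sigma> (1/2) f))\<^sup>2 = L2_inner f (C_sign_one \<sigma> f)"
    and "(L2_norm (C_sign \<sigma> (3/2) f))\<^sup>2 = L2_inner (curl (curl f)) (C_sign_one \<sigma> f)"
proof -
  let ?W = "\<lambda>\<xi>. (1/2) *\<^sub>R ((norm \<xi> powr 1) *\<^sub>R g \<xi> + \<sigma> *\<^sub>R curl_symbol \<xi> (g \<xi>))"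
  have s2: "\<sigma>\<^sup>2 = 1" using \<sigma> by (metis power2_abs power_one)
  have W: "?W \<xi> = norm \<xi> *\<^sub>R Q_symbol \<sigma> \<xi> (g \<xi>)" if "\<xi> \<noteq> 0" for \<xi>
    using that by (simp add: Q_symbol_def scaleR_add_right powr_minus_divide)
  have key: "(norm ((norm \<xi> powr s) *\<^sub>R Q_symbol \<sigma> \<xi> (g \<xi>)))\<^sup>2 = (norm \<xi> powr (2 * s)) * (g \<xi> \<bullet> Q_symbol \<sigma> \<xi> (g \<xi>))"
    if "\<xi> \<noteq> 0" "freq_dot \<xi> (g \<xi>) = 0" for \<xi> s
  proof -
    have "(norm \<xi> powr s)\<^sup>2 = norm \<xi> powr (2 * s)"
      unfolding power2_eq_square by (subst powr_add[symmetric]) simp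
    then show ?thesis
      by (simp add: power_mult_distrib norm_Q_symbol_sq[OF that(2) s2 that(1)])
  qed
  have [measurable]: "(\<lambda>\<xi>. Q_symbol \<sigma> \<xi> (g \<xi>)) \<in> borel_measurable borel" unfolding Q_symbol_def by measurable
  have "L2_inner (\<lambda>\<xi>. (norm \<xi> powr (1/2)) *\<^sub>R Q_symbol \<sigma> \<xi> (g \<xi>)) (\<lambda>\<xi>. (norm \<xi> powr (1/2)) *\<^sub>R Q_symbol \<sigma> \<xi> (g \<xi>))
      = L2_inner g ?W"
    unfolding L2_inner_def
  proof (rule integral_cong_AE)
    show "AE \<xi> in lborel. ((norm \<xi> powr (1/2)) *\<^sub>R Q_symbol \<sigma> \<xi> (g \<xi>)) \<bullet> ((norm \<xi> powr (1/2)) *\<^sub>R Q_symbol \<sigma> \<xi> (g \<xi>)) = g \<xi> \<bullet> ?W \<xi>"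
      using freq_dot_zero AE_nonzero
    proof eventually_elim
      case (elim \<xi>)
      show ?case unfolding W[OF elim(2)] power2_norm_eq_inner[symmetric] key[OF elim(2,1)] using elim by simp
    qed
  qed measurable
  then show "(L2_norm (C_sign \<sigma> (1/2) f))\<^sup>2 = L2_inner f (C_sign_one \<sigma> f)"
    unfolding L2_norm_sq_inner using Parseval[OF fourier is_fourier_C_sign_one[of \<sigma>]]
      Parseval[OF is_fourier_C_sign[OF \<sigma>, of "1/2"] is_fourier_C_sign[OF \<sigma>, of "1/2"]] by simp
  have "L2_inner (\<lambda>\<xi>. (norm \<xi> powr (3/2)) *\<^sub>R Q_symbol \<sigma> \<xi> (g \<xi>)) (\<lambda>\<xi>. (norm \<xi> powr (3/2)) *\<^sub>R Q_symbol \<sigma> \<xi> (g \<xi>))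
      = L2_inner (\<lambda>\<xi>. curl_symbol \<xi> (curl_symbol \<xi> (g \<xi>))) ?W"
    unfolding L2_inner_def
  proof (rule integral_cong_AE)
    show "AE \<xi> in lborel. ((norm \<xi> powr (3/2)) *\<^sub>R Q_symbol \<sigma> \<xi> (g \<xi>)) \<bullet> ((norm \<xi> powr (3/2)) *\<^sub>R Q_symbol \<sigma> \<xi> (g \<xi>))
        = curl_symbol \<xi> (curl_symbol \<xi> (g \<xi>)) \<bullet> ?W \<xi>"
      using freq_dot_zero AE_nonzero
    proof eventually_elim
      case (elim \<xi>)
      have "curl_symbol \<xi> (curl_symbol \<xi> (g \<xi>)) = (norm \<xi>)\<^sup>2 *\<^sub>R g \<xi>"
        unfolding curl_symbol_twice elim(1) by (simp add: vec_eq_iff)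
      moreover have "norm \<xi> powr 3 = (norm \<xi>)\<^sup>2 * norm \<xi>"
        using elim by (simp add: powr_numeral power2_eq_square power3_eq_cube)
      ultimately show ?case
        unfolding W[OF elim(2)] power2_norm_eq_inner[symmetric] key[OF elim(2,1)] by simp
    qed
  qed measurable
  then show "(L2_norm (C_sign \<sigma> (3/2) f))\<^sup>2 = L2_inner (curl (curl f)) (C_sign_one \<sigma> f)"
    unfolding L2_norm_sq_inner using Parseval[OF is_fourier_curl_curl_f is_fourier_C_sign_one[of \<sigma>]]
      Parseval[OF is_fourier_C_sign[OF \<sigma>, of "3/2"] is_fourier_C_sign[OF \<sigma>, of "3/2"]] by simp
qed

text \<open>
  The two signs give complementary orthogonal projections of the divergence-free vectors.
\<close>

lemma hom_sobolev_split:
  assumes s: "0 \<le> s" "s \<le> 3"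
  shows "(hom_sobolev_norm s f)\<^sup>2 = (L2_norm (C_sign 1 s f))\<^sup>2 + (L2_norm (C_sign (-1) s f))\<^sup>2"
proof -
  let ?Q = "\<lambda>\<sigma> \<xi>. (norm \<xi> powr s) *\<^sub>R Q_symbol \<sigma> \<xi> (g \<xi>)"
  have F: "is_fourier (C_sign 1 s f) (?Q 1)" "is_fourier (C_sign (-1) s f) (?Q (-1))"
    using s by (auto intro: is_fourier_C_sign)
  note L = is_fourier_L2(2)[OF F(1)] is_fourier_L2(2)[OF F(2)]
  note A = is_fourier_abs_D[OF s]
  have sum: "?Q 1 \<xi> + ?Q (-1) \<xi> = (norm \<xi> powr s) *\<^sub>R g \<xi>" for \<xi>
    unfolding Q_symbol_def scaleR_add_right[symmetric] by (simp flip: scaleR_2)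
  have orth: "AE \<xi> in lborel. ?Q 1 \<xi> \<bullet> ?Q (-1) \<xi> = 0"
    using freq_dot_zero AE_nonzero
  proof eventually_elim
    case (elim \<xi>)
    have "norm ((norm \<xi> powr (-1)) *\<^sub>R curl_symbol \<xi> (g \<xi>)) = norm (g \<xi>)"
      unfolding norm_scaleR norm_curl_symbol[OF elim(1)] using elim(2) by (simp add: powr_minus_divide)
    moreover define w where "w = (norm \<xi> powr (-1)) *\<^sub>R curl_symbol \<xi> (g \<xi>)"
    ultimately have w: "w \<bullet> w = g \<xi> \<bullet> g \<xi>"
      unfolding power2_norm_eq_inner[symmetric] by simp
    have "Q_symbol 1 \<xi> (g \<xi>) \<bullet> Q_symbol (-1) \<xi> (g \<xi>) = 0"
      unfolding Q_symbol_def w_def[symmetric] inner_scaleR_left inner_scaleR_right inner_add_left inner_add_right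
      using w by (simp add: inner_commute[of w "g \<xi>"] add_divide_distrib diff_divide_distrib)
    then show ?case by simp
  qed
  have "(L2_norm (\<lambda>\<xi>. (norm \<xi> powr s) *\<^sub>R g \<xi>))\<^sup>2 = (L2_norm (\<lambda>\<xi>. ?Q 1 \<xi> + ?Q (-1) \<xi>))\<^sup>2"
    unfolding sum ..
  also have "\<dots> = (L2_norm (?Q 1))\<^sup>2 + 2 * L2_inner (?Q 1) (?Q (-1)) + (L2_norm (?Q (-1)))\<^sup>2"
    by (rule L2_norm_sq_add[OF L])
  also have "L2_inner (?Q 1) (?Q (-1)) = 0"
    unfolding L2_inner_def by (rule integral_eq_zero_AE[OF orth])
  finally show ?thesis
    unfolding hom_sobolev_norm_def Plancherel[OF A] Plancherel[OF F(1)] Plancherel[OF F(2)]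
    by (simp add: add_divide_distrib)
qed

lemma sup_bound: "AE x in lborel. norm (f x) \<le> 3 * (sup_const * L2_norm (\<lambda>\<xi>. sobolev_weight \<xi> *\<^sub>R g \<xi>))"
  by (rule sobolev_sup_bound[OF fourier weight])

lemma vorticity_cross_L2: "L2 (vorticity_cross f)"
  unfolding vorticity_cross_def[abs_def]
  by (rule L2_cross3(1)[OF is_fourier_L2(1)[OF is_fourier_curl_f] L2_measurable[OF L2f] sup_bound])

text \<open>
  The curl half of \<open>C_sign_one\<close> contributes nothing, since \<open>curl f \<times> f\<close> is pointwise orthogonal
  to \<open>curl f\<close>. This is why the same determinant appears for both signs.
\<close>

lemma vorticity_cross_C_sign_one:
  "2 * L2_inner (vorticity_cross f) (C_sign_one \<sigma> f) = (LINT x|lborel. det3 (curl f x) (f x) (abs_D_powr 1 f x))"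
proof -
  have "vorticity_cross f x \<bullet> C_sign_one \<sigma> f x = (1/2) * det3 (curl f x) (f x) (abs_D_powr 1 f x)" for x
    by (simp add: vorticity_cross_def C_sign_one_def det3_def inner_add_right dot_cross_self)
  then have "L2_inner (vorticity_cross f) (C_sign_one \<sigma> f) = (LINT x|lborel. (1/2) * det3 (curl f x) (f x) (abs_D_powr 1 f x))"
    unfolding L2_inner_def by presburger
  then show ?thesis by simp
qed

end

section \<open>Continuous and differentiable curves in \<open>L\<^sup>2\<close>\<close>

text \<open>
  Mean value inequality in \<open>L\<^sup>2\<close> for a pointwise derivative. For each \<open>x\<close> the difference is the
  time integral of \<open>V \<tau> x - V r x\<close>; Cauchy-Schwarz in time and Tonelli reduce its \<open>L\<^sup>2\<close> norm to
  those of the integrand. The base point \<open>r\<close> may be either end, so that the lemma gives left and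
  right derivatives.
\<close>

lemma L2_difference_bound:
  fixes u V :: "real \<Rightarrow> real^3 \<Rightarrow> real^3"
  assumes st: "s \<le> t" and r: "r \<in> {s..t}"
    and cont: "continuous_on ({s..t} \<times> UNIV) (\<lambda>(\<tau>, x). V \<tau> x)"
    and deriv: "\<And>\<tau> x. \<tau> \<in> {s..t} \<Longrightarrow> ((\<lambda>\<tau>. u \<tau> x) has_vector_derivative V \<tau> x) (at \<tau> within {s..t})"
    and uL: "L2 (u s)" "L2 (u t)" and VL: "\<And>\<tau>. \<tau> \<in> {s..t} \<Longrightarrow> L2 (V \<tau>)"
    and \<epsilon>: "\<And>\<tau>. \<tau> \<in> {s..t} \<Longrightarrow> L2_norm (\<lambda>x. V \<tau> x - V r x) \<le> \<epsilon>"
  shows "L2_norm (\<lambda>x. u t x - u s x - (t - s) *\<^sub>R V r x) \<le> (t - s) * \<epsilon>"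
proof -
  define h where "h p = indicator ({s..t} \<times> UNIV) p *\<^sub>R (V (fst p) (snd p) - V r (snd p))" for p :: "real \<times> (real^3)"
  have hx: "h (\<tau>, x) = indicator {s..t} \<tau> *\<^sub>R (V \<tau> x - V r x)" for \<tau> x
    by (simp add: h_def indicator_def)
  have cVr: "continuous_on ({s..t} \<times> UNIV) (\<lambda>p. V r (snd p))"
    using r by (intro continuous_on_compose2[OF cont, of _ "\<lambda>p. (r, snd p)", simplified] continuous_intros) auto
  have "h \<in> borel_measurable borel"
    unfolding h_def
  proof (rule borel_measurable_continuous_on_indicator)
    show "({s..t} \<times> UNIV :: (real \<times> (real^3)) set) \<in> sets borel" by (intro borel_closed closed_Times) auto
    show "continuous_on ({s..t} \<times> UNIV) (\<lambda>p. V (fst p) (snd p) - V r (snd p))"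
      using cont cVr by (intro continuous_on_diff) (auto simp: case_prod_unfold)
  qed
  then have hm[measurable]: "h \<in> borel_measurable (lborel \<Otimes>\<^sub>M lborel)"
    by (simp add: lborel_prod)
  have \<epsilon>0: "0 \<le> \<epsilon>" using \<epsilon>[OF r] L2_norm_nonneg order_trans by blast
  define R where "R x = u t x - u s x - (t - s) *\<^sub>R V r x" for x
  have RL: "L2 R" unfolding R_def by (intro L2_diff L2_scaleR uL VL r)
  have R: "R x = (LINT \<tau>|lborel. h (\<tau>, x))" for x
  proof -
    have "(LINT \<tau>|lborel. indicator {s..t} \<tau> *\<^sub>R (V \<tau> x - V r x))
        = (u t x - (t - s) *\<^sub>R V r x) - (u s x - (s - s) *\<^sub>R V r x)"
    proof (rule integral_FTC_atLeastAtMost[OF st, of "\<lambda>\<tau>. u \<tau> x - (\<tau> - s) *\<^sub>R V r x"])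
      fix \<tau> assume "s \<le> \<tau>" "\<tau> \<le> t"
      then have "((\<lambda>\<tau>. u \<tau> x) has_vector_derivative V \<tau> x) (at \<tau> within {s..t})" by (intro deriv) simp
      then show "((\<lambda>\<tau>. u \<tau> x - (\<tau> - s) *\<^sub>R V r x) has_vector_derivative V \<tau> x - V r x) (at \<tau> within {s..t})"
        by (auto intro!: derivative_eq_intros)
    next
      show "continuous_on {s..t} (\<lambda>\<tau>. V \<tau> x - V r x)"
        by (intro continuous_intros continuous_on_compose2[OF cont, of _ "\<lambda>\<tau>. (\<tau>, x)", simplified]) auto
    qed
    then show ?thesis by (simp add: hx R_def)
  qed
  have sq: "ennreal ((norm (R x))\<^sup>2) \<le> (\<integral>\<^sup>+\<tau>. ennreal ((norm (h (\<tau>, x)))\<^sup>2) \<partial>lborel) * ennreal (t - s)" for x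
  proof -
    have [measurable]: "(\<lambda>\<tau>. h (\<tau>, x)) \<in> borel_measurable borel" using measurable_compose[OF measurable_Pair2' hm, of x] by simp
    have "ennreal (norm (R x)) \<le> (\<integral>\<^sup>+\<tau>. ennreal (norm (h (\<tau>, x))) \<partial>lborel)"
    proof (cases "integrable lborel (\<lambda>\<tau>. h (\<tau>, x))")
      case True
      then show ?thesis unfolding R by (rule integral_norm_bound_ennreal)
    qed (simp add: R not_integrable_integral_eq)
    also have "\<dots> = (\<integral>\<^sup>+\<tau>. ennreal (norm (h (\<tau>, x))) * indicator {s..t} \<tau> \<partial>lborel)"
      by (intro nn_integral_cong) (simp add: hx indicator_def)
    finally have "(ennreal (norm (R x)))\<^sup>2 \<le> (\<integral>\<^sup>+\<tau>. ennreal (norm (h (\<tau>, x))) * indicator {s..t} \<tau> \<partial>lborel)\<^sup>2"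
      by (rule power_mono) simp
    also have "\<dots> \<le> (\<integral>\<^sup>+\<tau>. (ennreal (norm (h (\<tau>, x))))\<^sup>2 \<partial>lborel) * (\<integral>\<^sup>+\<tau>. (indicator {s..t} \<tau>)\<^sup>2 \<partial>lborel)"
      by (rule Cauchy_Schwarz_nn_integral) measurable
    also have "(\<integral>\<^sup>+\<tau>. (indicator {s..t} \<tau>)\<^sup>2 \<partial>lborel) = (\<integral>\<^sup>+\<tau>. indicator {s..t} \<tau> \<partial>lborel)"
      by (intro nn_integral_cong) (simp add: indicator_def)
    also have "\<dots> = ennreal (t - s)" using st by simp
    finally show ?thesis by (simp add: ennreal_power)
  qed
  have "ennreal ((L2_norm R)\<^sup>2) = (\<integral>\<^sup>+x. ennreal ((norm (R x))\<^sup>2) \<partial>lborel)"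
    by (rule nn_integral_norm_sq[OF RL, symmetric])
  also have "\<dots> \<le> (\<integral>\<^sup>+x. (\<integral>\<^sup>+\<tau>. ennreal ((norm (h (\<tau>, x)))\<^sup>2) \<partial>lborel) * ennreal (t - s) \<partial>lborel)"
    by (intro nn_integral_mono sq)
  also have "\<dots> = (\<integral>\<^sup>+x. (\<integral>\<^sup>+\<tau>. ennreal ((norm (h (\<tau>, x)))\<^sup>2) \<partial>lborel) \<partial>lborel) * ennreal (t - s)"
    by (rule nn_integral_multc) measurable
  also have "(\<integral>\<^sup>+x. (\<integral>\<^sup>+\<tau>. ennreal ((norm (h (\<tau>, x)))\<^sup>2) \<partial>lborel) \<partial>lborel)
      = (\<integral>\<^sup>+\<tau>. (\<integral>\<^sup>+x. ennreal ((norm (h (\<tau>, x)))\<^sup>2) \<partial>lborel) \<partial>lborel)"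
    by (rule lborel_pair.Fubini) measurable
  also have "\<dots> \<le> (\<integral>\<^sup>+\<tau>. ennreal (\<epsilon>\<^sup>2) * indicator {s..t} \<tau> \<partial>lborel)"
  proof (rule nn_integral_mono)
    fix \<tau>
    show "(\<integral>\<^sup>+x. ennreal ((norm (h (\<tau>, x)))\<^sup>2) \<partial>lborel) \<le> ennreal (\<epsilon>\<^sup>2) * indicator {s..t} \<tau>"
    proof (cases "\<tau> \<in> {s..t}")
      case True
      then have "(\<integral>\<^sup>+x. ennreal ((norm (h (\<tau>, x)))\<^sup>2) \<partial>lborel) = ennreal ((L2_norm (\<lambda>x. V \<tau> x - V r x))\<^sup>2)"
        unfolding hx by (subst nn_integral_norm_sq[symmetric]) (auto intro!: L2_diff VL r)
      also have "\<dots> \<le> ennreal (\<epsilon>\<^sup>2)" by (intro ennreal_leI power_mono \<epsilon> True) simp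
      finally show ?thesis using True by simp
    qed (simp add: hx)
  qed
  also have "\<dots> = ennreal (\<epsilon>\<^sup>2) * ennreal (t - s)"
    using st by (simp add: nn_integral_cmult_indicator)
  finally have "ennreal ((L2_norm R)\<^sup>2) \<le> ennreal (\<epsilon>\<^sup>2 * (t - s) * (t - s))"
    using st by (simp add: ennreal_mult mult_right_mono)
  then have "(L2_norm R)\<^sup>2 \<le> \<epsilon>\<^sup>2 * (t - s) * (t - s)" using st by simp
  also have "\<dots> = ((t - s) * \<epsilon>)\<^sup>2" by (simp add: power2_eq_square)
  finally have "L2_norm R \<le> (t - s) * \<epsilon>" by (rule power2_le_imp_le) (use st \<epsilon>0 in simp)
  then show ?thesis by (simp add: R_def[abs_def])
qed

text \<open>
  Outside of \<open>S\<close> nothing is known about the two families, so they are replaced there by their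
  limits.
\<close>

lemma L2_inner_tendsto_within:
  assumes F: "\<And>\<tau>. \<tau> \<in> S \<Longrightarrow> L2 (F \<tau>)" and G: "\<And>\<tau>. \<tau> \<in> S \<Longrightarrow> L2 (G \<tau>)" and fg: "L2 f" "L2 g"
    and lF: "((\<lambda>\<tau>. L2_norm (\<lambda>x. F \<tau> x - f x)) \<longlongrightarrow> 0) (at t within S)"
    and lG: "((\<lambda>\<tau>. L2_norm (\<lambda>x. G \<tau> x - g x)) \<longlongrightarrow> 0) (at t within S)"
  shows "((\<lambda>\<tau>. L2_inner (F \<tau>) (G \<tau>)) \<longlongrightarrow> L2_inner f g) (at t within S)"
proof -
  define F' where "F' \<tau> = (if \<tau> \<in> S then F \<tau> else f)" for \<tau>
  define G' where "G' \<tau> = (if \<tau> \<in> S then G \<tau> else g)" for \<tau>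
  have ev: "\<forall>\<^sub>F \<tau> in at t within S. \<tau> \<in> S" by (simp add: eventually_at_filter)
  have "((\<lambda>\<tau>. L2_inner (F' \<tau>) (G' \<tau>)) \<longlongrightarrow> L2_inner f g) (at t within S)"
  proof (rule L2_inner_tendsto[OF _ _ fg])
    show "L2 (F' \<tau>)" "L2 (G' \<tau>)" for \<tau> using F G fg by (auto simp: F'_def G'_def)
    show "((\<lambda>\<tau>. L2_norm (\<lambda>x. F' \<tau> x - f x)) \<longlongrightarrow> 0) (at t within S)"
      by (rule Lim_transform_eventually[OF lF]) (use ev in \<open>eventually_elim, simp add: F'_def\<close>)
    show "((\<lambda>\<tau>. L2_norm (\<lambda>x. G' \<tau> x - g x)) \<longlongrightarrow> 0) (at t within S)"
      by (rule Lim_transform_eventually[OF lG]) (use ev in \<open>eventually_elim, simp add: G'_def\<close>)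
  qed
  then show ?thesis
    by (rule Lim_transform_eventually) (use ev in \<open>eventually_elim, simp add: F'_def G'_def\<close>)
qed

definition L2_continuous :: "real set \<Rightarrow> (real \<Rightarrow> real^3 \<Rightarrow> real^3) \<Rightarrow> bool" where
  "L2_continuous S F \<longleftrightarrow> (\<forall>t\<in>S. L2 (F t) \<and> ((\<lambda>\<tau>. L2_norm (\<lambda>x. F \<tau> x - F t x)) \<longlongrightarrow> 0) (at t within S))"

lemma L2_continuousD: "L2_continuous S F \<Longrightarrow> t \<in> S \<Longrightarrow> L2 (F t)"
  "L2_continuous S F \<Longrightarrow> t \<in> S \<Longrightarrow> ((\<lambda>\<tau>. L2_norm (\<lambda>x. F \<tau> x - F t x)) \<longlongrightarrow> 0) (at t within S)"
  by (auto simp: L2_continuous_def)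

lemma L2_continuousI:
  assumes L: "\<And>t. t \<in> S \<Longrightarrow> L2 (F t)"
    and b: "\<And>t. t \<in> S \<Longrightarrow> (b t \<longlongrightarrow> 0) (at t within S)"
    and le: "\<And>t \<tau>. t \<in> S \<Longrightarrow> \<tau> \<in> S \<Longrightarrow> L2_norm (\<lambda>x. F \<tau> x - F t x) \<le> b t \<tau>"
  shows "L2_continuous S F"
  unfolding L2_continuous_def
proof (intro ballI conjI L)
  fix t assume t: "t \<in> S"
  have "\<forall>\<^sub>F \<tau> in at t within S. \<tau> \<in> S" by (simp add: eventually_at_filter)
  then have "\<forall>\<^sub>F \<tau> in at t within S. norm (L2_norm (\<lambda>x. F \<tau> x - F t x)) \<le> b t \<tau>"
    by eventually_elim (use le t in simp)
  then show "((\<lambda>\<tau>. L2_norm (\<lambda>x. F \<tau> x - F t x)) \<longlongrightarrow> 0) (at t within S)"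
    by (rule Lim_null_comparison[OF _ b[OF t]])
qed

lemma L2_inner_continuous_on:
  assumes F: "L2_continuous S F" and G: "L2_continuous S G"
  shows "continuous_on S (\<lambda>t. L2_inner (F t) (G t))"
  unfolding continuous_on_def
  by (intro ballI L2_inner_tendsto_within L2_continuousD[OF F] L2_continuousD[OF G])

lemma L2_continuous_scaleR: assumes "L2_continuous S F" shows "L2_continuous S (\<lambda>t x. c *\<^sub>R F t x)"
proof (rule L2_continuousI)
  show "((\<lambda>\<tau>. \<bar>c\<bar> * L2_norm (\<lambda>x. F \<tau> x - F t x)) \<longlongrightarrow> 0) (at t within S)" if "t \<in> S" for t
    using tendsto_mult_right_zero[OF L2_continuousD(2)[OF assms that]] .
qed (use assms in \<open>auto simp: L2_continuous_def L2_norm_scaleR simp flip: scaleR_diff_right intro!: L2_scaleR\<close>)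

lemma L2_continuous_diff:
  assumes F: "L2_continuous S F" and G: "L2_continuous S G"
  shows "L2_continuous S (\<lambda>t x. F t x - G t x)"
proof (rule L2_continuousI)
  fix t assume t: "t \<in> S"
  show "L2 (\<lambda>x. F t x - G t x)" by (intro L2_diff L2_continuousD(1)[OF F t] L2_continuousD(1)[OF G t])
  show "((\<lambda>\<tau>. L2_norm (\<lambda>x. F \<tau> x - F t x) + L2_norm (\<lambda>x. G \<tau> x - G t x)) \<longlongrightarrow> 0) (at t within S)"
    using tendsto_add[OF L2_continuousD(2)[OF F t] L2_continuousD(2)[OF G t]] by simp
  fix \<tau> assume \<tau>: "\<tau> \<in> S"
  have "L2_norm (\<lambda>x. (F \<tau> x - F t x) + (G t x - G \<tau> x)) \<le> L2_norm (\<lambda>x. F \<tau> x - F t x) + L2_norm (\<lambda>x. G t x - G \<tau> x)"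
    by (intro L2_norm_triangle L2_diff L2_continuousD(1)[OF F] L2_continuousD(1)[OF G] t \<tau>)
  then show "L2_norm (\<lambda>x. F \<tau> x - G \<tau> x - (F t x - G t x)) \<le> L2_norm (\<lambda>x. F \<tau> x - F t x) + L2_norm (\<lambda>x. G \<tau> x - G t x)"
    by (simp add: algebra_simps L2_norm_minus_commute[of "G t"])
qed

lemma L2_continuous_leray:
  assumes F: "L2_continuous S F" shows "L2_continuous S (\<lambda>t. leray (F t))"
  by (rule L2_continuousI[OF _ L2_continuousD(2)[OF F]])
    (auto intro: leray_L2 leray_contraction L2_continuousD(1)[OF F])

section \<open>The energy balance along a solution\<close>

locale navier_stokes =
  fixes \<nu> :: real and T :: ereal and u :: "real \<Rightarrow> real^3 \<Rightarrow> real^3"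
  assumes sol: "smooth_NS_solution \<nu> T u (u 0)"
begin

definition times :: "real set" where "times = time_interval T"
definition u_hat :: "real \<Rightarrow> real^3 \<Rightarrow> complex^3" where "u_hat t = fourier (u t)"
text \<open>
  Up to a constant, the \<open>H\<^sup>3\<close> distance of \<open>u \<tau>\<close> and \<open>u t\<close>.
\<close>

definition sobolev_gap :: "real \<Rightarrow> real \<Rightarrow> real" where "sobolev_gap t \<tau> = L2_norm (\<lambda>\<xi>. sobolev_weight \<xi> *\<^sub>R (u_hat \<tau> \<xi> - u_hat t \<xi>))"
definition curl_curl_u :: "real \<Rightarrow> real^3 \<Rightarrow> real^3" where "curl_curl_u t = curl (curl (u t))"
definition nonlinearity :: "real \<Rightarrow> real^3 \<Rightarrow> real^3" where "nonlinearity t = vorticity_cross (u t)"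
text \<open>
  The right-hand side of the equation. It agrees with the classical time derivative up to a null
  set that may depend on \<open>t\<close>.
\<close>

definition time_derivative :: "real \<Rightarrow> real^3 \<Rightarrow> real^3" where
  "time_derivative t x = (- 1) *\<^sub>R leray (nonlinearity t) x - \<nu> *\<^sub>R curl_curl_u t x"

lemma times_interval: assumes "t \<in> times" "0 \<le> s" "s \<le> t" shows "s \<in> times"
  using assms by (auto simp: times_def time_interval_def intro: le_less_trans[of "ereal s" "ereal t"])

lemma times_subset: assumes "s \<in> times" "t \<in> times" shows "{s..t} \<subseteq> times"
proof
  fix \<tau> assume \<tau>: "\<tau> \<in> {s..t}"
  have "0 \<le> s" using assms by (simp add: times_def time_interval_def)
  then show "\<tau> \<in> times" using \<tau> by (intro times_interval[OF assms(2)]) auto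
qed

text \<open>
  The interval has no isolated point, so derivatives within it are unique, also at its left end.
\<close>

lemma at_within_times: assumes "t \<in> times" shows "at t within times \<noteq> bot"
proof -
  have "ereal t < T" using assms by (simp add: times_def time_interval_def)
  then obtain r where r: "ereal t < ereal r" "ereal r < T" by (metis ereal_dense2)
  have "{t..r} \<subseteq> times" using r assms by (intro times_subset) (auto simp: times_def time_interval_def)
  then have "at t within {t..r} \<le> at t within times" by (rule at_le)
  moreover have "at t within {t..r} \<noteq> bot" using r(1) by (simp add: at_within_Icc_at_right)
  ultimately show ?thesis using le_bot by metis
qed

lemma smooth_Ck: "Ck_on (times \<times> UNIV) k (\<lambda>(t, x). u t x)"
  using sol by (auto simp: smooth_NS_solution_def smooth_on_def times_def)

lemma field: assumes t: "t \<in> times" shows "solenoidal_field (u t) (u_hat t)"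
proof
  have "L2 (u t)" using sol t by (auto simp: smooth_NS_solution_def times_def)
  then show F: "is_fourier (u t) (u_hat t)" unfolding u_hat_def by (rule fourier_is)
  have "continuous_in_sobolev 3 T u" using sol by (simp add: smooth_NS_solution_def)
  then have "sobolev 3 (u t)" using t by (simp add: continuous_in_sobolev_def times_def)
  then show "L2 (\<lambda>\<xi>. sobolev_weight \<xi> *\<^sub>R u_hat t \<xi>)" by (rule sobolev_3(1)[OF F])
  show "(\<lambda>y. u t y $ k) differentiable at x" "(\<lambda>y. curl (u t) y $ k) differentiable at x" for k x
    using C2_components_differentiable[OF smooth_Ck t] by auto
  show "divergence (u t) x = 0" for x using sol t by (auto simp: smooth_NS_solution_def times_def)
qed

lemmas fourier_u = solenoidal_field.fourier[OF field]

lemma sobolev_gap_lim: assumes t: "t \<in> times" shows "(sobolev_gap t \<longlongrightarrow> 0) (at t within times)"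
proof -
  have "continuous_in_sobolev 3 T u" using sol by (simp add: smooth_NS_solution_def)
  then have "((\<lambda>\<tau>. sobolev_norm 3 (\<lambda>x. u \<tau> x - u t x)) \<longlongrightarrow> 0) (at t within times)"
    using t by (simp add: continuous_in_sobolev_def times_def)
  from tendsto_mult_right_zero[OF this, of plancherel_const]
  show ?thesis
  proof (rule Lim_transform_eventually)
    have "\<forall>\<^sub>F \<tau> in at t within times. \<tau> \<in> times" by (simp add: eventually_at_filter)
    then show "\<forall>\<^sub>F \<tau> in at t within times. plancherel_const * sobolev_norm 3 (\<lambda>x. u \<tau> x - u t x) = sobolev_gap t \<tau>"
    proof eventually_elim
      case (elim \<tau>)
      show ?case unfolding sobolev_3(2)[OF is_fourier_diff[OF fourier_u[OF elim] fourier_u[OF t]]] sobolev_gap_def by simp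
    qed
  qed
qed

text \<open>
  A multiplier of order at most 3 maps the continuous curve \<open>u\<close> in \<open>H\<^sup>3\<close> to a continuous curve
  in \<open>L\<^sup>2\<close>.
\<close>

lemma L2_continuous_symbol:
  assumes F: "\<And>t. t \<in> times \<Longrightarrow> is_fourier (F t) (\<lambda>\<xi>. m \<xi> (u_hat t \<xi>))"
    and m: "\<And>\<xi> v w. m \<xi> (v - w) = m \<xi> v - m \<xi> w" and le: "\<And>\<xi> v. norm (m \<xi> v) \<le> sobolev_weight \<xi> * norm v"
  shows "L2_continuous times F"
proof (rule L2_continuousI)
  fix t assume t: "t \<in> times"
  show "L2 (F t)" by (rule is_fourier_L2[OF F[OF t]])
  show "((\<lambda>\<tau>. sobolev_gap t \<tau> / plancherel_const) \<longlongrightarrow> 0) (at t within times)"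
    using tendsto_mult_left_zero[OF sobolev_gap_lim[OF t], of "1 / plancherel_const"] by simp
  fix \<tau> assume \<tau>: "\<tau> \<in> times"
  have d: "is_fourier (\<lambda>x. F \<tau> x - F t x) (\<lambda>\<xi>. m \<xi> (u_hat \<tau> \<xi> - u_hat t \<xi>))"
    unfolding m by (rule is_fourier_diff[OF F[OF \<tau>] F[OF t]])
  have W: "L2 (\<lambda>\<xi>. sobolev_weight \<xi> *\<^sub>R (u_hat \<tau> \<xi> - u_hat t \<xi>))"
    unfolding scaleR_diff_right by (intro L2_diff solenoidal_field.weight[OF field] t \<tau>)
  have "L2_norm (\<lambda>\<xi>. m \<xi> (u_hat \<tau> \<xi> - u_hat t \<xi>)) \<le> sobolev_gap t \<tau>"
    unfolding sobolev_gap_def by (rule L2_sobolev_weight_mono(2)[OF W L2_measurable[OF is_fourier_L2(2)[OF d]] le])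
  then show "L2_norm (\<lambda>x. F \<tau> x - F t x) \<le> sobolev_gap t \<tau> / plancherel_const"
    unfolding Plancherel_norm[OF d] by (intro divide_right_mono) auto
qed

lemma u_continuous: "L2_continuous times u"
proof (rule L2_continuous_symbol[of _ "\<lambda>\<xi> v. v"])
  show "norm v \<le> sobolev_weight \<xi> * norm v" for \<xi> and v :: "complex^3"
    using mult_right_mono[OF sobolev_weight_ge_1[of \<xi>] norm_ge_zero[of v]] by simp
qed (use fourier_u in auto)

lemma curl_continuous: "L2_continuous times (\<lambda>t. curl (u t))"
proof (rule L2_continuous_symbol[of _ curl_symbol])
  show "norm (curl_symbol \<xi> v) \<le> sobolev_weight \<xi> * norm v" for \<xi> v
    using norm_curl_symbol_le[of \<xi> v] mult_right_mono[OF norm_le_sobolev_weight(1)[of \<xi>] norm_ge_zero[of v]] by linarith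
qed (auto simp: curl_symbol_diff intro: solenoidal_field.is_fourier_curl_f[OF field])

lemma curl_curl_u_continuous: "L2_continuous times curl_curl_u"
proof (rule L2_continuous_symbol[of _ "\<lambda>\<xi> v. curl_symbol \<xi> (curl_symbol \<xi> v)"])
  show "norm (curl_symbol \<xi> (curl_symbol \<xi> v)) \<le> sobolev_weight \<xi> * norm v" for \<xi> v
    using norm_curl_symbol_twice_le[of \<xi> v] mult_right_mono[OF norm_le_sobolev_weight(2)[of \<xi>] norm_ge_zero[of v]] by linarith
qed (auto simp: curl_symbol_diff curl_curl_u_def intro: solenoidal_field.is_fourier_curl_curl_f[OF field])

lemma C_sign_one_continuous: assumes "\<bar>\<sigma>\<bar> = 1" shows "L2_continuous times (\<lambda>t. C_sign_one \<sigma> (u t))"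
proof (rule L2_continuous_symbol[of _ "\<lambda>\<xi> v. (1/2) *\<^sub>R ((norm \<xi> powr 1) *\<^sub>R v + \<sigma> *\<^sub>R curl_symbol \<xi> v)"])
  fix \<xi> and v w :: "complex^3"
  have "norm ((norm \<xi> powr 1) *\<^sub>R v + \<sigma> *\<^sub>R curl_symbol \<xi> v) \<le> norm \<xi> * norm v + norm \<xi> * norm v"
    using assms norm_curl_symbol_le[of \<xi> v] by (intro norm_triangle_le add_mono) auto
  also have "\<dots> \<le> 2 * (sobolev_weight \<xi> * norm v)"
    using mult_right_mono[OF norm_le_sobolev_weight(1)[of \<xi>] norm_ge_zero[of v]] by simp
  finally show "norm ((1/2) *\<^sub>R ((norm \<xi> powr 1) *\<^sub>R v + \<sigma> *\<^sub>R curl_symbol \<xi> v)) \<le> sobolev_weight \<xi> * norm v" by simp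
  show "(1/2) *\<^sub>R ((norm \<xi> powr 1) *\<^sub>R (v - w) + \<sigma> *\<^sub>R curl_symbol \<xi> (v - w))
     = (1/2) *\<^sub>R ((norm \<xi> powr 1) *\<^sub>R v + \<sigma> *\<^sub>R curl_symbol \<xi> v)
      - (1/2) *\<^sub>R ((norm \<xi> powr 1) *\<^sub>R w + \<sigma> *\<^sub>R curl_symbol \<xi> w)"
    unfolding curl_symbol_diff scaleR_diff_right scaleR_add_right by simp
qed (rule solenoidal_field.is_fourier_C_sign_one[OF field])

text \<open>
  Split the difference of the two products, and estimate the factors without derivative in the
  supremum norm, by means of the \<open>H\<^sup>3\<close> bound.
\<close>

lemma nonlinearity_continuous: "L2_continuous times nonlinearity"
proof (rule L2_continuousI)
  fix t assume t: "t \<in> times"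
  interpret t: solenoidal_field "u t" "u_hat t" by (rule field[OF t])
  show "L2 (nonlinearity t)" unfolding nonlinearity_def by (rule t.vorticity_cross_L2)
  define M where "M = 3 * (sup_const * L2_norm (\<lambda>\<xi>. sobolev_weight \<xi> *\<^sub>R u_hat t \<xi>))"
  define b where "b \<tau> = \<bar>M\<bar> * L2_norm (\<lambda>x. curl (u \<tau>) x - curl (u t) x)
      + \<bar>3 * (sup_const * sobolev_gap t \<tau>)\<bar> * (L2_norm (curl (u t)) + L2_norm (\<lambda>x. curl (u \<tau>) x - curl (u t) x))" for \<tau>
  note c = L2_continuousD[OF curl_continuous]
  have "(b \<longlongrightarrow> \<bar>M\<bar> * 0 + \<bar>3 * (sup_const * 0)\<bar> * (L2_norm (curl (u t)) + 0)) (at t within times)"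
    unfolding b_def by (intro tendsto_intros c(2)[OF t] sobolev_gap_lim[OF t])
  then show "(b \<longlongrightarrow> 0) (at t within times)" by simp
  fix \<tau> assume \<tau>: "\<tau> \<in> times"
  interpret \<tau>: solenoidal_field "u \<tau>" "u_hat \<tau>" by (rule field[OF \<tau>])
  let ?A = "\<lambda>x. cross3 (curl (u \<tau>) x - curl (u t) x) (u t x)" and ?B = "\<lambda>x. cross3 (curl (u \<tau>) x) (u \<tau> x - u t x)"
  have W: "L2 (\<lambda>\<xi>. sobolev_weight \<xi> *\<^sub>R (u_hat \<tau> \<xi> - u_hat t \<xi>))"
    unfolding scaleR_diff_right by (intro L2_diff t.weight \<tau>.weight)
  have dm: "(\<lambda>x. u \<tau> x - u t x) \<in> borel_measurable borel" by (rule L2_measurable[OF L2_diff[OF \<tau>.L2f t.L2f]])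
  note A = L2_cross3[OF L2_diff[OF c(1)[OF \<tau>] c(1)[OF t]] L2_measurable[OF t.L2f] t.sup_bound[folded M_def]]
  note B = L2_cross3[OF c(1)[OF \<tau>] dm sobolev_sup_bound[OF is_fourier_diff[OF \<tau>.fourier t.fourier] W, folded sobolev_gap_def]]
  have "nonlinearity \<tau> x - nonlinearity t x = ?A x + ?B x" for x
    by (simp add: nonlinearity_def vorticity_cross_def Cross3.left_diff_distrib Cross3.right_diff_distrib)
  then have "L2_norm (\<lambda>x. nonlinearity \<tau> x - nonlinearity t x) \<le> L2_norm ?A + L2_norm ?B"
    using L2_norm_triangle[OF A(1) B(1)] by simp
  also have "\<dots> \<le> b \<tau>"
    unfolding b_def
    by (intro add_mono A(2) order_trans[OF B(2)] mult_left_mono L2_norm_le_add_diff[OF c(1)[OF \<tau>] c(1)[OF t]]) simp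
  finally show "L2_norm (\<lambda>x. nonlinearity \<tau> x - nonlinearity t x) \<le> b \<tau>" .
qed

lemma time_derivative_continuous: "L2_continuous times time_derivative"
  unfolding time_derivative_def[abs_def]
  by (intro L2_continuous_diff L2_continuous_scaleR L2_continuous_leray nonlinearity_continuous curl_curl_u_continuous)

text \<open>
  The pointwise time derivative is continuous as a curve in \<open>L\<^sup>2\<close>, because the other terms of
  the equation are; by the mean value inequality \<open>u\<close> is then differentiable in \<open>L\<^sup>2\<close>.
\<close>

lemma L2_time_derivative:
  assumes t: "t \<in> times"
  shows "((\<lambda>\<tau>. L2_norm (\<lambda>x. (1 / (\<tau> - t)) *\<^sub>R (u \<tau> x - u t x) - time_derivative t x)) \<longlongrightarrow> 0) (at t within times)"
proof -
  obtain V where cV: "continuous_on (times \<times> UNIV) (\<lambda>(t, x). V t x)"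
    and dV: "\<And>t x. t \<in> times \<Longrightarrow> ((\<lambda>\<tau>. u \<tau> x) has_vector_derivative V t x) (at t within times)"
    using C1_on_time_derivative[OF smooth_Ck] by blast
  \<comment> \<open>The exceptional null set depends on \<open>s\<close>, which is harmless: only \<open>L\<^sup>2\<close> norms at fixed times are compared.\<close>
  have VG: "AE x in lborel. V s x = time_derivative s x" if s: "s \<in> times" for s
  proof -
    have "AE x in lborel. vector_derivative (\<lambda>\<tau>. u \<tau> x) (at s within times)
        + leray (\<lambda>y. cross3 (curl (u s) y) (u s y)) x + \<nu> *\<^sub>R curl (curl (u s)) x = 0"
      using sol s by (auto simp: smooth_NS_solution_def times_def)
    then show ?thesis
    proof eventually_elim
      case (elim x)
      have "vector_derivative (\<lambda>\<tau>. u \<tau> x) (at s within times) = V s x"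
        by (rule vector_derivative_within[OF at_within_times[OF s] dV[OF s]])
      moreover have "(\<lambda>y. cross3 (curl (u s) y) (u s y)) = nonlinearity s" by (simp add: nonlinearity_def vorticity_cross_def fun_eq_iff)
      ultimately have "V s x + (leray (nonlinearity s) x + \<nu> *\<^sub>R curl_curl_u s x) = 0" using elim by (simp add: curl_curl_u_def add.assoc)
      then have "V s x = - (leray (nonlinearity s) x + \<nu> *\<^sub>R curl_curl_u s x)" by (rule eq_neg_iff_add_eq_0[THEN iffD2])
      then show ?case by (simp add: time_derivative_def)
    qed
  qed
  have GL: "L2 (time_derivative s)" if "s \<in> times" for s by (rule L2_continuousD(1)[OF time_derivative_continuous that])
  have Vm: "V s \<in> borel_measurable borel" if s: "s \<in> times" for s
  proof -
    have "continuous_on UNIV (V s)"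
      using s by (intro continuous_on_compose2[OF cV, of _ "\<lambda>x. (s, x)", simplified] continuous_intros) auto
    then show ?thesis by (rule borel_measurable_continuous_onI)
  qed
  have VL: "L2 (V s)" if s: "s \<in> times" for s
    by (rule L2_cong_AE[OF GL[OF s] _ Vm[OF s]]) (use VG[OF s] in \<open>eventually_elim, simp\<close>)
  have uL: "L2 (u s)" if "s \<in> times" for s by (rule L2_continuousD(1)[OF u_continuous that])
  have bound: "L2_norm (\<lambda>x. u b x - u a x - (b - a) *\<^sub>R V t x) \<le> (b - a) * \<epsilon>"
    if ab: "a \<in> times" "b \<in> times" "a \<le> b" "t \<in> {a..b}" and \<epsilon>: "\<And>\<tau>. \<tau> \<in> {a..b} \<Longrightarrow> L2_norm (\<lambda>x. time_derivative \<tau> x - time_derivative t x) \<le> \<epsilon>" for a b \<epsilon>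
  proof (rule L2_difference_bound[OF ab(3,4)])
    note sub = times_subset[OF ab(1,2)]
    show "continuous_on ({a..b} \<times> UNIV) (\<lambda>(\<tau>, x). V \<tau> x)" by (rule continuous_on_subset[OF cV]) (use sub in auto)
    show "((\<lambda>\<tau>. u \<tau> x) has_vector_derivative V \<tau> x) (at \<tau> within {a..b})" if "\<tau> \<in> {a..b}" for \<tau> x
      by (rule has_vector_derivative_within_subset[OF dV sub]) (use sub that in auto)
    show "L2 (u a)" "L2 (u b)" using uL ab by auto
    show "L2 (V \<tau>)" if "\<tau> \<in> {a..b}" for \<tau> using VL sub that by auto
    show "L2_norm (\<lambda>x. V \<tau> x - V t x) \<le> \<epsilon>" if \<tau>: "\<tau> \<in> {a..b}" for \<tau>
    proof -
      have \<tau>times: "\<tau> \<in> times" using \<tau> sub by auto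
      have "AE x in lborel. V \<tau> x - V t x = time_derivative \<tau> x - time_derivative t x" using VG[OF \<tau>times] VG[OF t] by eventually_elim simp
      then have "L2_norm (\<lambda>x. V \<tau> x - V t x) = L2_norm (\<lambda>x. time_derivative \<tau> x - time_derivative t x)"
        by (rule L2_norm_cong_AE) (intro L2_measurable[OF L2_diff[OF VL VL]] L2_measurable[OF L2_diff[OF GL GL]] \<tau>times t)+
      then show ?thesis using \<epsilon>[OF \<tau>] by simp
    qed
  qed
  show ?thesis
  proof (rule tendstoI)
    fix e :: real assume e: "0 < e"
    have "\<forall>\<^sub>F \<tau> in at t within times. L2_norm (\<lambda>x. time_derivative \<tau> x - time_derivative t x) < e / 2"
      using order_tendstoD(2)[OF L2_continuousD(2)[OF time_derivative_continuous t], of "e / 2"] e by simp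
    then obtain d where d: "0 < d" "\<And>\<tau>. \<tau> \<in> times \<Longrightarrow> \<tau> \<noteq> t \<Longrightarrow> dist \<tau> t < d \<Longrightarrow> L2_norm (\<lambda>x. time_derivative \<tau> x - time_derivative t x) < e / 2"
      unfolding eventually_at by blast
    have dd: "L2_norm (\<lambda>x. time_derivative \<tau> x - time_derivative t x) \<le> e / 2" if "\<tau> \<in> times" "dist \<tau> t < d" for \<tau>
      using d(2)[OF that(1) _ that(2)] e by (cases "\<tau> = t") (auto simp: L2_norm_def)
    have "dist (L2_norm (\<lambda>x. (1 / (\<tau> - t)) *\<^sub>R (u \<tau> x - u t x) - time_derivative t x)) 0 < e"
      if \<tau>: "\<tau> \<in> times" "\<tau> \<noteq> t" "dist \<tau> t < d" for \<tau>
    proof -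
      define c where "c = \<tau> - t"
      have c0: "c \<noteq> 0" using \<tau> by (simp add: c_def)
      have le: "L2_norm (\<lambda>x. u \<tau> x - u t x - c *\<^sub>R V t x) \<le> \<bar>c\<bar> * (e / 2)"
      proof (cases "t \<le> \<tau>")
        case True
        have "L2_norm (\<lambda>x. u \<tau> x - u t x - (\<tau> - t) *\<^sub>R V t x) \<le> (\<tau> - t) * (e / 2)"
        proof (rule bound[OF t \<tau>(1) True])
          fix \<tau>' assume "\<tau>' \<in> {t..\<tau>}"
          then show "L2_norm (\<lambda>x. time_derivative \<tau>' x - time_derivative t x) \<le> e / 2"
            using times_subset[OF t \<tau>(1)] \<tau>(3) by (intro dd) (auto simp: dist_real_def)
        qed (use True in auto)
        then show ?thesis using True by (simp add: c_def)
      next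
        case False
        have "L2_norm (\<lambda>x. u t x - u \<tau> x - (t - \<tau>) *\<^sub>R V t x) \<le> (t - \<tau>) * (e / 2)"
        proof (rule bound[OF \<tau>(1) t])
          fix \<tau>' assume "\<tau>' \<in> {\<tau>..t}"
          then show "L2_norm (\<lambda>x. time_derivative \<tau>' x - time_derivative t x) \<le> e / 2"
            using times_subset[OF \<tau>(1) t] \<tau>(3) by (intro dd) (auto simp: dist_real_def)
        qed (use False in auto)
        moreover have "(\<lambda>x. u t x - u \<tau> x - (t - \<tau>) *\<^sub>R V t x) = (\<lambda>x. (-1) *\<^sub>R (u \<tau> x - u t x - c *\<^sub>R V t x))"
          by (rule ext) (simp add: c_def algebra_simps)
        ultimately have "\<bar>- 1\<bar> * L2_norm (\<lambda>x. u \<tau> x - u t x - c *\<^sub>R V t x) \<le> (t - \<tau>) * (e / 2)"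
          unfolding L2_norm_scaleR[symmetric] by (simp only:)
        then show ?thesis using False by (simp add: c_def)
      qed
      have "L2_norm (\<lambda>x. (1 / c) *\<^sub>R (u \<tau> x - u t x) - time_derivative t x) = L2_norm (\<lambda>x. (1 / c) *\<^sub>R (u \<tau> x - u t x - c *\<^sub>R V t x))"
      proof (rule L2_norm_cong_AE)
        show "AE x in lborel. (1 / c) *\<^sub>R (u \<tau> x - u t x) - time_derivative t x = (1 / c) *\<^sub>R (u \<tau> x - u t x - c *\<^sub>R V t x)"
          using VG[OF t] by eventually_elim (simp add: scaleR_diff_right c0)
        show "(\<lambda>x. (1 / c) *\<^sub>R (u \<tau> x - u t x) - time_derivative t x) \<in> borel_measurable borel"
          by (intro L2_measurable L2_diff L2_scaleR uL GL t \<tau>)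
        show "(\<lambda>x. (1 / c) *\<^sub>R (u \<tau> x - u t x - c *\<^sub>R V t x)) \<in> borel_measurable borel"
          by (intro L2_measurable L2_diff L2_scaleR uL VL t \<tau>)
      qed
      also have "\<dots> \<le> (1 / \<bar>c\<bar>) * (\<bar>c\<bar> * (e / 2))"
        unfolding L2_norm_scaleR using mult_left_mono[OF le, of "1 / \<bar>c\<bar>"] by simp
      also have "\<dots> < e" using c0 e by simp
      finally show ?thesis by (simp add: c_def)
    qed
    then show "\<forall>\<^sub>F \<tau> in at t within times. dist (L2_norm (\<lambda>x. (1 / (\<tau> - t)) *\<^sub>R (u \<tau> x - u t x) - time_derivative t x)) 0 < e"
      unfolding eventually_at using d(1) by blast
  qed
qed

definition helical_energy :: "real \<Rightarrow> real \<Rightarrow> real" where "helical_energy \<sigma> t = L2_inner (u t) (C_sign_one \<sigma> (u t))"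

text \<open>
  \<open>|D|\<close> and \<open>curl\<close> are symmetric.
\<close>

lemma C_sign_one_symmetric:
  assumes "s \<in> times" "t \<in> times"
  shows "L2_inner (u s) (C_sign_one \<sigma> (u t)) = L2_inner (u t) (C_sign_one \<sigma> (u s))"
proof -
  interpret s: solenoidal_field "u s" "u_hat s" by (rule field[OF assms(1)])
  interpret t: solenoidal_field "u t" "u_hat t" by (rule field[OF assms(2)])
  have "u_hat s \<xi> \<bullet> ((1/2) *\<^sub>R ((norm \<xi> powr 1) *\<^sub>R u_hat t \<xi> + \<sigma> *\<^sub>R curl_symbol \<xi> (u_hat t \<xi>)))
      = u_hat t \<xi> \<bullet> ((1/2) *\<^sub>R ((norm \<xi> powr 1) *\<^sub>R u_hat s \<xi> + \<sigma> *\<^sub>R curl_symbol \<xi> (u_hat s \<xi>)))" for \<xi>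
  proof -
    have "u_hat s \<xi> \<bullet> curl_symbol \<xi> (u_hat t \<xi>) = u_hat t \<xi> \<bullet> curl_symbol \<xi> (u_hat s \<xi>)"
      using inner_curl_symbol[of \<xi> "u_hat s \<xi>" "u_hat t \<xi>"] by (simp add: inner_commute)
    then show ?thesis by (simp add: inner_add_right inner_commute[of "u_hat s \<xi>" "u_hat t \<xi>"])
  qed
  then show ?thesis
    unfolding Parseval[OF s.fourier t.is_fourier_C_sign_one] Parseval[OF t.fourier s.is_fourier_C_sign_one]
    by (simp only: L2_inner_def)
qed

text \<open>
  With \<open>w\<close> short for \<open>C_sign_one\<close>, symmetry gives \<open>E \<tau> - E t = \<langle>u \<tau> - u t, w \<tau> + w t\<rangle>\<close>. Hence it
  suffices that \<open>u\<close> is differentiable and \<open>w\<close> continuous in \<open>L\<^sup>2\<close>.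
\<close>

lemma helical_energy_derivative:
  assumes \<sigma>: "\<bar>\<sigma>\<bar> = 1" and t: "t \<in> times"
  shows "(helical_energy \<sigma> has_real_derivative 2 * L2_inner (time_derivative t) (C_sign_one \<sigma> (u t))) (at t within times)"
proof -
  note u = L2_continuousD[OF u_continuous] and w = L2_continuousD[OF C_sign_one_continuous[OF \<sigma>]]
  let ?w = "\<lambda>\<tau>. C_sign_one \<sigma> (u \<tau>)"
  have GL: "L2 (time_derivative t)" by (rule L2_continuousD(1)[OF time_derivative_continuous t])
  have lim: "((\<lambda>\<tau>. L2_inner (\<lambda>x. (1 / (\<tau> - t)) *\<^sub>R (u \<tau> x - u t x)) (\<lambda>x. ?w \<tau> x + ?w t x))
      \<longlongrightarrow> L2_inner (time_derivative t) (\<lambda>x. ?w t x + ?w t x)) (at t within times)"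
  proof (rule L2_inner_tendsto_within)
    show "((\<lambda>\<tau>. L2_norm (\<lambda>x. (1 / (\<tau> - t)) *\<^sub>R (u \<tau> x - u t x) - time_derivative t x)) \<longlongrightarrow> 0) (at t within times)"
      by (rule L2_time_derivative[OF t])
    show "((\<lambda>\<tau>. L2_norm (\<lambda>x. ?w \<tau> x + ?w t x - (?w t x + ?w t x))) \<longlongrightarrow> 0) (at t within times)"
      using w(2)[OF t] by simp
    show "L2 (\<lambda>x. ?w t x + ?w t x)" by (intro L2_add w t)
  qed (auto intro!: L2_scaleR L2_diff L2_add u w t GL)
  have val: "L2_inner (time_derivative t) (\<lambda>x. ?w t x + ?w t x) = 2 * L2_inner (time_derivative t) (?w t)"
    unfolding L2_inner_add_right[OF w(1)[OF t] w(1)[OF t] GL] by simp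
  have ev: "\<forall>\<^sub>F \<tau> in at t within times. L2_inner (\<lambda>x. (1 / (\<tau> - t)) *\<^sub>R (u \<tau> x - u t x)) (\<lambda>x. ?w \<tau> x + ?w t x) = (helical_energy \<sigma> \<tau> - helical_energy \<sigma> t) / (\<tau> - t)"
  proof -
    have "\<forall>\<^sub>F \<tau> in at t within times. \<tau> \<in> times" by (simp add: eventually_at_filter)
    then show ?thesis
    proof eventually_elim
      case (elim \<tau>)
      show ?case
        unfolding L2_inner_scaleR_left using C_sign_one_symmetric[OF elim t, of \<sigma>]
        by (simp add: L2_inner_diff_left L2_inner_add_right L2_diff L2_add u w t elim helical_energy_def)
    qed
  qed
  show ?thesis
    unfolding has_field_derivative_iff by (rule Lim_transform_eventually[OF lim[unfolded val] ev])
qed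

definition det_integral :: "real \<Rightarrow> real" where
  "det_integral t = (LINT x|lborel. det3 (curl (u t) x) (u t x) (abs_D_powr 1 (u t) x))"

definition helical_dissipation :: "real \<Rightarrow> real \<Rightarrow> real" where "helical_dissipation \<sigma> t = L2_inner (curl_curl_u t) (C_sign_one \<sigma> (u t))"

lemma det_integral_eq: "t \<in> times \<Longrightarrow> det_integral t = 2 * L2_inner (nonlinearity t) (C_sign_one \<sigma> (u t))"
  unfolding det_integral_def nonlinearity_def by (rule solenoidal_field.vorticity_cross_C_sign_one[OF field, symmetric])

text \<open>
  The Leray projection disappears, because it is symmetric and \<open>C_sign_one\<close> is divergence-free.
\<close>

lemma helical_energy_derivative_eq:
  assumes \<sigma>: "\<bar>\<sigma>\<bar> = 1" and t: "t \<in> times"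
  shows "2 * L2_inner (time_derivative t) (C_sign_one \<sigma> (u t)) = - det_integral t - 2 * \<nu> * helical_dissipation \<sigma> t"
proof -
  have NL: "L2 (nonlinearity t)" and CL: "L2 (curl_curl_u t)" and wL: "L2 (C_sign_one \<sigma> (u t))"
    using L2_continuousD(1)[OF nonlinearity_continuous t] L2_continuousD(1)[OF curl_curl_u_continuous t]
      L2_continuousD(1)[OF C_sign_one_continuous[OF \<sigma>] t] by auto
  have "L2_inner (leray (nonlinearity t)) (C_sign_one \<sigma> (u t)) = L2_inner (nonlinearity t) (C_sign_one \<sigma> (u t))"
    by (rule leray_inner[OF NL solenoidal_field.C_sign_one_div_free[OF field[OF t]]])
  then show ?thesis
    unfolding time_derivative_def[abs_def] det_integral_eq[OF t, of \<sigma>] helical_dissipation_def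
      L2_inner_diff_left[OF L2_scaleR[OF leray_L2[OF NL]] L2_scaleR[OF CL] wL] L2_inner_scaleR_left
    by simp
qed

lemma det_integral_continuous: "continuous_on times det_integral"
proof -
  have "continuous_on times (\<lambda>t. 2 * L2_inner (nonlinearity t) (C_sign_one 1 (u t)))"
    by (intro continuous_intros L2_inner_continuous_on nonlinearity_continuous C_sign_one_continuous) simp
  then show ?thesis by (simp add: det_integral_eq[of _ 1] cong: continuous_on_cong)
qed

lemma helical_dissipation_continuous: "\<bar>\<sigma>\<bar> = 1 \<Longrightarrow> continuous_on times (helical_dissipation \<sigma>)"
  unfolding helical_dissipation_def[abs_def] by (intro L2_inner_continuous_on curl_curl_u_continuous C_sign_one_continuous)

lemma energy_identity:
  assumes \<sigma>: "\<bar>\<sigma>\<bar> = 1" and t: "t \<in> times"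
  shows "helical_energy \<sigma> t + 2 * \<nu> * (LINT \<tau>:{0..t}|lborel. helical_dissipation \<sigma> \<tau>) + (LINT \<tau>:{0..t}|lborel. det_integral \<tau>) = helical_energy \<sigma> 0"
proof -
  have t0: "0 \<le> t" using t by (simp add: times_def time_interval_def)
  have sub: "{0..t} \<subseteq> times" using times_interval[OF t] by auto
  have cD: "continuous_on {0..t} det_integral" and cK: "continuous_on {0..t} (helical_dissipation \<sigma>)"
    using continuous_on_subset[OF det_integral_continuous sub] continuous_on_subset[OF helical_dissipation_continuous[OF \<sigma>] sub] by auto
  have iD: "set_integrable lborel {0..t} det_integral" and iK: "set_integrable lborel {0..t} (helical_dissipation \<sigma>)"
    using borel_integrable_atLeastAtMost'[OF cD] borel_integrable_atLeastAtMost'[OF cK] by auto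
  have "(LINT \<tau>|lborel. indicator {0..t} \<tau> *\<^sub>R (- det_integral \<tau> - 2 * \<nu> * helical_dissipation \<sigma> \<tau>)) = helical_energy \<sigma> t - helical_energy \<sigma> 0"
  proof (rule integral_FTC_atLeastAtMost[OF t0])
    fix x assume x: "0 \<le> x" "x \<le> t"
    then have xI: "x \<in> times" using sub by auto
    have "(helical_energy \<sigma> has_real_derivative (- det_integral x - 2 * \<nu> * helical_dissipation \<sigma> x)) (at x within times)"
      using helical_energy_derivative[OF \<sigma> xI] unfolding helical_energy_derivative_eq[OF \<sigma> xI] .
    then show "(helical_energy \<sigma> has_vector_derivative (- det_integral x - 2 * \<nu> * helical_dissipation \<sigma> x)) (at x within {0..t})"
      using sub by (metis has_real_derivative_iff_has_vector_derivative has_vector_derivative_within_subset)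
  next
    show "continuous_on {0..t} (\<lambda>x. - det_integral x - 2 * \<nu> * helical_dissipation \<sigma> x)" by (intro continuous_intros cD cK)
  qed
  also have "(LINT \<tau>|lborel. indicator {0..t} \<tau> *\<^sub>R (- det_integral \<tau> - 2 * \<nu> * helical_dissipation \<sigma> \<tau>))
      = (LINT \<tau>|lborel. (- 1) * (indicator {0..t} \<tau> *\<^sub>R det_integral \<tau>) - 2 * \<nu> * (indicator {0..t} \<tau> *\<^sub>R helical_dissipation \<sigma> \<tau>))"
    by (intro Bochner_Integration.integral_cong refl) (simp add: algebra_simps)
  also have "\<dots> = - (LINT \<tau>:{0..t}|lborel. det_integral \<tau>) - 2 * \<nu> * (LINT \<tau>:{0..t}|lborel. helical_dissipation \<sigma> \<tau>)"
    unfolding set_lebesgue_integral_def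
    by (subst Bochner_Integration.integral_diff)
      (use iD iK in \<open>auto simp: set_integrable_def\<close>)
  finally show ?thesis by simp
qed

end

theorem proposition25:
  fixes \<nu> :: real and T :: ereal
    and u :: "real \<Rightarrow> real^3 \<Rightarrow> real^3" and u0 :: "real^3 \<Rightarrow> real^3"
  assumes "0 < \<nu>"
    and "smooth_NS_solution \<nu> T u u0"
  shows "(\<forall>t\<in>time_interval T. \<forall>\<sigma>\<in>{1, -1}.
            (L2_norm (C_sign \<sigma> (1/2) (u t)))\<^sup>2
            + 2 * \<nu> * (LINT \<tau>:{0..t}|lborel. (L2_norm (C_sign \<sigma> (3/2) (u \<tau>)))\<^sup>2)
            + (LINT \<tau>:{0..t}|lborel. LINT x|lborel.
                 det3 (curl (u \<tau>) x) (u \<tau> x) (abs_D_powr 1 (u \<tau>) x))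
            = (L2_norm (C_sign \<sigma> (1/2) u0))\<^sup>2)
       \<and> (\<forall>t\<in>time_interval T.
            (hom_sobolev_norm (1/2) (u t))\<^sup>2
            + 2 * \<nu> * (LINT \<tau>:{0..t}|lborel. (hom_sobolev_norm (3/2) (u \<tau>))\<^sup>2)
            + 2 * (LINT \<tau>:{0..t}|lborel. LINT x|lborel.
                 det3 (curl (u \<tau>) x) (u \<tau> x) (abs_D_powr 1 (u \<tau>) x))
            = (hom_sobolev_norm (1/2) u0)\<^sup>2)"
proof -
  have u0: "u0 = u 0" using assms(2) by (simp add: smooth_NS_solution_def)
  interpret navier_stokes \<nu> T u by unfold_locales (use assms(2) u0 in simp)
  have sub: "{0..t} \<subseteq> times" if "t \<in> times" for t using times_interval[OF that] by auto
  have zero: "0 \<in> times" if "t \<in> times" for t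
    using times_interval[OF that, of 0] that by (simp add: times_def time_interval_def)
  have EK: "(L2_norm (C_sign \<sigma> (1/2) (u t)))\<^sup>2 = helical_energy \<sigma> t" "(L2_norm (C_sign \<sigma> (3/2) (u t)))\<^sup>2 = helical_dissipation \<sigma> t"
    if "\<bar>\<sigma>\<bar> = 1" "t \<in> times" for \<sigma> t
    using solenoidal_field.C_sign_norm_sq[OF field[OF that(2)] that(1)] by (simp_all add: helical_energy_def helical_dissipation_def curl_curl_u_def)
  have hom: "(hom_sobolev_norm (1/2) (u t))\<^sup>2 = helical_energy 1 t + helical_energy (-1) t" "(hom_sobolev_norm (3/2) (u t))\<^sup>2 = helical_dissipation 1 t + helical_dissipation (-1) t"
    if "t \<in> times" for t
    using solenoidal_field.hom_sobolev_split[OF field[OF that]] EK that by simp_all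
  have A: "helical_energy \<sigma> t + 2 * \<nu> * (LINT \<tau>:{0..t}|lborel. (L2_norm (C_sign \<sigma> (3/2) (u \<tau>)))\<^sup>2)
      + (LINT \<tau>:{0..t}|lborel. det_integral \<tau>) = helical_energy \<sigma> 0" if "\<bar>\<sigma>\<bar> = 1" "t \<in> times" for \<sigma> t
  proof -
    have "(LINT \<tau>:{0..t}|lborel. (L2_norm (C_sign \<sigma> (3/2) (u \<tau>)))\<^sup>2) = (LINT \<tau>:{0..t}|lborel. helical_dissipation \<sigma> \<tau>)"
      using sub[OF that(2)] EK(2)[OF that(1)] by (intro set_lebesgue_integral_cong) auto
    then show ?thesis using energy_identity[OF that] by simp
  qed
  have B: "(LINT \<tau>:{0..t}|lborel. (hom_sobolev_norm (3/2) (u \<tau>))\<^sup>2)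
      = (LINT \<tau>:{0..t}|lborel. helical_dissipation 1 \<tau>) + (LINT \<tau>:{0..t}|lborel. helical_dissipation (-1) \<tau>)" if t: "t \<in> times" for t
  proof -
    have "(LINT \<tau>:{0..t}|lborel. (hom_sobolev_norm (3/2) (u \<tau>))\<^sup>2) = (LINT \<tau>:{0..t}|lborel. helical_dissipation 1 \<tau> + helical_dissipation (-1) \<tau>)"
      using sub[OF t] hom(2) by (intro set_lebesgue_integral_cong) auto
    also have "\<dots> = (LINT \<tau>:{0..t}|lborel. helical_dissipation 1 \<tau>) + (LINT \<tau>:{0..t}|lborel. helical_dissipation (-1) \<tau>)"
      by (intro set_integral_add borel_integrable_atLeastAtMost' continuous_on_subset[OF helical_dissipation_continuous sub[OF t]]) auto
    finally show ?thesis .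
  qed
  show ?thesis
    unfolding times_def[symmetric] det_integral_def[symmetric] u0
  proof (intro conjI ballI)
    fix t \<sigma> :: real assume t: "t \<in> times" and "\<sigma> \<in> {1, -1}"
    then have \<sigma>: "\<bar>\<sigma>\<bar> = 1" by auto
    show "(L2_norm (C_sign \<sigma> (1/2) (u t)))\<^sup>2
            + 2 * \<nu> * (LINT \<tau>:{0..t}|lborel. (L2_norm (C_sign \<sigma> (3/2) (u \<tau>)))\<^sup>2)
            + (LINT \<tau>:{0..t}|lborel. det_integral \<tau>) = (L2_norm (C_sign \<sigma> (1/2) (u 0)))\<^sup>2"
      unfolding EK(1)[OF \<sigma> t] EK(1)[OF \<sigma> zero[OF t]] by (rule A[OF \<sigma> t])
  next
    fix t assume t: "t \<in> times"
    show "(hom_sobolev_norm (1/2) (u t))\<^sup>2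
            + 2 * \<nu> * (LINT \<tau>:{0..t}|lborel. (hom_sobolev_norm (3/2) (u \<tau>))\<^sup>2)
            + 2 * (LINT \<tau>:{0..t}|lborel. det_integral \<tau>) = (hom_sobolev_norm (1/2) (u 0))\<^sup>2"
      unfolding hom(1)[OF t] hom(1)[OF zero[OF t]] B[OF t]
      using energy_identity[of 1, OF _ t] energy_identity[of "-1", OF _ t] by (simp add: distrib_left)
  qed
qed

end
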